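(* Fix $\epsilon\in(0,1)$. Then there exist constants $c=c(\epsilon)>0$ and $C=C(\epsilon)>0$ such that the following holds. For any probability distribution $\mu=(\mu_k)_{k\ge 0}$ on $\mathbb{N}=\{0,1,2,\dots\}$ with $\mu_0+\mu_1<1-\epsilon$ and $\mu_0/(\mu_0+\mu_1)>\epsilon$, for all $n$ sufficiently large (where how large may depend on $\mu$) for which $\mathbf{P}(|\mathrm{T}_\mu|=n)>0$, and for all $x>0$, $$\mathbf{P}\left(\mathrm{ht}(\mathrm{T}_{\mu,n})\ge x n^{1/2}\right)<C\exp(-cx^2).$$
   Context: A plane tree is a rooted, unlabeled finite tree in which the set of children of each node carries a (left-to-right) total order. $\mathrm{T}_\mu$ is the Bienaymé (Galton–Watson) tree with offspring distribution $\mu$, i.e. the family tree of a branching process with offspring distribution $\mu$; for every finite plane tree $\mathrm{t}$, $\mathbf{P}(\mathrm{T}_\mu=\mathrm{t})=\prod_{v}\mu_{d_{\mathrm{t}}(v)}$, where the product is over vertices $v$ of $\mathrm{t}$ and $d_{\mathrm{t}}(v)$ is the number of children of $v$. $|\mathrm{T}_\mu|$ is its number of vertices, and for $n$ with $\mathbf{P}(|\mathrm{T}_\mu|=n)>0$, $\mathrm{T}_{\mu,n}$ is $\mathrm{T}_\mu$ conditioned to have exactly $n$ vertices. The height $\mathrm{ht}(\mathrm{t})$ is the maximum graph distance from the root to a vertex of $\mathrm{t}$. *)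

theory Defs
  imports "HOL-Probability.Probability"
begin

text \<open>
  Plane trees in Ulam--Harris form: a node is the word of child indices leading to it from
  the root \<open>[]\<close>, and \<open>u @ [j]\<close> is the \<open>j\<close>-th child of \<open>u\<close> from the left, counting from 0.
\<close>

definition plane_tree :: "nat list set \<Rightarrow> bool" where
  "plane_tree t \<longleftrightarrow> finite t \<and> [] \<in> t \<and>
     (\<forall>u j. u @ [j] \<in> t \<longrightarrow> u \<in> t \<and> (\<forall>i<j. u @ [i] \<in> t))"

definition num_children :: "nat list set \<Rightarrow> nat list \<Rightarrow> nat" where
  "num_children t u = card {j. u @ [j] \<in> t}"

text \<open>
  The graph distance from the root to a node is the length of its word; meaningful for
  finite trees only.
\<close>

definition ht :: "nat list set \<Rightarrow> nat" where
  "ht t = Max (length ` t)"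

text \<open>The family tree of a population in which a potential individual \<open>u\<close> has \<open>\<xi> u\<close> children;
  it may be infinite.\<close>

inductive_set family_tree :: "(nat list \<Rightarrow> nat) \<Rightarrow> nat list set" for \<xi> where
  root: "[] \<in> family_tree \<xi>"
| child: "u \<in> family_tree \<xi> \<Longrightarrow> j < \<xi> u \<Longrightarrow> u @ [j] \<in> family_tree \<xi>"

text \<open>
  Independent offspring numbers with common law \<open>\<mu>\<close>. The random tree \<open>T\<^sub>\<mu>\<close> is
  \<open>family_tree \<xi>\<close> with \<open>\<xi>\<close> drawn from this space.
\<close>

definition branching :: "nat pmf \<Rightarrow> (nat list \<Rightarrow> nat) measure" where
  "branching \<mu> = Pi\<^sub>M UNIV (\<lambda>_. measure_pmf \<mu>)"

lemma prob_space_branching: "prob_space (branching \<mu>)"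
  unfolding branching_def by (intro prob_space_PiM measure_pmf.prob_space_axioms)

lemma space_branching [simp]: "space (branching \<mu>) = UNIV"
  by (simp add: branching_def space_PiM PiE_UNIV_domain)

lemma snoc_in_family_tree_iff:
  "u @ [j] \<in> family_tree \<xi> \<longleftrightarrow> u \<in> family_tree \<xi> \<and> j < \<xi> u"
  by (auto intro: family_tree.child elim: family_tree.cases)

lemma plane_tree_family_tree:
  "finite (family_tree \<xi>) \<Longrightarrow> plane_tree (family_tree \<xi>)"
  by (auto simp: plane_tree_def snoc_in_family_tree_iff family_tree.root)

lemma plane_tree_snoc_iff:
  assumes "plane_tree t"
  shows "u @ [j] \<in> t \<longleftrightarrow> j < num_children t u"
proof -
  let ?C = "{j. u @ [j] \<in> t}"
  have fin: "finite ?C"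
    using assms finite_vimageI[of t "\<lambda>j. u @ [j]"]
    by (simp add: plane_tree_def vimage_def inj_def)
  have down: "i \<in> ?C" if "j \<in> ?C" "i < j" for i j
    using assms that by (auto simp: plane_tree_def)
  show ?thesis
  proof
    assume "u @ [j] \<in> t"
    hence "{..j} \<subseteq> ?C"
      using down by (force simp: le_less)
    from card_mono[OF fin this] show "j < num_children t u"
      by (simp add: num_children_def)
  next
    assume j: "j < num_children t u"
    show "u @ [j] \<in> t"
    proof (rule ccontr)
      assume "u @ [j] \<notin> t"
      hence "i < j" if "i \<in> ?C" for i
        using that down[OF that, of j] by (cases i j rule: linorder_cases) simp_all
      hence "?C \<subseteq> {..<j}"
        by blast
      from card_mono[OF _ this] j show False
        by (simp add: num_children_def)
    qed
  qed
qed

lemma family_tree_eq_iff: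
  assumes t: "plane_tree t"
  shows "family_tree \<xi> = t \<longleftrightarrow> (\<forall>u\<in>t. \<xi> u = num_children t u)"
proof
  assume eq: "family_tree \<xi> = t"
  show "\<forall>u\<in>t. \<xi> u = num_children t u"
  proof
    fix u assume "u \<in> t"
    hence "{j. u @ [j] \<in> t} = {..<\<xi> u}"
      using snoc_in_family_tree_iff[of u _ \<xi>] by (auto simp: eq)
    thus "\<xi> u = num_children t u"
      by (simp add: num_children_def)
  qed
next
  assume *: "\<forall>u\<in>t. \<xi> u = num_children t u"
  have "u \<in> family_tree \<xi> \<longleftrightarrow> u \<in> t" for u
  proof (induction u rule: rev_induct)
    case Nil
    show ?case
      using t by (simp add: plane_tree_def family_tree.root)
  next
    case (snoc j u)
    have "u @ [j] \<in> t \<longrightarrow> u \<in> t"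
      using t by (auto simp: plane_tree_def)
    thus ?case
      using snoc.IH * plane_tree_snoc_iff[OF t, of u j] by (auto simp: snoc_in_family_tree_iff)
  qed
  thus "family_tree \<xi> = t"
    by blast
qed

lemma cylinder_in_sets_branching:
  assumes "finite t"
  shows "{\<xi>. \<forall>u\<in>t. \<xi> u = d u} \<in> sets (branching \<mu>)"
proof -
  have "{\<xi> \<in> space (branching \<mu>). \<xi> u = d u} \<in> sets (branching \<mu>)" for u
    using measurable_sets[OF measurable_component_singleton[of u UNIV "\<lambda>_. measure_pmf \<mu>"], of "{d u}"]
    by (simp add: branching_def space_PiM PiE_UNIV_domain vimage_def)
  hence "{\<xi> \<in> space (branching \<mu>). \<forall>u\<in>t. \<xi> u = d u} \<in> sets (branching \<mu>)"
    using assms by (rule sets.sets_Collect_finite_All)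
  thus ?thesis by simp
qed

lemma prob_family_tree:
  assumes t: "plane_tree t"
  shows "\<P>(\<xi> in branching \<mu>. family_tree \<xi> = t) = (\<Prod>u\<in>t. pmf \<mu> (num_children t u))"
proof -
  interpret product_prob_space "\<lambda>_. measure_pmf \<mu>" "UNIV :: nat list set"
    by unfold_locales
  have fin: "finite t"
    using t by (simp add: plane_tree_def)
  have "emeasure (branching \<mu>) {\<xi>. \<forall>u\<in>t. \<xi> u \<in> {num_children t u}}
      = (\<Prod>u\<in>t. emeasure (measure_pmf \<mu>) {num_children t u})"
    using emeasure_PiM_Collect[of t "\<lambda>u. {num_children t u}"] fin
    by (simp add: branching_def space_PiM PiE_UNIV_domain)
  also have "\<dots> = ennreal (\<Prod>u\<in>t. pmf \<mu> (num_children t u))"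
    by (simp add: emeasure_pmf_single prod_ennreal)
  finally show ?thesis
    by (simp add: family_tree_eq_iff[OF t] measure_def prod_nonneg)
qed

lemma family_tree_event_in_sets:
  "{\<xi>. finite (family_tree \<xi>) \<and> P (family_tree \<xi>)} \<in> sets (branching \<mu>)"
proof -
  let ?F = "{t. plane_tree t \<and> P t}"
  have "finite (family_tree \<xi>) \<and> P (family_tree \<xi>) \<longleftrightarrow> (\<exists>t\<in>?F. family_tree \<xi> = t)" for \<xi>
    using plane_tree_family_tree[of \<xi>] by (auto simp: plane_tree_def)
  moreover have "(\<exists>t\<in>?F. family_tree \<xi> = t) \<longleftrightarrow> (\<exists>t\<in>?F. \<forall>u\<in>t. \<xi> u = num_children t u)" for \<xi>
    by (intro bex_cong refl) (simp add: family_tree_eq_iff)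
  ultimately have "{\<xi>. finite (family_tree \<xi>) \<and> P (family_tree \<xi>)} =
      (\<Union>t\<in>?F. {\<xi>. \<forall>u\<in>t. \<xi> u = num_children t u})"
    by blast
  moreover have "countable ?F"
    by (rule countable_subset[OF _ countable_Collect_finite]) (auto simp: plane_tree_def)
  moreover have "(\<Union>t\<in>?F. {\<xi>. \<forall>u\<in>t. \<xi> u = num_children t u}) \<in> sets (branching \<mu>)"
    if "countable ?F"
    using that by (rule sets.countable_UN') (auto intro!: cylinder_in_sets_branching simp: plane_tree_def)
  ultimately show ?thesis
    by simp
qed

end

theory Submission
  imports Defs
begin

text \<open>
  Labeling the vertices turns the conditioned tree into a mixture, over degree sequences, of uniform
  labeled plane trees with given degrees, each degree sequence of length \<open>n\<close> and total \<open>n - 1\<close>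
  carrying \<open>(n - 1)!\<close> trees. Outside an event of probability \<open>exp (- c n)\<close>, which is harmless since
  the height is less than \<open>n\<close>, there are at least \<open>\<delta> n\<close> leaves. For such a degree sequence,
  the ancestral line of a leaf is revealed by sampling slots without replacement, as in a
  line-breaking construction: the subtree spanned by \<open>k\<close> leaves has at least of order \<open>sqrt (k n)\<close> free slots
  except with probability \<open>exp (- k)\<close>, and then any further vertex is at distance more than \<open>y\<close> from it with
  probability at most \<open>exp (- c y sqrt (k / n))\<close>. Chaining over \<open>k = 4 ^ i K\<close> with \<open>K\<close> of order \<open>x\<^sup>2\<close>
  bounds the height by a multiple of \<open>sqrt (K n)\<close>.
\<close>

section \<open>Trees as slot assignments\<close>

text \<open>The law \<mu> may be subcritical, supercritical or heavy-tailed, so the conditioning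
  event can be exponentially unlikely. Hence every estimate compares two weighted counts for the
  same \<open>n\<close>, and probabilities return only at the end, as a quotient. Few leaves require
  almost all vertices to have one child; the hypotheses on \<mu> make it profitable to exchange ones
  for balanced mixtures of zeros and larger numbers, and the length of the exchanged block is what
  makes the threshold for \<open>n\<close> depend on \<mu>. Uniformity enters through one fact:
  after a vertex is merged into its parent, the remaining tree is again uniform in a class of the
  same kind, whose size depends only on the numbers of vertices and of root slots. So a revealed
  line is controlled by one counter, the root slots plus the slots of the current vertex, minus one.
  The line rarely ends while this counter is small, but many leaves force many slots at vertices
  with at least two children, which push it up. Thus the height bound involves the degrees only
  through \<delta>.\<close>

text \<open>
  A labeled plane tree is encoded by the map sending each vertex of \<open>W\<close> to the slot of its parent
  that it occupies; \<open>own s\<close> is the vertex offering the slot \<open>s\<close>, and slots owned by something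
  outside \<open>W\<close> are slots of the root. With a general owner function the class is closed under
  contracting a vertex into its parent, which is what every count below is an induction on.
\<close>

definition slot_trees :: "'v set \<Rightarrow> 's set \<Rightarrow> ('s \<Rightarrow> 'v) \<Rightarrow> ('v \<Rightarrow> 's) set" where
  "slot_trees W S own = {p \<in> W \<rightarrow>\<^sub>E S. bij_betw p W S \<and>
     (\<exists>f :: 'v \<Rightarrow> nat. \<forall>v\<in>W. own (p v) \<in> W \<longrightarrow> f (own (p v)) < f v)}"

text \<open>Contracting \<open>v\<close> into the owner of the slot \<open>s\<close> it occupies hands the slots of \<open>v\<close> over to that owner.\<close>

definition redirect :: "('s \<Rightarrow> 'v) \<Rightarrow> 'v \<Rightarrow> 's \<Rightarrow> 's \<Rightarrow> 'v" where
  "redirect own v s = (\<lambda>t. if own t = v then own s else own t)"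

lemma finite_slot_trees: "finite W \<Longrightarrow> finite S \<Longrightarrow> finite (slot_trees W S own)"
  unfolding slot_trees_def by (rule finite_subset[of _ "W \<rightarrow>\<^sub>E S"]) (auto intro: finite_PiE)

lemma slot_trees_parent_neq:
  assumes "p \<in> slot_trees W S own" "v \<in> W"
  shows "own (p v) \<noteq> v"
proof
  assume "own (p v) = v"
  with assms show False by (force simp: slot_trees_def)
qed

text \<open>The rank function of \<open>p\<close> serves unchanged: a child \<open>w\<close> of
  \<open>v\<close> moves up to \<open>own (p v)\<close>, and
  \<open>f (own (p v)) < f v < f w\<close>.\<close>

lemma slot_trees_contract:
  assumes v: "v \<in> W" and p: "p \<in> slot_trees W S own"
  shows "p v \<in> S" "own (p v) \<noteq> v"
    "restrict p (W - {v}) \<in> slot_trees (W - {v}) (S - {p v}) (redirect own v (p v))"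
proof -
  from p have pE: "p \<in> W \<rightarrow>\<^sub>E S" and bij: "bij_betw p W S"
    by (auto simp: slot_trees_def)
  from p obtain f :: "'a \<Rightarrow> nat" where f: "\<And>w. w \<in> W \<Longrightarrow> own (p w) \<in> W \<Longrightarrow> f (own (p w)) < f w"
    by (auto simp: slot_trees_def)
  show "p v \<in> S" using bij_betwE[OF bij] v by simp
  show "own (p v) \<noteq> v" using slot_trees_parent_neq[OF p v] .
  have bij': "bij_betw p (W - {v}) (S - {p v})"
    using bij v bij_betwE[OF bij] by (intro bij_betw_DiffI) auto
  have "bij_betw (restrict p (W - {v})) (W - {v}) (S - {p v})"
    using bij' by (rule bij_betw_cong[THEN iffD1, rotated]) simp
  moreover from this have "restrict p (W - {v}) \<in> (W - {v}) \<rightarrow>\<^sub>E (S - {p v})"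
    by (auto dest: bij_betwE)
  moreover have "f (redirect own v (p v) (restrict p (W - {v}) w)) < f w"
    if "w \<in> W - {v}" "redirect own v (p v) (restrict p (W - {v}) w) \<in> W - {v}" for w
    using that v f[of w] f[of v] by (auto simp: redirect_def split: if_splits)
  ultimately show "restrict p (W - {v}) \<in> slot_trees (W - {v}) (S - {p v}) (redirect own v (p v))"
    unfolding slot_trees_def by blast
qed

lemma slot_trees_expand:
  assumes v: "v \<in> W" and s: "s \<in> S" "own s \<noteq> v"
    and q: "q \<in> slot_trees (W - {v}) (S - {s}) (redirect own v s)"
  shows "q(v := s) \<in> slot_trees W S own"
proof -
  from q have qE: "q \<in> (W - {v}) \<rightarrow>\<^sub>E (S - {s})" and bij: "bij_betw q (W - {v}) (S - {s})"
    by (auto simp: slot_trees_def)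
  from q obtain f :: "'a \<Rightarrow> nat" where
    f: "\<And>w. w \<in> W - {v} \<Longrightarrow> redirect own v s (q w) \<in> W - {v} \<Longrightarrow> f (redirect own v s (q w)) < f w"
    by (auto simp: slot_trees_def)
  \<comment> \<open>Ranks are doubled to make room: \<open>v\<close> gets an even value strictly
    between its parent and its children, whose ranks are odd. If \<open>own s\<close> lies outside
    \<open>W\<close>, the value 0 is below all odd ranks.\<close>
  define g where "g = (\<lambda>w. if w = v then if own s \<in> W then 2 * f (own s) + 2 else 0 else 2 * f w + 1)"
  have "bij_betw (q(v := s)) (W - {v}) (S - {s})"
    using bij by (rule bij_betw_cong[THEN iffD1, rotated]) auto
  then have "bij_betw (q(v := s)) ((W - {v}) \<union> {v}) ((S - {s}) \<union> {s})"
    by (rule bij_betw_combine) auto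
  then have bij': "bij_betw (q(v := s)) W S"
    using v s by (simp add: insert_absorb)
  show ?thesis
    unfolding slot_trees_def
  proof (intro CollectI conjI exI[of _ g] ballI impI)
    show "bij_betw (q(v := s)) W S" by fact
    show "q(v := s) \<in> W \<rightarrow>\<^sub>E S"
      using qE v s by (auto simp: PiE_iff extensional_def)
    fix w assume w: "w \<in> W" and o: "own ((q(v := s)) w) \<in> W"
    show "g (own ((q(v := s)) w)) < g w"
    proof (cases "w = v")
      case True
      then show ?thesis using o s by (simp add: g_def)
    next
      case False
      show ?thesis
      proof (cases "own (q w) = v")
        case True
        then show ?thesis
          using o w s False f[of w] by (cases "own s \<in> W") (auto simp: g_def redirect_def)
      next
        case neq: False
        then show ?thesis
          using o w False f[of w] by (simp add: g_def redirect_def)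
      qed
    qed
  qed
qed

lemma slot_trees_contract_bij:
  assumes v: "v \<in> W"
  shows "bij_betw (\<lambda>(s, q). q(v := s))
    (SIGMA s:{s\<in>S. own s \<noteq> v}. slot_trees (W - {v}) (S - {s}) (redirect own v s))
    (slot_trees W S own)"
  (is "bij_betw ?F ?X ?Y")
proof (rule bij_betw_byWitness[where f' = "\<lambda>p. (p v, restrict p (W - {v}))"])
  show "\<forall>a\<in>?X. (\<lambda>p. (p v, restrict p (W - {v}))) (?F a) = a"
  proof (intro ballI)
    fix x assume "x \<in> ?X"
    then obtain s q where x: "x = (s, q)" "q \<in> slot_trees (W - {v}) (S - {s}) (redirect own v s)"
      by auto
    then have "q \<in> extensional (W - {v})" by (simp add: slot_trees_def PiE_iff)
    then have "restrict (q(v := s)) (W - {v}) = q"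
      by (auto simp: fun_eq_iff extensional_def)
    then show "(\<lambda>p. (p v, restrict p (W - {v}))) (?F x) = x"
      by (simp add: x)
  qed
  show "\<forall>p\<in>?Y. ?F (p v, restrict p (W - {v})) = p"
    using v by (auto simp: slot_trees_def fun_eq_iff PiE_iff extensional_def)
  show "?F ` ?X \<subseteq> ?Y"
    using slot_trees_expand[OF v] by auto
  show "(\<lambda>p. (p v, restrict p (W - {v}))) ` ?Y \<subseteq> ?X"
    using slot_trees_contract[OF v] by blast
qed

text \<open>The first-step decomposition behind all later probabilities: given the slot
  \<open>s\<close> of \<open>v\<close>, the contracted tree ranges over its whole class and so is
  again uniform.\<close>

lemma card_slot_trees_contract:
  assumes v: "v \<in> W" and fin: "finite W" "finite S"
  shows "card {p \<in> slot_trees W S own. Q p} =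
    (\<Sum>s | s \<in> S \<and> own s \<noteq> v.
       card {q \<in> slot_trees (W - {v}) (S - {s}) (redirect own v s). Q (q(v := s))})"
proof -
  have "bij_betw (\<lambda>(s, q). q(v := s))
     (SIGMA s:{s\<in>S. own s \<noteq> v}. {q \<in> slot_trees (W - {v}) (S - {s}) (redirect own v s). Q (q(v := s))})
     {p \<in> slot_trees W S own. Q p}" (is "bij_betw _ ?X _")
  proof (rule bij_betw_subset[OF slot_trees_contract_bij[OF v]])
    show "(\<lambda>(s, q). q(v := s)) ` ?X = {p \<in> slot_trees W S own. Q p}"
    proof (intro equalityI subsetI)
      fix p assume p: "p \<in> {p \<in> slot_trees W S own. Q p}"
      then obtain s q where "p = q(v := s)" "s \<in> S" "own s \<noteq> v"
        "q \<in> slot_trees (W - {v}) (S - {s}) (redirect own v s)"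
        using bij_betw_imp_surj_on[OF slot_trees_contract_bij[OF v, of S own]] by force
      then show "p \<in> (\<lambda>(s, q). q(v := s)) ` ?X"
        using p by (intro image_eqI[of _ _ "(s, q)"]) auto
    qed (use slot_trees_expand[OF v] in auto)
  qed auto
  from bij_betw_same_card[OF this] show ?thesis
    using fin by (subst (asm) card_SigmaI) (simp_all add: finite_slot_trees)
qed

section \<open>Counting by contraction\<close>

definition root_slots :: "'v set \<Rightarrow> 's set \<Rightarrow> ('s \<Rightarrow> 'v) \<Rightarrow> 's set" where
  "root_slots W S own = {s \<in> S. own s \<notin> W}"

definition slot_deg :: "'s set \<Rightarrow> ('s \<Rightarrow> 'v) \<Rightarrow> 'v \<Rightarrow> nat" where
  "slot_deg S own v = card {s \<in> S. own s = v}"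

lemma slot_deg_contract:
  assumes fin: "finite S" and s: "s \<in> S" "own s \<noteq> v" and u: "u \<noteq> v"
  shows "slot_deg (S - {s}) (redirect own v s) u =
    (if u = own s then slot_deg S own u + slot_deg S own v - 1 else slot_deg S own u)"
proof (cases "u = own s")
  case True
  have eq: "{t \<in> S - {s}. redirect own v s t = u} = ({t\<in>S. own t = u} - {s}) \<union> {t\<in>S. own t = v}"
    using True u s by (auto simp: redirect_def)
  have "card ({t\<in>S. own t = u} - {s}) = slot_deg S own u - 1"
    unfolding slot_deg_def using True s fin by (subst card_Diff_singleton) auto
  moreover have "slot_deg S own u > 0"
    using True s fin by (auto simp: slot_deg_def card_gt_0_iff)
  ultimately show ?thesis
    using True fin u by (subst slot_deg_def, subst eq, subst card_Un_disjoint) (auto simp: slot_deg_def)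
next
  case False
  then have "{t \<in> S - {s}. redirect own v s t = u} = {t\<in>S. own t = u}"
    using u by (auto simp: redirect_def)
  then show ?thesis using False by (simp add: slot_deg_def)
qed

lemma card_root_slots_contract:
  assumes fin: "finite S" and s: "s \<in> S" "own s \<noteq> v" and v: "v \<in> W"
  shows "card (root_slots (W - {v}) (S - {s}) (redirect own v s)) =
    (if own s \<in> W then card (root_slots W S own)
     else card (root_slots W S own) + slot_deg S own v - 1)"
proof (cases "own s \<in> W")
  case False
  have eq: "root_slots (W - {v}) (S - {s}) (redirect own v s) = (root_slots W S own - {s}) \<union> {t\<in>S. own t = v}"
    using False s v by (auto simp: redirect_def root_slots_def)
  have "card (root_slots W S own - {s}) = card (root_slots W S own) - 1"
    using False s fin by (subst card_Diff_singleton) (auto simp: root_slots_def)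
  moreover have "card (root_slots W S own) > 0"
    using False s fin by (auto simp: root_slots_def card_gt_0_iff)
  ultimately show ?thesis
    using False fin v
    by (subst eq, subst card_Un_disjoint) (auto simp: slot_deg_def root_slots_def)
next
  case True
  then have "root_slots (W - {v}) (S - {s}) (redirect own v s) = root_slots W S own"
    using s v by (auto simp: redirect_def root_slots_def)
  then show ?thesis using True by simp
qed

lemma card_slots_split:
  assumes "finite S" "v \<in> W"
  shows "card S = card (root_slots W S own) + slot_deg S own v + card {s\<in>S. own s \<in> W - {v}}"
proof -
  have "S = root_slots W S own \<union> {s\<in>S. own s = v} \<union> {s\<in>S. own s \<in> W - {v}}"
    by (auto simp: root_slots_def)
  from arg_cong[OF this, of card]
  have "card S = card (root_slots W S own \<union> {s\<in>S. own s = v} \<union> {s\<in>S. own s \<in> W - {v}})" .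
  also have "\<dots> = card (root_slots W S own \<union> {s\<in>S. own s = v}) + card {s\<in>S. own s \<in> W - {v}}"
    using assms by (intro card_Un_disjoint) (auto simp: root_slots_def)
  also have "card (root_slots W S own \<union> {s\<in>S. own s = v}) = card (root_slots W S own) + slot_deg S own v"
    unfolding slot_deg_def using assms by (intro card_Un_disjoint) (auto simp: root_slots_def)
  finally show ?thesis .
qed

lemma sum_noteq_split:
  assumes "finite S" "v \<in> W"
  shows "(\<Sum>s | s \<in> S \<and> own s \<noteq> v. g s) = (\<Sum>s | s \<in> S \<and> own s \<in> W - {v}. g s) + sum g (root_slots W S own)"
proof -
  have "{s. s \<in> S \<and> own s \<noteq> v} = {s. s \<in> S \<and> own s \<in> W - {v}} \<union> root_slots W S own"
    using assms by (auto simp: root_slots_def)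
  then show ?thesis
    using assms by (simp, subst sum.union_disjoint) (auto simp: root_slots_def)
qed

text \<open>Sum over the slot of a vertex with \<open>d\<close> slots, \<open>r\<close> being the
  number of root slots. A non-root slot leaves \<open>r\<close> root slots; a root slot is replaced
  by the slots of the vertex, leaving \<open>r + d - 1\<close>. Since \<open>card S\<close> splits
  into non-root, root and own slots, both contributions combine to one factor.\<close>

lemma card_slot_trees:
  assumes "finite W" "finite S" "card W = Suc k" "card S = Suc k"
  shows "card (slot_trees W S own) = card (root_slots W S own) * fact k"
  using assms
proof (induction k arbitrary: W S own)
  case 0
  then obtain v s where W: "W = {v}" and S: "S = {s}"
    by (auto simp: card_Suc_eq)
  have e: "slot_trees {} {} own' = {\<lambda>x. undefined}" for own' :: "'b \<Rightarrow> 'a"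
    by (auto simp: slot_trees_def bij_betw_def)
  show ?case
    using card_slot_trees_contract[of v W S own "\<lambda>_. True"]
    by (cases "own s = v") (auto simp: W S e root_slots_def if_distrib cong: conj_cong)
next
  case (Suc k)
  then obtain v where v: "v \<in> W" by fastforce
  let ?r = "card (root_slots W S own)" and ?d = "slot_deg S own v"
  let ?A = "{s \<in> S. own s \<in> W - {v}}"
  have "card (slot_trees W S own) = (\<Sum>s | s \<in> S \<and> own s \<noteq> v.
       card (slot_trees (W - {v}) (S - {s}) (redirect own v s)))"
    using card_slot_trees_contract[OF v Suc.prems(1,2), of own "\<lambda>_. True"] by simp
  also have "\<dots> = (\<Sum>s | s \<in> S \<and> own s \<noteq> v. (if own s \<in> W then ?r else ?r + ?d - 1) * fact k)"
  proof (rule sum.cong[OF refl])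
    fix s assume s: "s \<in> {s. s \<in> S \<and> own s \<noteq> v}"
    have "card (slot_trees (W - {v}) (S - {s}) (redirect own v s)) =
       card (root_slots (W - {v}) (S - {s}) (redirect own v s)) * fact k"
      using Suc.prems s v by (intro Suc.IH) auto
    then show "card (slot_trees (W - {v}) (S - {s}) (redirect own v s)) = (if own s \<in> W then ?r else ?r + ?d - 1) * fact k"
      using card_root_slots_contract[of S s own v W] s v Suc.prems by simp
  qed
  also have "\<dots> = card ?A * ?r * fact k + ?r * (?r + ?d - 1) * fact k"
    using Suc.prems v by (subst sum_noteq_split[of S v W]) (auto simp: root_slots_def)
  also have "\<dots> = ?r * fact (Suc k)"
  proof (cases "?r = 0")
    case False
    have "card ?A + (?r + ?d - 1) = Suc k"
      using card_slots_split[OF Suc.prems(2) v, of own] Suc.prems False by auto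
    then have "?r * (card ?A + (?r + ?d - 1)) * fact k = ?r * (Suc k) * fact k" by simp
    then show ?thesis by (simp add: algebra_simps)
  qed simp
  finally show ?case .
qed

text \<open>
  One step of revealing the ancestral line of \<open>v\<close>: the parent slot of \<open>v\<close> is each given non-root slot
  with probability \<open>1 / (card W - 1)\<close>, and a root slot with total probability
  \<open>\<rho> / (card W - 1)\<close>, where \<open>\<rho>\<close> is one less than the number of root slots and slots of \<open>v\<close>.
\<close>

lemma card_slot_trees_step:
  fixes b :: "'s \<Rightarrow> real" and own :: "'s \<Rightarrow> 'v"
  assumes fin: "finite W" "finite S" and k: "card S = card W" "card W \<ge> 2" and v: "v \<in> W"
  assumes nonroot: "\<And>s. s \<in> S \<Longrightarrow> own s \<in> W - {v} \<Longrightarrow>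
      real (card {q \<in> slot_trees (W - {v}) (S - {s}) (redirect own v s). Q (q(v := s))})
        \<le> b s * real (card (slot_trees (W - {v}) (S - {s}) (redirect own v s)))"
    and root: "\<And>s. s \<in> S \<Longrightarrow> own s \<notin> W \<Longrightarrow>
      real (card {q \<in> slot_trees (W - {v}) (S - {s}) (redirect own v s). Q (q(v := s))})
        \<le> c * real (card (slot_trees (W - {v}) (S - {s}) (redirect own v s)))"
    and B: "(\<Sum>s | s \<in> S \<and> own s \<in> W - {v}. b s) +
        (real (card (root_slots W S own)) + real (slot_deg S own v) - 1) * c \<le> B * (real (card W) - 1)"
  shows "real (card {p \<in> slot_trees W S own. Q p}) \<le> B * real (card (slot_trees W S own))"
proof -
  let ?r = "card (root_slots W S own)" and ?d = "slot_deg S own v"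
  obtain k' where k': "card W = Suc (Suc k')"
    using k by (metis Suc_le_D numeral_2_eq_2 Suc_le_mono)
  have sub: "card (slot_trees (W - {v}) (S - {s}) (redirect own v s)) = (if own s \<in> W then ?r else ?r + ?d - 1) * fact k'"
    if s: "s \<in> S" "own s \<noteq> v" for s
    using card_slot_trees[of "W - {v}" "S - {s}" k' "redirect own v s"] fin k k' v s
      card_root_slots_contract[of S s own v W] by simp
  have "real (card {p \<in> slot_trees W S own. Q p}) =
     (\<Sum>s | s \<in> S \<and> own s \<noteq> v. real (card {q \<in> slot_trees (W - {v}) (S - {s}) (redirect own v s). Q (q(v := s))}))"
    using card_slot_trees_contract[OF v fin, of own Q] by simp
  also have "\<dots> = (\<Sum>s | s \<in> S \<and> own s \<in> W - {v}. real (card {q \<in> slot_trees (W - {v}) (S - {s}) (redirect own v s). Q (q(v := s))}))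
     + (\<Sum>s\<in>root_slots W S own. real (card {q \<in> slot_trees (W - {v}) (S - {s}) (redirect own v s). Q (q(v := s))}))"
    by (rule sum_noteq_split[OF fin(2) v])
  also have "\<dots> \<le> (\<Sum>s | s \<in> S \<and> own s \<in> W - {v}. b s * (?r * fact k')) +
     (\<Sum>s\<in>root_slots W S own. c * ((real ?r + ?d - 1) * fact k'))"
  proof (intro add_mono sum_mono)
    fix s assume "s \<in> {s \<in> S. own s \<in> W - {v}}"
    then show "real (card {q \<in> slot_trees (W - {v}) (S - {s}) (redirect own v s). Q (q(v := s))}) \<le> b s * (?r * fact k')"
      using nonroot[of s] sub[of s] by auto
  next
    fix s assume s: "s \<in> root_slots W S own"
    then have "?r > 0" using fin by (auto simp: root_slots_def card_gt_0_iff)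
    then have "real (?r + ?d - 1) = real ?r + ?d - 1" by (simp add: of_nat_diff)
    moreover have "card (slot_trees (W - {v}) (S - {s}) (redirect own v s)) = (?r + ?d - 1) * fact k'"
      using sub[of s] s v by (auto simp: root_slots_def)
    ultimately have "real (card (slot_trees (W - {v}) (S - {s}) (redirect own v s))) = (real ?r + ?d - 1) * fact k'"
      by (metis of_nat_mult of_nat_fact)
    then show "real (card {q \<in> slot_trees (W - {v}) (S - {s}) (redirect own v s). Q (q(v := s))}) \<le> c * ((real ?r + ?d - 1) * fact k')"
      using root[of s] s by (simp add: root_slots_def)
  qed
  also have "\<dots> = ((\<Sum>s | s \<in> S \<and> own s \<in> W - {v}. b s) + (real ?r + real ?d - 1) * c) * (?r * fact k')"
    by (simp add: sum_distrib_right[symmetric]) (simp add: algebra_simps)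
  also have "\<dots> \<le> (B * (real (card W) - 1)) * (?r * fact k')"
    by (intro mult_right_mono B) auto
  also have "\<dots> = B * real (card (slot_trees W S own))"
    using card_slot_trees[of W S "Suc k'" own] fin k k' by (simp add: algebra_simps)
  finally show ?thesis .
qed

text \<open>Count both sides of \<open>card S = card W\<close>: vertices of degree one own as many
  slots as there are of them and cancel, which leaves a comparison of leaves with slots of branching
  vertices. This is how leaves guarantee frequent increases of \<rho>.\<close>

lemma slots_of_branching_vertices:
  fixes own :: "'s \<Rightarrow> 'v"
  assumes fin: "finite W" "finite S" and k: "card S = card W" and v: "v \<in> W"
  shows "real (card {u \<in> W - {v}. slot_deg S own u = 0}) \<le>
     real (card {s \<in> S. own s \<in> W - {v} \<and> slot_deg S own (own s) \<ge> 2})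
     + real (card (root_slots W S own)) + real (slot_deg S own v) - 1"
proof -
  let ?W = "W - {v}" and ?d = "slot_deg S own"
  let ?L = "{u\<in>?W. ?d u = 0}" and ?U = "{u\<in>?W. ?d u = 1}" and ?B = "{u\<in>?W. ?d u \<ge> 2}"
  have sl: "card {s\<in>S. own s \<in> X} = (\<Sum>u\<in>X. ?d u)" if "finite X" for X
  proof -
    have "{s\<in>S. own s \<in> X} = (\<Union>u\<in>X. {s\<in>S. own s = u})" by auto
    then have "card {s\<in>S. own s \<in> X} = card (\<Union>u\<in>X. {s\<in>S. own s = u})" by simp
    also have "\<dots> = (\<Sum>u\<in>X. ?d u)"
      unfolding slot_deg_def using that fin by (intro card_UN_disjoint) auto
    finally show ?thesis .
  qed
  have "{s\<in>S. own s \<in> ?W} = {s\<in>S. own s \<in> ?U} \<union> {s\<in>S. own s \<in> ?B}"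
  proof -
    have "?d (own s) > 0" if "s \<in> S" for s
      using that fin by (auto simp: slot_deg_def card_gt_0_iff)
    then show ?thesis by fastforce
  qed
  then have h1: "card {s\<in>S. own s \<in> ?W} = card {s\<in>S. own s \<in> ?U} + card {s\<in>S. own s \<in> ?B}"
    using fin by (simp, subst card_Un_disjoint) auto
  have h2: "card {s\<in>S. own s \<in> ?U} = card ?U"
    using fin by (subst sl) auto
  have "?W = ?L \<union> ?U \<union> ?B" by auto
  from arg_cong[OF this, of card] have "card ?W = card (?L \<union> ?U \<union> ?B)" .
  also have "\<dots> = card (?L \<union> ?U) + card ?B"
    using fin by (intro card_Un_disjoint) auto
  also have "card (?L \<union> ?U) = card ?L + card ?U"
    using fin by (intro card_Un_disjoint) auto
  finally have h3: "card ?W = card ?L + card ?U + card ?B" .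
  have h4: "card W = Suc (card ?W)"
    by (rule card.remove[OF fin(1) v])
  have h5: "card {s \<in> S. own s \<in> ?W \<and> ?d (own s) \<ge> 2} = card {s\<in>S. own s \<in> ?B}"
    by (rule arg_cong[where f = card]) auto
  have arith: "real l \<le> real h + real r + real e - 1"
    if "w = u' + b'" "u' = u" "w' = l + u + b" "cw = Suc w'" "h = b'" "cs = r + e + w" "cs = cw"
    for w u' b' u w' l b cw h cs r e :: nat
    using that by simp
  show ?thesis
    by (rule arith[OF h1 h2 h3 h4 h5 card_slots_split[OF fin(2) v] k])
qed

section \<open>Ancestral lines\<close>

text \<open>Depth and distance are expressed by orbits that stay in a set. For
  \<open>f = own \<circ> p\<close>, the choice \<open>X = W\<close> says that \<open>v\<close> has
  depth at least \<open>y\<close>, since the owner of a root slot lies outside \<open>W\<close>;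
  with a spanned subtree removed from \<open>X\<close>, the line of \<open>v\<close> does not meet
  that subtree within \<open>y\<close> steps.\<close>

fun orbit_in :: "'v set \<Rightarrow> ('v \<Rightarrow> 'v) \<Rightarrow> nat \<Rightarrow> 'v \<Rightarrow> bool" where
  "orbit_in X f 0 v \<longleftrightarrow> v \<in> X"
| "orbit_in X f (Suc y) v \<longleftrightarrow> v \<in> X \<and> orbit_in X f y (f v)"

lemma orbit_in_mem: "orbit_in X f y v \<Longrightarrow> v \<in> X"
  by (cases y) auto

lemma orbit_in_antimono: "orbit_in X f y v \<Longrightarrow> z \<le> y \<Longrightarrow> orbit_in X f z v"
proof (induction y arbitrary: z v)
  case (Suc y)
  then show ?case by (cases z) (auto dest: orbit_in_mem)
qed auto

text \<open>Leaving \<open>X\<close> ends an orbit for good, so two maps may differ in where they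
  leave to. Contraction changes owners in just this way.\<close>

lemma orbit_in_cong:
  assumes "\<And>v. v \<in> X \<Longrightarrow> f v = g v \<or> (f v \<notin> X \<and> g v \<notin> X)"
  shows "orbit_in X f y v \<longleftrightarrow> orbit_in X g y v"
proof (induction y arbitrary: v)
  case (Suc y)
  show ?case using assms[of v] Suc.IH[of "f v"] Suc.IH[of "g v"]
    by (metis orbit_in.simps(2) orbit_in_mem)
qed auto

text \<open>By acyclicity the line above \<open>v\<close> never returns to \<open>v\<close>, so
  redirecting the slots of \<open>v\<close> does not affect it.\<close>

lemma orbit_in_contract:
  fixes own :: "'s \<Rightarrow> 'v"
  assumes v: "v \<in> W" and s: "s \<in> S" "own s \<noteq> v"
    and q: "q \<in> slot_trees (W - {v}) (S - {s}) (redirect own v s)"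
    and o: "orbit_in W (own \<circ> q(v := s)) (Suc y) v"
  shows "orbit_in (W - {v}) (redirect own v s \<circ> q) y (own s)"
proof -
  have "q(v := s) \<in> slot_trees W S own"
    by (rule slot_trees_expand[OF v s q])
  then obtain f :: "'v \<Rightarrow> nat" where
    f: "\<And>w. w \<in> W \<Longrightarrow> own ((q(v := s)) w) \<in> W \<Longrightarrow> f (own ((q(v := s)) w)) < f w"
    by (auto simp: slot_trees_def)
  have main: "orbit_in (W - {v}) (redirect own v s \<circ> q) y u"
    if "orbit_in W (own \<circ> q(v := s)) y u" "f u < f v" for u
    using that
  proof (induction y arbitrary: u)
    case (Suc y)
    let ?u = "own ((q(v := s)) u)"
    have u: "u \<in> W" "u \<noteq> v" and o': "orbit_in W (own \<circ> q(v := s)) y ?u"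
      using Suc.prems by (auto simp: comp_def)
    have "f ?u < f u" using f[of u] u orbit_in_mem[OF o'] by simp
    with Suc.prems have lt: "f ?u < f v" by simp
    then have "?u \<noteq> v" by auto
    then show ?case using Suc.IH[OF o' lt] u by (simp add: redirect_def)
  qed auto
  have "orbit_in W (own \<circ> q(v := s)) y (own s)" using o by (simp add: comp_def)
  moreover from this have "f (own s) < f v"
    using f[of v] v orbit_in_mem by fastforce
  ultimately show ?thesis by (rule main)
qed

lemma card_root_slots_pos:
  assumes "finite W" "finite S" "card W = card S" "W \<noteq> {}" "slot_trees W S own \<noteq> {}"
  shows "card (root_slots W S own) > 0"
proof -
  obtain k where "card W = Suc k" using assms by (metis card_gt_0_iff gr0_implies_Suc)
  then have "card (slot_trees W S own) = card (root_slots W S own) * fact k"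
    using assms by (intro card_slot_trees) auto
  moreover have "card (slot_trees W S own) > 0"
    using assms by (simp add: card_gt_0_iff finite_slot_trees)
  ultimately show ?thesis by (metis mult_0 not_gr_zero)
qed

text \<open>\<open>own s\<close> offers \<open>s\<close> and so is no leaf before the contraction;
  afterwards it may be one, but then it is excluded as the new current vertex. Thus a lower bound on
  the other leaves survives every step along a line.\<close>

lemma leaves_contract:
  assumes "finite S" "s \<in> S" "own s \<noteq> v" "v \<in> W"
  shows "{u \<in> W - {v} - {own s}. slot_deg (S - {s}) (redirect own v s) u = 0} =
    {u \<in> W - {v}. slot_deg S own u = 0}"
proof -
  have "slot_deg S own (own s) > 0"
    using assms by (auto simp: slot_deg_def card_gt_0_iff)
  then show ?thesis
    using assms by (auto simp: slot_deg_contract)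
qed

lemma one_minus_exp_ge_half:
  fixes \<beta> :: real
  assumes "0 \<le> \<beta>" "\<beta> \<le> 1"
  shows "1 - exp (- \<beta>) \<ge> \<beta> / 2"
proof -
  have "(1 + \<beta>) * exp (- \<beta>) \<le> exp \<beta> * exp (- \<beta>)"
    by (intro mult_right_mono exp_ge_add_one_self) auto
  then have "(1 + \<beta>) * exp (- \<beta>) \<le> 1" by (simp add: exp_minus)
  then have "exp (- \<beta>) \<le> 1 / (1 + \<beta>)" using assms by (simp add: field_simps)
  also have "\<dots> \<le> 1 - \<beta> / 2"
  proof -
    have "\<beta> * \<beta> \<le> 1 * \<beta>" using assms by (intro mult_right_mono) auto
    then have "1 \<le> (1 - \<beta> / 2) * (1 + \<beta>)" by (simp add: algebra_simps)
    then show ?thesis using assms by (simp add: divide_le_eq)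
  qed
  finally show ?thesis by simp
qed

lemma sum_two_valued:
  assumes "finite X"
  shows "(\<Sum>s\<in>X. E * (if P s then e else 1)) = E * (real (card X) - real (card {s\<in>X. P s}) * (1 - e))" 
proof -
  have "(\<Sum>s\<in>X. (if P s then e else 1)) = (\<Sum>s\<in>X. 1 - (if P s then 1 - e else 0))"
    by (intro sum.cong) auto
  also have "\<dots> = real (card X) - (\<Sum>s\<in>X. if P s then 1 - e else 0)"
    by (simp add: sum_subtractf)
  also have "(\<Sum>s\<in>X. if P s then 1 - e else 0) = real (card {s\<in>X. P s}) * (1 - e)"
    using assms by (simp add: sum.If_cases Int_def conj_commute)
  finally show ?thesis by (simp add: sum_distrib_left[symmetric])
qed

text \<open>
  The hazard of reaching the root is \<open>\<rho> / (card W - 1)\<close>, and \<open>\<rho>\<close> grows whenever the line meets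
  a vertex with at least two children. The exponential weight trades the waiting time until
  \<open>\<rho> \<ge> M\<close> against the geometric survival probability afterwards.
\<close>

lemma card_orbit_in_le:
  fixes own :: "'s \<Rightarrow> 'v" and \<gamma> \<beta> M z :: real
  assumes "finite W" "finite S" "card W = card S" "v \<in> W" "card W \<le> n"
    and \<beta>: "0 \<le> \<beta>" "\<beta> \<le> 1" and M: "0 \<le> M" and \<gamma>: "\<gamma> \<le> M / real n"
    and "M \<le> real (card (root_slots W S own)) + real (slot_deg S own v) - 1 \<or>
      \<gamma> \<le> z * \<beta> / (4 * real n) \<and> 2 * M \<le> z \<and> z \<le> card {u \<in> W - {v}. slot_deg S own u = 0}"
  shows "card {p \<in> slot_trees W S own. orbit_in W (own \<circ> p) y v} \<le>
     exp (- \<gamma> * y + \<beta> * max 0 (M + 1 - (real (card (root_slots W S own)) + real (slot_deg S own v) - 1)))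
       * card (slot_trees W S own)"
  using assms(1-5) assms(10)
proof (induction y arbitrary: W S own v)
  case 0
  have "real (card {p \<in> slot_trees W S own. orbit_in W (own \<circ> p) 0 v}) \<le> (1::real) * card (slot_trees W S own)"
    using 0 by (simp add: card_mono finite_slot_trees)
  also have "\<dots> \<le> exp (- \<gamma> * (0::nat) + \<beta> * max 0 (M + 1 - (real (card (root_slots W S own)) + real (slot_deg S own v) - 1)))
       * card (slot_trees W S own)"
    using \<beta> by (intro mult_right_mono) auto
  finally show ?case .
next
  case (Suc y)
  note fin = Suc.prems(1,2) and v = Suc.prems(4)
  let ?T = "\<lambda>s. slot_trees (W - {v}) (S - {s}) (redirect own v s)"
  define r where "r = card (root_slots W S own)"
  define \<rho> where "\<rho> = real r + real (slot_deg S own v) - 1"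
  define E where "E = exp (- \<gamma> * y + \<beta> * max 0 (M + 1 - \<rho>))"
  have sub: "{q \<in> ?T s. orbit_in W (own \<circ> q(v := s)) (Suc y) v} \<subseteq>
       {q \<in> ?T s. orbit_in (W - {v}) (redirect own v s \<circ> q) y (own s)}" if "s \<in> S" "own s \<noteq> v" for s
    using orbit_in_contract[where W = W and S = S and own = own, OF v that] by blast
  show ?case
  proof (cases "slot_trees W S own = {}")
    case False
    then have rpos: "r > 0"
      using card_root_slots_pos[OF fin Suc.prems(3) _ False] v unfolding r_def by blast
    then have \<rho>0: "\<rho> \<ge> 0" by (simp add: \<rho>_def)
    show ?thesis
    proof (cases "card W \<ge> 2")
      case True
      have E0: "E > 0" by (simp add: E_def)
      have k: "real (card W) - 1 \<ge> 1" using True by simp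
      define b where "b s = exp (- \<gamma> * y + \<beta> * max 0 (M + 1 - (\<rho> + real (slot_deg S own (own s)) - 1)))" for s
      let ?X = "{s. s \<in> S \<and> own s \<in> W - {v}}"
      let ?H = "{s \<in> S. own s \<in> W - {v} \<and> slot_deg S own (own s) \<ge> 2}"
      have degpos: "slot_deg S own (own s) \<ge> 1" if "s \<in> S" for s
      proof -
        have "{t \<in> S. own t = own s} \<noteq> {}" using that by auto
        then have "slot_deg S own (own s) > 0" unfolding slot_deg_def using fin by (simp add: card_gt_0_iff)
        then show ?thesis by simp
      qed
      have cX: "real (card ?X) = real (card W) - 1 - \<rho>"
        using card_slots_split[OF fin(2) v, of own] Suc.prems(3) by (simp add: \<rho>_def r_def)
      have cH: "real (card {u \<in> W - {v}. slot_deg S own u = 0}) \<le> real (card ?H) + \<rho>"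
        using slots_of_branching_vertices[OF fin _ v, of own] Suc.prems(3) by (simp add: \<rho>_def r_def)
      have nk: "real (card W) - 1 \<le> n" using Suc.prems(5) by simp
      have n0: "real n > 0" using nk k by linarith
      have bE: "b s \<le> E" if "s \<in> S" for s
      proof -
        have "max 0 (M + 1 - (\<rho> + real (slot_deg S own (own s)) - 1)) \<le> max 0 (M + 1 - \<rho>)"
          using degpos[OF that] by auto
        then show ?thesis using \<beta> by (simp add: b_def E_def mult_left_mono)
      qed
      have "(\<Sum>s\<in>?X. b s) \<le> E * exp (- \<gamma>) * (real (card W) - 1)"
      proof (cases "M \<le> \<rho>")
        case M\<rho>: True
        have "(\<Sum>s\<in>?X. b s) \<le> (\<Sum>s\<in>?X. E)"
          using bE by (intro sum_mono) auto
        also have "\<dots> = E * (real (card W) - 1 - \<rho>)" using cX by simp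
        \<comment> \<open>The line survives one step with probability
          \<open>1 - \<rho> / (card W - 1)\<close>, here at most
          \<open>1 - \<gamma>\<close>.\<close>
        also have "\<dots> \<le> E * (exp (- \<gamma>) * (real (card W) - 1))"
        proof -
          have "\<gamma> * (real (card W) - 1) \<le> M / real n * (real (card W) - 1)"
            using k \<gamma> by (intro mult_right_mono) auto
          also have "\<dots> \<le> M / real n * n" using nk M by (intro mult_left_mono) auto
          also have "\<dots> = M" using n0 by simp
          finally have "\<gamma> * (real (card W) - 1) \<le> \<rho>" using M\<rho> by simp
          moreover have "(1 - \<gamma>) * (real (card W) - 1) \<le> exp (- \<gamma>) * (real (card W) - 1)"
            using exp_ge_add_one_self[of "- \<gamma>"] k by (intro mult_right_mono) auto
          ultimately show ?thesis using E0 by (intro mult_left_mono) (auto simp: algebra_simps)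
        qed
        finally show ?thesis by (simp add: mult.assoc)
      next
        case M\<rho>: False
        with Suc.prems(6) have z: "\<gamma> \<le> z * \<beta> / (4 * real n)" "2 * M \<le> z"
          "z \<le> card {u \<in> W - {v}. slot_deg S own u = 0}"
          by (auto simp: \<rho>_def r_def)
        have "(\<Sum>s\<in>?X. b s) \<le> (\<Sum>s\<in>?X. E * (if slot_deg S own (own s) \<ge> 2 then exp (- \<beta>) else 1))"
        proof (intro sum_mono)
          fix s assume "s \<in> ?X"
          then have s: "s \<in> S" by simp
          show "b s \<le> E * (if slot_deg S own (own s) \<ge> 2 then exp (- \<beta>) else 1)"
          proof (cases "slot_deg S own (own s) \<ge> 2")
            case True
            \<comment> \<open>The reason for \<open>M + 1\<close> in the weight: while
              \<open>\<rho> < M\<close>, the difference \<open>M + 1 - \<rho>\<close> exceeds 1, so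
              raising \<rho> by one lowers the maximum by a full unit before it is cut off at
              0.\<close>
            then have "max 0 (M + 1 - (\<rho> + real (slot_deg S own (own s)) - 1)) \<le> max 0 (M + 1 - \<rho>) - 1"
              using M\<rho> by auto
            then have "\<beta> * max 0 (M + 1 - (\<rho> + real (slot_deg S own (own s)) - 1)) \<le> \<beta> * (max 0 (M + 1 - \<rho>) - 1)"
              using \<beta> by (intro mult_left_mono) auto
            then show ?thesis using True
              by (simp add: b_def E_def exp_add[symmetric] algebra_simps)
          qed (use bE[OF s] in auto)
        qed
        also have "\<dots> = E * (real (card ?X) - real (card ?H) * (1 - exp (- \<beta>)))"
          using fin by (subst sum_two_valued) (auto simp: conj_assoc)
        also have "\<dots> \<le> E * (exp (- \<gamma>) * (real (card W) - 1))"
        proof -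
          \<comment> \<open>Since \<open>\<rho> < M \<le> z / 2\<close>, at least
            \<open>z / 2\<close> slots belong to branching vertices. Each saves
            \<open>1 - exp (- \<beta>) \<ge> \<beta> / 2\<close>, which is the origin of the 4 in
            \<open>z * \<beta> / (4 * real n)\<close>.\<close>
          have "real (card ?H) \<ge> z / 2" using cH z M\<rho> by linarith
          then have "z / 2 * (\<beta> / 2) \<le> real (card ?H) * (1 - exp (- \<beta>))"
            using one_minus_exp_ge_half[OF \<beta>] \<beta> z M by (intro mult_mono) auto
          moreover have "\<gamma> * (real (card W) - 1) \<le> z * \<beta> / 4"
          proof -
            have "\<gamma> * (real (card W) - 1) \<le> z * \<beta> / (4 * real n) * (real (card W) - 1)"
              using z k by (intro mult_right_mono) auto
            also have "\<dots> \<le> z * \<beta> / (4 * real n) * n"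
              using nk z M \<beta> by (intro mult_left_mono) auto
            also have "\<dots> = z * \<beta> / 4" using n0 by simp
            finally show ?thesis .
          qed
          moreover have "(1 - \<gamma>) * (real (card W) - 1) \<le> exp (- \<gamma>) * (real (card W) - 1)"
            using exp_ge_add_one_self[of "- \<gamma>"] k by (intro mult_right_mono) auto
          ultimately show ?thesis using E0 \<rho>0 cX by (intro mult_left_mono) (auto simp: algebra_simps)
        qed
        finally show ?thesis by (simp add: mult.assoc)
      qed
      then have B: "(\<Sum>s\<in>?X. b s) + \<rho> * 0 \<le> (E * exp (- \<gamma>)) * (real (card W) - 1)" by simp
      have "real (card {p \<in> slot_trees W S own. orbit_in W (own \<circ> p) (Suc y) v}) \<le> (E * exp (- \<gamma>)) * real (card (slot_trees W S own))"
      proof (rule card_slot_trees_step[where b = b and c = 0, OF fin _ True v _ _ B[unfolded \<rho>_def r_def]])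
        show "card S = card W" using Suc.prems by simp
      next
        fix s assume s: "s \<in> S" "own s \<in> W - {v}"
        then have s': "own s \<noteq> v" by auto
        have r': "card (root_slots (W - {v}) (S - {s}) (redirect own v s)) = r"
          using card_root_slots_contract[where own = own, OF fin(2) s(1) s' v] s by (simp add: r_def)
        have "slot_deg (S - {s}) (redirect own v s) (own s) = slot_deg S own (own s) + slot_deg S own v - 1"
          using slot_deg_contract[where own = own, OF fin(2) s(1) s', of "own s"] s' by simp
        then have d': "real r + real (slot_deg (S - {s}) (redirect own v s) (own s)) - 1 = \<rho> + real (slot_deg S own (own s)) - 1"
          using degpos[OF s(1)] by (simp add: \<rho>_def of_nat_diff)
        have "real (card {q \<in> ?T s. orbit_in W (own \<circ> q(v := s)) (Suc y) v}) \<le>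
           real (card {q \<in> ?T s. orbit_in (W - {v}) (redirect own v s \<circ> q) y (own s)})"
          using fin by (intro of_nat_mono card_mono sub s s') (simp add: finite_slot_trees)
        also have "\<dots> \<le> b s * real (card (?T s))"
          unfolding b_def d'[symmetric] r'[symmetric]
        proof (rule Suc.IH[where W = "W - {v}" and S = "S - {s}" and own = "redirect own v s" and v = "own s"])
          show "M \<le> real (card (root_slots (W - {v}) (S - {s}) (redirect own v s)))
             + real (slot_deg (S - {s}) (redirect own v s) (own s)) - 1 \<or>
            \<gamma> \<le> z * \<beta> / (4 * real n) \<and> 2 * M \<le> z \<and>
              z \<le> card {u \<in> W - {v} - {own s}. slot_deg (S - {s}) (redirect own v s) u = 0}"
            unfolding leaves_contract[where own = own, OF fin(2) s(1) s' v] r' d'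
            using Suc.prems(6) degpos[OF s(1)] by (auto simp: \<rho>_def r_def)
        qed (use fin v s Suc.prems in auto)
        finally show "real (card {q \<in> ?T s. orbit_in W (own \<circ> q(v := s)) (Suc y) v}) \<le> b s * real (card (?T s))" .
      next
        fix s assume s: "s \<in> S" "own s \<notin> W"
        then have s': "own s \<noteq> v" using v by auto
        \<comment> \<open>A line that takes a root slot has ended, hence
          \<open>c = 0\<close>.\<close>
        from sub[OF s(1) s'] s have "{q \<in> ?T s. orbit_in W (own \<circ> q(v := s)) (Suc y) v} = {}"
          by (auto dest: orbit_in_mem)
        then show "real (card {q \<in> ?T s. orbit_in W (own \<circ> q(v := s)) (Suc y) v}) \<le> 0 * real (card (?T s))"
          by (simp only: card.empty)
      qed
      also have "E * exp (- \<gamma>) = exp (- \<gamma> * Suc y + \<beta> * max 0 (M + 1 - \<rho>))"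
        by (simp add: E_def exp_add[symmetric] algebra_simps)
      finally show ?thesis by (simp add: \<rho>_def r_def)
    next
      case False
      moreover have "card W > 0" using v fin by (auto simp: card_gt_0_iff)
      ultimately have "card W = 1" by simp
      then have "W = {v}" using v by (auto simp: card_1_singleton_iff)
      then have "{p \<in> slot_trees W S own. orbit_in W (own \<circ> p) (Suc y) v} = {}"
        by (auto dest!: orbit_in_mem slot_trees_parent_neq)
      then show ?thesis by (simp only: card.empty) simp
    qed
  qed simp
qed

section \<open>Spanned subtrees and their free slots\<close>

inductive_set ancestors :: "'v set \<Rightarrow> ('v \<Rightarrow> 'v) \<Rightarrow> 'v set \<Rightarrow> 'v set" for W par A where
  base: "a \<in> A \<Longrightarrow> a \<in> W \<Longrightarrow> a \<in> ancestors W par A"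
| parent: "u \<in> ancestors W par A \<Longrightarrow> par u \<in> W \<Longrightarrow> par u \<in> ancestors W par A"

lemma ancestors_subset: "ancestors W par A \<subseteq> W"
proof
  fix u assume "u \<in> ancestors W par A" then show "u \<in> W" by induction auto
qed

lemma ancestors_empty: "A \<inter> W = {} \<Longrightarrow> ancestors W par A = {}"
proof -
  assume A: "A \<inter> W = {}"
  have False if "u \<in> ancestors W par A" for u
    using that by induction (use A in auto)
  then show ?thesis by auto
qed

text \<open>Everything outside the spanned subtree hangs off one of these slots; they become exactly
  the root slots once the subtree has been contracted away.\<close>

definition free_slots :: "'v set \<Rightarrow> 's set \<Rightarrow> ('s \<Rightarrow> 'v) \<Rightarrow> ('v \<Rightarrow> 's) \<Rightarrow> 'v set \<Rightarrow> 's set" where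
  "free_slots W S own p A =
    {t \<in> S - p ` ancestors W (own \<circ> p) A. own t \<in> ancestors W (own \<circ> p) A \<or> own t \<notin> W}"

lemma free_slots_empty: "A \<inter> W = {} \<Longrightarrow> free_slots W S own p A = root_slots W S own"
  by (auto simp: free_slots_def root_slots_def ancestors_empty)

text \<open>Contracting a marked vertex moves its mark to its parent. From a root slot the mark
  lands outside \<open>W\<close>, where \<open>ancestors\<close> ignores it; this is why marks are
  allowed outside \<open>W\<close>.\<close>

lemma ancestors_contract:
  fixes own :: "'s \<Rightarrow> 'v"
  assumes v: "v \<in> W" "v \<in> A" and s: "s \<in> S" "own s \<noteq> v"
    and q: "q \<in> slot_trees (W - {v}) (S - {s}) (redirect own v s)"
  shows "ancestors W (own \<circ> q(v := s)) A =
    insert v (ancestors (W - {v}) (redirect own v s \<circ> q) (insert (own s) (A - {v})))"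
    (is "?L = insert v ?R")
proof (intro equalityI subsetI)
  fix u assume "u \<in> ?L"
  then show "u \<in> insert v ?R"
  proof induction
    case (base a)
    then show ?case by (auto intro: ancestors.base)
  next
    case (parent u)
    show ?case
    proof (cases "u = v \<or> (own \<circ> q(v := s)) u = v")
      case True
      then show ?thesis using parent s by (auto intro: ancestors.base)
    next
      case False
      then have eq: "(own \<circ> q(v := s)) u = (redirect own v s \<circ> q) u" by (auto simp: redirect_def)
      have uR: "u \<in> ?R" using parent.IH False by blast
      have "(redirect own v s \<circ> q) u \<in> W - {v}"
        unfolding eq[symmetric] using parent.hyps False by auto
      from ancestors.parent[OF uR this] show ?thesis unfolding eq by blast
    qed
  qed
next
  have vL: "v \<in> ?L" using v by (auto intro: ancestors.base)
  have sL: "own s \<in> ?L" if "own s \<in> W"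
    using ancestors.parent[OF vL] that by simp
  fix u assume "u \<in> insert v ?R"
  moreover have "u \<in> ?L" if "u \<in> ?R" for u
    using that
  proof induction
    case (base a)
    then show ?case using sL by (blast intro: ancestors.base)
  next
    case (parent u)
    then have "u \<noteq> v" using ancestors_subset[of "W - {v}"] by auto
    show ?case
    proof (cases "own (q u) = v")
      case True
      then have e: "(redirect own v s \<circ> q) u = own s" by (simp add: redirect_def)
      have "own s \<in> W" using parent.hyps(2) unfolding e by blast
      then show ?thesis unfolding e by (rule sL)
    next
      case False
      then have eq: "(redirect own v s \<circ> q) u = (own \<circ> q(v := s)) u"
        using \<open>u \<noteq> v\<close> by (simp add: redirect_def)
      have "(own \<circ> q(v := s)) u \<in> W"
        using parent.hyps(2) unfolding eq by blast
      from ancestors.parent[OF parent.IH this] show ?thesis unfolding eq .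
    qed
  qed
  ultimately show "u \<in> ?L" using vL by auto
qed

lemma free_slots_contract:
  fixes own :: "'s \<Rightarrow> 'v"
  assumes v: "v \<in> W" "v \<in> A" and s: "s \<in> S" "own s \<noteq> v"
    and q: "q \<in> slot_trees (W - {v}) (S - {s}) (redirect own v s)"
  shows "free_slots W S own (q(v := s)) A =
    free_slots (W - {v}) (S - {s}) (redirect own v s) q (insert (own s) (A - {v}))"
proof -
  let ?R = "ancestors (W - {v}) (redirect own v s \<circ> q) (insert (own s) (A - {v}))"
  have R: "?R \<subseteq> W - {v}" by (rule ancestors_subset)
  have sR: "own s \<in> ?R" if "own s \<in> W"
    using that s by (auto intro: ancestors.base)
  have im: "q(v := s) ` insert v ?R = insert s (q ` ?R)"
    using R by auto
  show ?thesis
    unfolding free_slots_def ancestors_contract[where own = own, OF v s q] im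
    using R sR v s by (auto simp: redirect_def)
qed

lemma orbit_in_avoiding_contract:
  fixes own :: "'s \<Rightarrow> 'v"
  assumes v: "v \<in> W" "v \<in> A" and s: "s \<in> S" "own s \<noteq> v"
    and q: "q \<in> slot_trees (W - {v}) (S - {s}) (redirect own v s)"
  shows "orbit_in (W - ancestors W (own \<circ> q(v := s)) A) (own \<circ> q(v := s)) y l \<longleftrightarrow>
    orbit_in (W - {v} - ancestors (W - {v}) (redirect own v s \<circ> q) (insert (own s) (A - {v})))
      (redirect own v s \<circ> q) y l"
proof -
  let ?R = "ancestors (W - {v}) (redirect own v s \<circ> q) (insert (own s) (A - {v}))"
  have R: "?R \<subseteq> W - {v}" by (rule ancestors_subset)
  have sR: "own s \<in> ?R" if "own s \<in> W"
    using that s by (auto intro: ancestors.base)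
  have eq: "W - insert v ?R = W - {v} - ?R" by auto
  show ?thesis
    unfolding ancestors_contract[where own = own, OF v s q] eq
    by (rule orbit_in_cong) (use sR in \<open>auto simp: redirect_def\<close>)
qed

text \<open>Contract the spanned subtree vertex by vertex. In the end no mark is left in
  \<open>W\<close>, the free slots are the root slots, and the condition on their number no longer
  depends on \<open>p\<close>. The remaining tree is uniform, and the line of \<open>l\<close> ends
  at each step with probability at least \<open>(m - 1) / n\<close>.\<close>

lemma card_far_le:
  fixes own :: "'s \<Rightarrow> 'v"
  assumes "finite W" "finite S" "card W = card S" "card W \<le> n" "m \<ge> 1"
  shows "card {p \<in> slot_trees W S own. m \<le> card (free_slots W S own p A) \<and>
      orbit_in (W - ancestors W (own \<circ> p) A) (own \<circ> p) y l}
    \<le> exp (- ((real m - 1) / real n) * y) * card (slot_trees W S own)"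
  using assms(1-4)
proof (induction "card W" arbitrary: W S own A)
  case 0
  then have "W = {}" by simp
  then have "{p \<in> slot_trees W S own. m \<le> card (free_slots W S own p A) \<and>
      orbit_in (W - ancestors W (own \<circ> p) A) (own \<circ> p) y l} = {}"
    by (auto dest: orbit_in_mem)
  then show ?case by (simp only: card.empty) simp
next
  case (Suc k)
  note fin = Suc.prems(1,2)
  show ?case
  proof (cases "A \<inter> W = {}")
    case True
    show ?thesis
    proof (cases "l \<in> W \<and> m \<le> card (root_slots W S own)")
      case l: True
      have "real (card {p \<in> slot_trees W S own. m \<le> card (free_slots W S own p A) \<and>
          orbit_in (W - ancestors W (own \<circ> p) A) (own \<circ> p) y l})
        \<le> card {p \<in> slot_trees W S own. orbit_in W (own \<circ> p) y l}"
        using fin by (intro of_nat_mono card_mono) (auto simp: finite_slot_trees ancestors_empty[OF True])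
      \<comment> \<open>\<open>\<beta> = 0\<close> switches the weight off, and
        \<open>M = m - 1\<close> is reached from the start because the root slots alone give
        \<open>\<rho> \<ge> m - 1\<close>.\<close>
      also have "\<dots> \<le> exp (- ((real m - 1) / real n) * y + 0 *
           max 0 ((real m - 1) + 1 - (real (card (root_slots W S own)) + real (slot_deg S own l) - 1)))
         * card (slot_trees W S own)"
        using l assms(5) Suc.prems by (intro card_orbit_in_le) auto
      finally show ?thesis by simp
    next
      case False
      then have "{p \<in> slot_trees W S own. m \<le> card (free_slots W S own p A) \<and>
          orbit_in (W - ancestors W (own \<circ> p) A) (own \<circ> p) y l} = {}"
        by (auto dest: orbit_in_mem simp: free_slots_empty[OF True])
      then show ?thesis by (simp only: card.empty) simp
    qed
  next
    case False
    then obtain v where v: "v \<in> W" "v \<in> A" by auto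
    let ?T = "\<lambda>s. slot_trees (W - {v}) (S - {s}) (redirect own v s)"
    let ?c = "exp (- ((real m - 1) / real n) * y)"
    have "real (card {p \<in> slot_trees W S own. m \<le> card (free_slots W S own p A) \<and>
          orbit_in (W - ancestors W (own \<circ> p) A) (own \<circ> p) y l}) =
      (\<Sum>s | s \<in> S \<and> own s \<noteq> v. real (card {q \<in> ?T s. m \<le> card (free_slots W S own (q(v := s)) A) \<and>
          orbit_in (W - ancestors W (own \<circ> q(v := s)) A) (own \<circ> q(v := s)) y l}))"
      by (subst card_slot_trees_contract[OF v(1) fin]) simp
    also have "\<dots> \<le> (\<Sum>s | s \<in> S \<and> own s \<noteq> v. ?c * real (card (?T s)))"
    proof (rule sum_mono)
      fix s assume "s \<in> {s. s \<in> S \<and> own s \<noteq> v}"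
      then have s: "s \<in> S" "own s \<noteq> v" by auto
      have eq: "{q \<in> ?T s. m \<le> card (free_slots W S own (q(v := s)) A) \<and>
          orbit_in (W - ancestors W (own \<circ> q(v := s)) A) (own \<circ> q(v := s)) y l} =
        {q \<in> ?T s. m \<le> card (free_slots (W - {v}) (S - {s}) (redirect own v s) q (insert (own s) (A - {v}))) \<and>
          orbit_in (W - {v} - ancestors (W - {v}) (redirect own v s \<circ> q) (insert (own s) (A - {v}))) (redirect own v s \<circ> q) y l}"
        using free_slots_contract[where own = own, OF v s] orbit_in_avoiding_contract[where own = own, OF v s]
        by (intro Collect_cong conj_cong refl) auto
      show "real (card {q \<in> ?T s. m \<le> card (free_slots W S own (q(v := s)) A) \<and>
          orbit_in (W - ancestors W (own \<circ> q(v := s)) A) (own \<circ> q(v := s)) y l}) \<le> ?c * real (card (?T s))"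
        unfolding eq
        by (rule Suc.hyps(1)[where W = "W - {v}" and S = "S - {s}" and own = "redirect own v s"])
          (use Suc v s in auto)
    qed
    also have "\<dots> = ?c * real (card (slot_trees W S own))"
      using card_slot_trees_contract[OF v(1) fin, of own "\<lambda>_. True"]
      by (simp add: sum_distrib_left)
    finally show ?thesis .
  qed
qed

text \<open>
  Supermartingale argument along the process that reveals the ancestral lines of \<open>v\<close> and then of the
  leaves \<open>A\<close>: completing a line lowers \<open>\<rho>\<close> by one but is rare while \<open>\<rho>\<close> is small, and a branching
  vertex raises it. If \<open>\<rho> \<ge> m + card A\<close> ever holds, then at least \<open>m\<close> slots remain free at the end.
\<close>

lemma card_few_free_slots_walk:
  fixes own :: "'s \<Rightarrow> 'v" and \<beta> z :: real
  assumes "finite W" "finite S" "card W = card S"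
    and "v \<in> W" "v \<notin> A" "A \<subseteq> W" "\<And>u. u \<in> A \<Longrightarrow> slot_deg S own u = 0" "Mk \<inter> W = insert v A"
    and "z \<le> card {u \<in> W - {v} - A. slot_deg S own u = 0}" and "card A \<le> m" "m \<ge> 1"
    and \<beta>: "0 \<le> \<beta>" "\<beta> \<le> 1" and z: "exp (2 + \<beta>) * (2 * real m) \<le> (z - 2 * real m) * (1 - exp (- \<beta>))"
      "z \<ge> 2 * real m"
  shows "card {p \<in> slot_trees W S own. card (free_slots W S own p Mk) < m} \<le>
    (if real m + card A \<le> real (card (root_slots W S own)) + slot_deg S own v - 1 then 0
     else exp (- 2 * (real (card A) + 1) + \<beta> * (2 * real m - (real (card (root_slots W S own)) + slot_deg S own v - 1))))
    * card (slot_trees W S own)"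
  using assms(1-11)
proof (induction "card W" arbitrary: W S own v A Mk)
  case (Suc k)
  note fin = Suc.prems(1,2) and v = Suc.prems(4)
  have finA: "finite A" using Suc.prems(6) fin finite_subset by blast
  let ?T = "\<lambda>s. slot_trees (W - {v}) (S - {s}) (redirect own v s)"
  define r where "r = card (root_slots W S own)"
  define \<rho> where "\<rho> = real r + real (slot_deg S own v) - 1"
  define Z where "Z a \<rho> = (if real m + real a \<le> \<rho> then 0 else exp (- 2 * (real a + 1) + \<beta> * (2 * real m - \<rho>)))"
    for a :: nat and \<rho> :: real
  have Z0: "Z a \<rho>' \<ge> 0" for a \<rho>' by (simp add: Z_def)
  show ?case
  proof (cases "slot_trees W S own = {}")
    case False
    then have rpos: "r > 0"
      using card_root_slots_pos[OF fin Suc.prems(3) _ False] v unfolding r_def by blast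
    then have \<rho>0: "\<rho> \<ge> 0" by (simp add: \<rho>_def)
    have degpos: "slot_deg S own (own s) \<ge> 1" if "s \<in> S" for s
    proof -
      have "{t \<in> S. own t = own s} \<noteq> {}" using that by auto
      then have "slot_deg S own (own s) > 0" unfolding slot_deg_def using fin by (simp add: card_gt_0_iff)
      then show ?thesis by simp
    qed
    have k: "card W \<ge> 2"
    proof -
      have "card {u \<in> W - {v} - A. slot_deg S own u = 0} > 0"
        using Suc.prems(9,11) z(2) by (intro of_nat_0_less_iff[where 'a = real, THEN iffD1]) linarith
      then obtain u where "u \<in> W" "u \<noteq> v" by (auto simp: card_gt_0_iff)
      then have "card {u, v} \<le> card W" using v fin by (intro card_mono) auto
      then show ?thesis using \<open>u \<noteq> v\<close> by simp
    qed
    let ?X = "{s. s \<in> S \<and> own s \<in> W - {v}}"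
    let ?H = "{s \<in> S. own s \<in> W - {v} \<and> slot_deg S own (own s) \<ge> 2}"
    define a where "a = card A"
    define b where "b s = Z a (\<rho> + real (slot_deg S own (own s)) - 1)" for s
    \<comment> \<open>Completing a line leaves \<rho> root slots. With no leaf waiting this is the
      final number of free slots; otherwise the next leaf, having no slots of its own, starts at
      \<open>\<rho> - 1\<close>.\<close>
    define c where "c = (if a = 0 then if real m \<le> \<rho> then 0 else 1 else Z (a - 1) (\<rho> - 1))"
    have cX: "real (card ?X) = real (card W) - 1 - \<rho>"
      using card_slots_split[OF fin(2) v, of own] Suc.prems(3) by (simp add: \<rho>_def r_def)
    have cH: "z \<le> real (card ?H) + \<rho>"
    proof -
      have "card {u \<in> W - {v} - A. slot_deg S own u = 0} \<le> card {u \<in> W - {v}. slot_deg S own u = 0}"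
        using fin by (intro card_mono) auto
      then show ?thesis
        using slots_of_branching_vertices[OF fin _ v, of own] Suc.prems(3,9) by (simp add: \<rho>_def r_def)
    qed
    have B: "(\<Sum>s\<in>?X. b s) + \<rho> * c \<le> Z a \<rho> * (real (card W) - 1)"
    proof (cases "real m + real a \<le> \<rho>")
      case True
      have "b s = 0" if "s \<in> S" for s
        using True degpos[OF that] by (simp add: b_def Z_def)
      moreover have "c = 0" using True by (auto simp: c_def Z_def)
      ultimately show ?thesis using True by (simp add: Z_def)
    next
      case False
      define E where "E = exp (- 2 * (real a + 1) + \<beta> * (2 * real m - \<rho>))"
      have E: "Z a \<rho> = E" "E > 0" using False by (auto simp: Z_def E_def)
      have "(\<Sum>s\<in>?X. b s) \<le> (\<Sum>s\<in>?X. E * (if slot_deg S own (own s) \<ge> 2 then exp (- \<beta>) else 1))"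
      proof (intro sum_mono)
        fix s assume "s \<in> ?X"
        then have s: "s \<in> S" by simp
        have "b s \<le> exp (- 2 * (real a + 1) + \<beta> * (2 * real m - (\<rho> + real (slot_deg S own (own s)) - 1)))"
          by (simp add: b_def Z_def)
        also have "\<dots> \<le> E * (if slot_deg S own (own s) \<ge> 2 then exp (- \<beta>) else 1)"
        proof -
          have "\<beta> * real (slot_deg S own (own s)) \<ge> \<beta> * (if slot_deg S own (own s) \<ge> 2 then 2 else 1)"
            using degpos[OF s] \<beta> by (intro mult_left_mono) auto
          then show ?thesis by (auto simp: E_def exp_add[symmetric] algebra_simps)
        qed
        finally show "b s \<le> E * (if slot_deg S own (own s) \<ge> 2 then exp (- \<beta>) else 1)" .
      qed
      also have "\<dots> = E * (real (card ?X) - real (card ?H) * (1 - exp (- \<beta>)))"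
        using fin by (subst sum_two_valued) (auto simp: conj_assoc)
      also have "\<dots> \<le> E * (real (card W) - 1 - \<rho> - (z - 2 * real m) * (1 - exp (- \<beta>)))"
      proof -
        have "z - 2 * real m \<le> real (card ?H)" using cH False Suc.prems(10) by (simp add: a_def)
        then have "(z - 2 * real m) * (1 - exp (- \<beta>)) \<le> real (card ?H) * (1 - exp (- \<beta>))"
          using \<beta> by (intro mult_right_mono) auto
        then show ?thesis using E cX by (intro mult_left_mono) auto
      qed
      finally have 1: "(\<Sum>s\<in>?X. b s) \<le> E * (real (card W) - 1 - \<rho> - (z - 2 * real m) * (1 - exp (- \<beta>)))" .
      \<comment> \<open>Completing a line raises the weight by \<open>exp 2\<close> for the leaf
        used up and by \<open>exp \<beta>\<close> for the unit lost in \<rho>. On the last line the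
        failure value 1 obeys the same bound because \<open>\<rho> < m\<close>.\<close>
      have "c \<le> E * exp (2 + \<beta>)"
      proof (cases "a = 0")
        case True
        have "c \<le> 1" using True by (simp add: c_def)
        also have "1 \<le> exp (\<beta> * (2 * real m - \<rho> + 1))"
          using False True \<beta> by simp
        also have "\<dots> = E * exp (2 + \<beta>)"
          by (simp add: True E_def exp_add[symmetric] algebra_simps)
        finally show ?thesis .
      next
        case a: False
        then obtain a' where a': "a = Suc a'" by (cases a) auto
        have "c \<le> exp (- 2 * (real (a - 1) + 1) + \<beta> * (2 * real m - (\<rho> - 1)))"
          using a by (simp add: c_def Z_def)
        also have "\<dots> = E * exp (2 + \<beta>)"
          by (simp add: E_def exp_add[symmetric] algebra_simps a')
        finally show ?thesis .
      qed
      moreover have "c \<ge> 0" by (simp add: c_def Z0)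
      ultimately have "\<rho> * c \<le> (2 * real m) * (E * exp (2 + \<beta>))"
        using False Suc.prems(10) \<rho>0 by (intro mult_mono) (auto simp: a_def)
      also have "\<dots> = E * (exp (2 + \<beta>) * (2 * real m))" by simp
      also have "\<dots> \<le> E * ((z - 2 * real m) * (1 - exp (- \<beta>)))"
        using z(1) E by (intro mult_left_mono) auto
      finally have 2: "\<rho> * c \<le> E * ((z - 2 * real m) * (1 - exp (- \<beta>)))" .
      have "E * (real (card W) - 1 - \<rho> - (z - 2 * real m) * (1 - exp (- \<beta>))) + E * ((z - 2 * real m) * (1 - exp (- \<beta>)))
         \<le> E * (real (card W) - 1)"
        using E \<rho>0 by (simp add: algebra_simps)
      then show ?thesis unfolding E(1) using 1 2 by linarith
    qed
    have B': "(\<Sum>s\<in>?X. b s) + (real (card (root_slots W S own)) + real (slot_deg S own v) - 1) * c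
        \<le> Z a \<rho> * (real (card W) - 1)"
      using B unfolding \<rho>_def[unfolded r_def, symmetric] .
    \<comment> \<open>\<open>Mk\<close> agrees on \<open>W\<close> with the current vertex and the
      waiting leaves but may also hold owners outside \<open>W\<close>; it follows the marks exactly
      as \<open>free_slots_contract\<close> moves them.\<close>
    have Amk: "v \<in> Mk" using Suc.prems(8) by auto
    have eq: "{q \<in> ?T s. card (free_slots W S own (q(v := s)) Mk) < m} =
        {q \<in> ?T s. card (free_slots (W - {v}) (S - {s}) (redirect own v s) q (insert (own s) (Mk - {v}))) < m}"
      if s: "s \<in> S" "own s \<noteq> v" for s
      using free_slots_contract[where own = own, OF v Amk s] by auto
    have degA: "slot_deg (S - {s}) (redirect own v s) u = slot_deg S own u"
      if s: "s \<in> S" "own s \<noteq> v" and u: "u \<noteq> own s" "u \<noteq> v" for s u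
      using slot_deg_contract[where own = own, OF fin(2) s u(2)] u by simp
    have "real (card {p \<in> slot_trees W S own. card (free_slots W S own p Mk) < m}) \<le> Z a \<rho> * real (card (slot_trees W S own))"
    proof (rule card_slot_trees_step[where b = b and c = c, OF fin _ k v _ _ B'])
      show "card S = card W" using Suc.prems by simp
    next
      fix s assume s: "s \<in> S" "own s \<in> W - {v}"
      then have s': "own s \<noteq> v" by auto
      have sA: "own s \<notin> A" using Suc.prems(7)[of "own s"] degpos[OF s(1)] by auto
      have r': "card (root_slots (W - {v}) (S - {s}) (redirect own v s)) = r"
        using card_root_slots_contract[where own = own, OF fin(2) s(1) s' v] s by (simp add: r_def)
      have "slot_deg (S - {s}) (redirect own v s) (own s) = slot_deg S own (own s) + slot_deg S own v - 1"
        using slot_deg_contract[where own = own, OF fin(2) s(1) s', of "own s"] s' by simp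
      then have d': "real r + real (slot_deg (S - {s}) (redirect own v s) (own s)) - 1 = \<rho> + real (slot_deg S own (own s)) - 1"
        using degpos[OF s(1)] by (simp add: \<rho>_def of_nat_diff)
      have lv: "{u \<in> W - {v} - {own s} - A. slot_deg (S - {s}) (redirect own v s) u = 0} =
        {u \<in> W - {v} - A. slot_deg S own u = 0}"
        using leaves_contract[where own = own, OF fin(2) s(1) s' v] by blast
      show "real (card {q \<in> ?T s. card (free_slots W S own (q(v := s)) Mk) < m}) \<le> b s * real (card (?T s))"
        unfolding eq[OF s(1) s'] b_def Z_def a_def d'[symmetric] r'[symmetric]
      proof (rule Suc.hyps(1)[where W = "W - {v}" and S = "S - {s}" and own = "redirect own v s" and v = "own s" and A = A])
        show "insert (own s) (Mk - {v}) \<inter> (W - {v}) = insert (own s) A"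
          using Suc.prems(5,6,8) s by auto
        show "z \<le> card {u \<in> W - {v} - {own s} - A. slot_deg (S - {s}) (redirect own v s) u = 0}"
          unfolding lv using Suc.prems(9) .
        show "slot_deg (S - {s}) (redirect own v s) u = 0" if "u \<in> A" for u
          using degA[OF s(1) s', of u] that sA Suc.prems(5,7) by auto
      qed (use Suc.hyps Suc.prems s sA in auto)
    next
      fix s assume s: "s \<in> S" "own s \<notin> W"
      then have s': "own s \<noteq> v" using v by auto
      have r': "real (card (root_slots (W - {v}) (S - {s}) (redirect own v s))) = \<rho>"
        using card_root_slots_contract[where own = own, OF fin(2) s(1) s' v] s rpos by (simp add: \<rho>_def r_def of_nat_diff)
      show "real (card {q \<in> ?T s. card (free_slots W S own (q(v := s)) Mk) < m}) \<le> c * real (card (?T s))"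
      proof (cases "A = {}")
        case True
        have "insert (own s) (Mk - {v}) \<inter> (W - {v}) = {}" using Suc.prems(8) True s by auto
        then have f: "free_slots (W - {v}) (S - {s}) (redirect own v s) q (insert (own s) (Mk - {v})) =
           root_slots (W - {v}) (S - {s}) (redirect own v s)" for q by (rule free_slots_empty)
        have a0: "a = 0" using True by (simp add: a_def)
        show ?thesis
          unfolding eq[OF s(1) s'] f
        proof (cases "real m \<le> \<rho>")
          case True
          then have "{q \<in> ?T s. card (root_slots (W - {v}) (S - {s}) (redirect own v s)) < m} = {}"
            using r' by auto
          then show "real (card {q \<in> ?T s. card (root_slots (W - {v}) (S - {s}) (redirect own v s)) < m}) \<le> c * real (card (?T s))"
            using True a0 by (simp only: card.empty) (simp add: c_def)
        next
          case False
          then have "c = 1" using a0 by (simp add: c_def)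
          then show "real (card {q \<in> ?T s. card (root_slots (W - {v}) (S - {s}) (redirect own v s)) < m}) \<le> c * real (card (?T s))"
            using fin by (simp add: card_mono finite_slot_trees)
        qed
      next
        case False
        then obtain w where w: "w \<in> A" by auto
        have wv: "w \<noteq> v" "w \<noteq> own s" using w Suc.prems(5,6) s by auto
        have a: "a \<noteq> 0" "card (A - {w}) = a - 1" using w finA by (auto simp: a_def)
        have dw: "slot_deg (S - {s}) (redirect own v s) w = 0"
          using degA[OF s(1) s' wv(2,1)] Suc.prems(7)[OF w] by simp
        have r'': "real (card (root_slots (W - {v}) (S - {s}) (redirect own v s))) + real (slot_deg (S - {s}) (redirect own v s) w) - 1 = \<rho> - 1"
          using r' dw by simp
        have c: "c = Z (card (A - {w})) (\<rho> - 1)" using a by (simp add: c_def)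
        have lv: "{u \<in> W - {v} - {w} - (A - {w}). slot_deg (S - {s}) (redirect own v s) u = 0} =
          {u \<in> W - {v} - A. slot_deg S own u = 0}"
        proof -
          have "slot_deg (S - {s}) (redirect own v s) u = slot_deg S own u" if "u \<in> W - {v}" for u
            using degA[OF s(1) s', of u] that s by auto
          then show ?thesis using w by auto
        qed
        show ?thesis
          unfolding eq[OF s(1) s'] c Z_def r''[symmetric]
        proof (rule Suc.hyps(1)[where W = "W - {v}" and S = "S - {s}" and own = "redirect own v s" and v = w and A = "A - {w}"])
          show "insert (own s) (Mk - {v}) \<inter> (W - {v}) = insert w (A - {w})"
            using Suc.prems(5,6,8) s w by auto
          show "z \<le> card {u \<in> W - {v} - {w} - (A - {w}). slot_deg (S - {s}) (redirect own v s) u = 0}"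
            unfolding lv using Suc.prems(9) .
          show "slot_deg (S - {s}) (redirect own v s) u = 0" if "u \<in> A - {w}" for u
            using degA[OF s(1) s', of u] that s Suc.prems(5,6,7) by auto
          show "card (A - {w}) \<le> m" using a Suc.prems(10) by (simp add: a_def)
        qed (use Suc.hyps Suc.prems s w wv in auto)
      qed
    qed
    then show ?thesis by (simp add: Z_def \<rho>_def r_def a_def)
  qed simp
qed simp

section \<open>Height of uniform trees with many leaves\<close>

text \<open>Walking towards the root never increases the distance to a set closed under parents, so
  closeness of the marked vertices extends to the subtree they span.\<close>

lemma orbit_in_ancestors_propagate:
  assumes "u \<in> ancestors W par A"
    and "\<And>a. a \<in> A \<Longrightarrow> \<not> orbit_in (W - ancestors W par A') par y a"
  shows "\<not> orbit_in (W - ancestors W par A') par y u"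
  using assms(1)
proof induction
  case (base a)
  then show ?case using assms(2) by simp
next
  case (parent u)
  show ?case
  proof
    assume o: "orbit_in (W - ancestors W par A') par y (par u)"
    have "u \<in> W - ancestors W par A'"
      using parent.hyps orbit_in_mem[OF o] ancestors_subset[of W par A] ancestors.parent[of u W par A'] by auto
    then have "orbit_in (W - ancestors W par A') par (Suc y) u" using o by simp
    then show False using parent.IH orbit_in_antimono[of _ _ "Suc y" u y] by auto
  qed
qed

lemma orbit_in_compose:
  assumes "\<not> orbit_in (W - B) f y v" "\<And>u. u \<in> B \<Longrightarrow> \<not> orbit_in W f z u"
  shows "\<not> orbit_in W f (y + z) v"
  using assms(1)
proof (induction y arbitrary: v)
  case 0
  then show ?case using assms(2)[of v] by (auto dest: orbit_in_mem)
next
  case (Suc y)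
  show ?case
  proof (cases "v \<in> B")
    case True
    then show ?thesis using assms(2) orbit_in_antimono[of W f "Suc y + z" v z] by auto
  next
    case False
    then show ?thesis using Suc by auto
  qed
qed

lemma orbit_in_chain:
  assumes "\<And>a. a \<in> A 0 \<Longrightarrow> \<not> orbit_in W par (y 0) a"
    and "\<And>i a. i < I \<Longrightarrow> a \<in> A (Suc i) \<Longrightarrow> \<not> orbit_in (W - ancestors W par (A i)) par (y (Suc i)) a"
    and "u \<in> ancestors W par (A I)"
  shows "\<not> orbit_in W par (\<Sum>i\<le>I. y i) u"
  using assms(2,3)
proof (induction I arbitrary: u)
  case 0
  have "ancestors W par {} = {}" by (rule ancestors_empty) simp
  then show ?case
    using orbit_in_ancestors_propagate[of u W par "A 0" "{}" "y 0"] 0 assms(1) by simp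
next
  case (Suc I)
  have "\<not> orbit_in (W - ancestors W par (A I)) par (y (Suc I)) u"
    using Suc.prems(1) by (intro orbit_in_ancestors_propagate[OF Suc.prems(2)]) simp
  moreover have "\<not> orbit_in W par (\<Sum>i\<le>I. y i) w" if "w \<in> ancestors W par (A I)" for w
    using Suc.prems(1) that by (intro Suc.IH) simp_all
  ultimately have "\<not> orbit_in W par (y (Suc I) + (\<Sum>i\<le>I. y i)) u"
    by (rule orbit_in_compose)
  then show ?case by (simp add: add.commute)
qed

text \<open>The walk starts at one leaf of \<open>A\<close> with the others waiting; a single root
  slot and a leaf give \<open>\<rho> = 0\<close>. The initial weight is
  \<open>exp (- 2 * card A + 2 * \<beta> * m)\<close>, and half of the exponent survives when
  \<open>2 * \<beta> * m \<le> card A\<close>.\<close>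

lemma card_few_free_slots:
  fixes own :: "'s \<Rightarrow> 'v" and z :: real
  assumes fin: "finite W" "finite S" and WS: "card W = card S" and r: "card (root_slots W S own) = 1"
    and A: "A \<subseteq> {u \<in> W. slot_deg S own u = 0}" "A \<noteq> {}" "card A \<le> m"
    and z: "z + card A \<le> card {u \<in> W. slot_deg S own u = 0}"
      "432 * (real m)\<^sup>2 \<le> z * card A" "216 * real m \<le> z"
  shows "card {p \<in> slot_trees W S own. card (free_slots W S own p A) < m} \<le> exp (- real (card A)) * card (slot_trees W S own)"
proof -
  have finA: "finite A" using A(1) fin finite_subset by (metis (no_types, lifting) mem_Collect_eq subset_eq)
  obtain v where v: "v \<in> A" using A by auto
  have cA: "card A = Suc (card (A - {v}))" using finA v by (rule card.remove)
  have m: "m \<ge> 1" using cA A by simp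
  have zp: "z > 0" using z m by linarith
  \<comment> \<open>With \<open>exp (2 + \<beta>) \<le> 27\<close>,
    \<open>z - 2 * m \<ge> z / 2\<close> and \<open>1 - exp (- \<beta>) \<ge> \<beta> / 2\<close>,
    the condition of the walk follows from \<open>54 * m \<le> z * \<beta> / 4\<close>, an equality
    for this choice.\<close>
  define \<beta> where "\<beta> = 216 * m / z"
  have \<beta>: "0 \<le> \<beta>" "\<beta> \<le> 1" using zp z by (auto simp: \<beta>_def)
  have deg: "slot_deg S own u = 0" if "u \<in> A" for u using that A by auto
  have AW: "A \<subseteq> W" using A by auto
  have "exp (2 + \<beta>) \<le> exp 3" using \<beta> by simp
  also have "exp 3 = exp (1::real) ^ 3" by (simp flip: exp_of_nat_mult)
  also have "\<dots> \<le> 3 ^ 3" using exp_le by (intro power_mono) auto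
  also have "\<dots> = 27" by simp
  finally have e: "exp (2 + \<beta>) * (2 * real m) \<le> 27 * (2 * real m)" by (intro mult_right_mono) auto
  have "54 * real m = z / 2 * (\<beta> / 2)" using zp by (simp add: \<beta>_def)
  also have "\<dots> \<le> (z - 2 * real m) * (1 - exp (- \<beta>))"
    using z zp \<beta> one_minus_exp_ge_half[OF \<beta>] by (intro mult_mono) auto
  finally have "27 * (2 * real m) \<le> (z - 2 * real m) * (1 - exp (- \<beta>))" by simp
  with e have zz: "exp (2 + \<beta>) * (2 * real m) \<le> (z - 2 * real m) * (1 - exp (- \<beta>))" by (rule order_trans)
  have lv: "z \<le> card {u \<in> W - {v} - (A - {v}). slot_deg S own u = 0}"
  proof -
    have "{u \<in> W - {v} - (A - {v}). slot_deg S own u = 0} = {u \<in> W. slot_deg S own u = 0} - A"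
      using v by auto
    then show ?thesis using z(1) card_Diff_subset[OF finA A(1)] card_mono[OF _ A(1)] fin by simp
  qed
  have "card {p \<in> slot_trees W S own. card (free_slots W S own p A) < m} \<le>
    (if real m + card (A - {v}) \<le> real (card (root_slots W S own)) + slot_deg S own v - 1 then 0
     else exp (- 2 * (real (card (A - {v})) + 1) + \<beta> * (2 * real m - (real (card (root_slots W S own)) + slot_deg S own v - 1))))
    * card (slot_trees W S own)"
  proof (rule card_few_free_slots_walk[OF fin WS _ _ _ _ _ lv _ m \<beta> zz])
    show "v \<in> W" "A - {v} \<subseteq> W" "v \<notin> A - {v}" "A \<inter> W = insert v (A - {v})"
      using v AW by auto
    show "slot_deg S own u = 0" if "u \<in> A - {v}" for u
      using deg that by blast
    show "card (A - {v}) \<le> m" using cA A(3) by linarith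
    show "2 * real m \<le> z" using z(3) by linarith
  qed
  also have "\<dots> = exp (- 2 * real (card A) + \<beta> * (2 * real m)) * card (slot_trees W S own)"
    using m by (simp add: r deg[OF v] cA)
  also have "\<dots> \<le> exp (- real (card A)) * card (slot_trees W S own)"
  proof -
    have "\<beta> * (2 * real m) = 432 * (real m)\<^sup>2 / z" by (simp add: \<beta>_def power2_eq_square)
    also have "\<dots> \<le> card A" using z(2) zp by (simp add: divide_le_eq mult.commute)
    finally show ?thesis by (intro mult_right_mono) auto
  qed
  finally show ?thesis .
qed

text \<open>The first line starts with \<open>\<rho> = 0\<close> and must meet branching vertices
  before the root becomes likely. Heuristically, after \<open>y\<close> steps the hazard is of order
  \<open>\<delta> * y / n\<close>, and summing it along the line gives the Gaussian
  exponent.\<close>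

lemma card_deep_leaf_le:
  fixes own :: "'s \<Rightarrow> 'v" and \<delta> :: real
  assumes fin: "finite W" "finite S" and WS: "card W = card S" and r: "card (root_slots W S own) = 1"
    and \<delta>: "0 < \<delta>" "\<delta> * card W + 2 \<le> 2 * real (card {u \<in> W. slot_deg S own u = 0})"
    and v: "v \<in> W" "slot_deg S own v = 0" and y: "y \<le> 2 * card W"
  shows "card {p \<in> slot_trees W S own. orbit_in W (own \<circ> p) y v} \<le>
    3 * exp (- (\<delta> * (real y)\<^sup>2 / (32 * real (card W)))) * card (slot_trees W S own)"
proof -
  let ?n = "real (card W)"
  have n: "?n > 0" using v fin by (auto simp: card_gt_0_iff)
  define z where "z = \<delta> * ?n / 2"
  \<comment> \<open>For \<open>M = z * \<beta> / 4\<close> the two conditions on the rate coincide,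
    and apart from a summand \<beta> the exponent is
    \<open>z / 4 * (\<beta>\<^sup>2 - \<beta> * y / n)\<close>; this \<beta> minimizes it.\<close>
  define \<beta> where "\<beta> = y / (2 * ?n)"
  define M where "M = z * y / (8 * ?n)"
  have \<beta>: "0 \<le> \<beta>" "\<beta> \<le> 1" using y n by (auto simp: \<beta>_def divide_le_eq)
  have z0: "z > 0" using n \<delta> by (simp add: z_def)
  have M: "M \<ge> 0" using z0 n by (simp add: M_def)
  have lv: "z \<le> card {u \<in> W - {v}. slot_deg S own u = 0}"
  proof -
    have "{u \<in> W - {v}. slot_deg S own u = 0} = {u \<in> W. slot_deg S own u = 0} - {v}" by auto
    moreover have "card ({u \<in> W. slot_deg S own u = 0} - {v}) = card {u \<in> W. slot_deg S own u = 0} - 1"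
      using v fin by (subst card_Diff_singleton) auto
    moreover have "card {u \<in> W. slot_deg S own u = 0} \<ge> 1"
    proof -
      have "{u \<in> W. slot_deg S own u = 0} \<noteq> {}" using v by auto
      then have "card {u \<in> W. slot_deg S own u = 0} > 0" using fin by (simp add: card_gt_0_iff)
      then show ?thesis by simp
    qed
    ultimately show ?thesis using \<delta> by (simp add: z_def of_nat_diff)
  qed
  have "card {p \<in> slot_trees W S own. orbit_in W (own \<circ> p) y v} \<le>
     exp (- (M / real (card W)) * y + \<beta> * max 0 (M + 1 - (real (card (root_slots W S own)) + real (slot_deg S own v) - 1)))
       * card (slot_trees W S own)"
  proof (rule card_orbit_in_le[OF fin WS v(1) order_refl \<beta> M order_refl])
    have "M / ?n = z * \<beta> / (4 * ?n)" using n by (simp add: M_def \<beta>_def)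
    moreover have "2 * M \<le> z"
    proof -
      have "z * y \<le> z * (4 * ?n)" using y z0 by (intro mult_left_mono) auto
      then show ?thesis using n by (simp add: M_def field_simps)
    qed
    ultimately show "M \<le> real (card (root_slots W S own)) + real (slot_deg S own v) - 1 \<or>
      M / ?n \<le> z * \<beta> / (4 * ?n) \<and> 2 * M \<le> z \<and> z \<le> card {u \<in> W - {v}. slot_deg S own u = 0}"
      using lv by simp
  qed
  also have "\<dots> = exp (- (M / ?n) * y + \<beta> * (M + 1)) * card (slot_trees W S own)"
    using M by (simp add: r v)
  also have "\<dots> \<le> (3 * exp (- (\<delta> * (real y)\<^sup>2 / (32 * real (card W))))) * card (slot_trees W S own)"
  proof (rule mult_right_mono)
    have "- (M / ?n) * y + \<beta> * (M + 1) = - (\<delta> * (real y)\<^sup>2 / (32 * real (card W))) + \<beta>"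
      using n by (simp add: M_def \<beta>_def z_def field_simps power2_eq_square)
    then have "exp (- (M / ?n) * y + \<beta> * (M + 1)) = exp (- (\<delta> * (real y)\<^sup>2 / (32 * real (card W)))) * exp \<beta>"
      by (simp only: exp_add)
    moreover have "exp \<beta> \<le> 3" using \<beta> exp_le by (intro order_trans[of "exp \<beta>" "exp 1" 3]) simp_all
    ultimately show "exp (- (M / ?n) * y + \<beta> * (M + 1)) \<le> 3 * exp (- (\<delta> * (real y)\<^sup>2 / (32 * real (card W))))"
      by simp
  qed simp
  finally show ?thesis .
qed

text \<open>One stage of the chaining: either fewer than about
  \<open>sqrt (\<eta> * n * card A)\<close> slots are free, or the line of each vertex of
  \<open>B\<close> faces a hazard of that order divided by \<open>n\<close>, and a union bound over
  \<open>B\<close> applies.\<close>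

lemma card_stage_le:
  fixes own :: "'s \<Rightarrow> 'v" and \<delta> \<eta> :: real
  assumes fin: "finite W" "finite S" and WS: "card W = card S" and r: "card (root_slots W S own) = 1"
    and \<delta>: "0 < \<delta>" "\<delta> * card W \<le> real (card {u \<in> W. slot_deg S own u = 0})"
    and \<eta>: "\<eta> = \<delta> / 864"
    and A: "A \<subseteq> {u \<in> W. slot_deg S own u = 0}" "4 \<le> card A" "real (card A) \<le> \<eta> * card W"
    and B: "finite B"
  shows "card {p \<in> slot_trees W S own. \<exists>b\<in>B. orbit_in (W - ancestors W (own \<circ> p) A) (own \<circ> p) y b} \<le>
    (exp (- real (card A)) + card B * exp (- (sqrt (\<eta> * card W * card A) / (2 * real (card W)) * y))) * card (slot_trees W S own)"
proof -
  let ?n = "real (card W)" and ?T = "slot_trees W S own"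
  have n: "?n > 0"
  proof -
    have "card W \<noteq> 0" using A by (auto intro!: Nat.gr0I)
    then show ?thesis by simp
  qed
  have \<eta>0: "\<eta> > 0" using \<delta> \<eta> by simp
  \<comment> \<open>\<open>g\<close> solves \<open>432 * g\<^sup>2 = z * card A\<close> for
    \<open>z = \<delta> * n / 2\<close>, which fixes \<open>\<eta> = \<delta> / 864\<close>. The
    bound \<open>card A \<le> \<eta> * n\<close> gives
    \<open>card A \<le> g \<le> \<eta> * n\<close>.\<close>
  define g where "g = sqrt (\<eta> * ?n * card A)"
  define m where "m = nat \<lfloor>g\<rfloor>"
  have g: "card A \<le> g"
    unfolding g_def using A(3) by (intro real_le_rsqrt) (simp add: power2_eq_square mult_right_mono)
  have g0: "g \<ge> 4" using g A(2) by linarith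
  have mg: "real m \<le> g" "real m \<ge> g - 1" using g0 unfolding m_def by linarith+
  have Am: "card A \<le> m" using g unfolding m_def by linarith
  have gn: "g \<le> \<eta> * ?n"
    unfolding g_def using A(3) \<eta>0 n by (intro real_le_lsqrt) (auto simp: power2_eq_square intro!: mult_left_mono)
  have R: "card {p \<in> ?T. card (free_slots W S own p A) < m} \<le> exp (- real (card A)) * card ?T"
  proof (rule card_few_free_slots[OF fin WS r A(1) _ Am, where z = "\<delta> * ?n / 2"])
    show "A \<noteq> {}" using A(2) by auto
    have "\<eta> * ?n \<le> \<delta> * ?n / 2" using \<delta> n by (simp add: \<eta>)
    then show "\<delta> * ?n / 2 + card A \<le> card {u \<in> W. slot_deg S own u = 0}" using \<delta> A(3) by linarith
    have "(real m)\<^sup>2 \<le> g\<^sup>2" using mg by (intro power_mono) auto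
    also have "g\<^sup>2 = \<eta> * ?n * card A" using \<eta>0 by (simp add: g_def)
    finally show "432 * (real m)\<^sup>2 \<le> \<delta> * ?n / 2 * card A" by (simp add: \<eta>)
    show "216 * real m \<le> \<delta> * ?n / 2"
    proof -
      have "216 * real m \<le> 216 * (\<eta> * ?n)" using mg gn by linarith
      also have "\<dots> \<le> \<delta> * ?n / 2" using \<delta> n by (simp add: \<eta>)
      finally show ?thesis .
    qed
  qed
  have G: "card {p \<in> ?T. m \<le> card (free_slots W S own p A) \<and> orbit_in (W - ancestors W (own \<circ> p) A) (own \<circ> p) y b}
     \<le> exp (- (g / (2 * ?n) * y)) * card ?T" for b
  proof -
    have "card {p \<in> ?T. m \<le> card (free_slots W S own p A) \<and> orbit_in (W - ancestors W (own \<circ> p) A) (own \<circ> p) y b}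
      \<le> exp (- ((real m - 1) / ?n) * y) * card ?T"
      using fin WS Am A(2) by (intro card_far_le) auto
    also have "\<dots> \<le> exp (- (g / (2 * ?n) * y)) * card ?T"
    proof -
      have "g / 2 \<le> real m - 1" using mg g0 by linarith
      then have "g / 2 / ?n * y \<le> (real m - 1) / ?n * y"
        using n by (intro mult_right_mono divide_right_mono) auto
      then show ?thesis by (intro mult_right_mono) auto
    qed
    finally show ?thesis .
  qed
  have finT: "finite ?T" using fin by (rule finite_slot_trees)
  have "{p \<in> ?T. \<exists>b\<in>B. orbit_in (W - ancestors W (own \<circ> p) A) (own \<circ> p) y b} \<subseteq>
    {p \<in> ?T. card (free_slots W S own p A) < m} \<union>
    (\<Union>b\<in>B. {p \<in> ?T. m \<le> card (free_slots W S own p A) \<and> orbit_in (W - ancestors W (own \<circ> p) A) (own \<circ> p) y b})"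
    (is "_ \<subseteq> ?X \<union> (\<Union>b\<in>B. ?Y b)")
    by (auto simp: not_less)
  then have "card {p \<in> ?T. \<exists>b\<in>B. orbit_in (W - ancestors W (own \<circ> p) A) (own \<circ> p) y b} \<le> card (?X \<union> (\<Union>b\<in>B. ?Y b))"
    using finT B by (intro card_mono) auto
  also have "\<dots> \<le> card ?X + card (\<Union>b\<in>B. ?Y b)"
    by (rule card_Un_le)
  also have "\<dots> \<le> card ?X + (\<Sum>b\<in>B. card (?Y b))"
    by (intro add_left_mono card_UN_le B)
  finally have nat_le: "card {p \<in> ?T. \<exists>b\<in>B. orbit_in (W - ancestors W (own \<circ> p) A) (own \<circ> p) y b}
     \<le> card ?X + (\<Sum>b\<in>B. card (?Y b))" .
  have "real (card {p \<in> ?T. \<exists>b\<in>B. orbit_in (W - ancestors W (own \<circ> p) A) (own \<circ> p) y b})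
     \<le> card ?X + (\<Sum>b\<in>B. real (card (?Y b)))"
    using of_nat_mono[OF nat_le, where 'a = real] by (simp only: of_nat_add of_nat_sum)
  also have "\<dots> \<le> exp (- real (card A)) * card ?T + (\<Sum>b\<in>B. exp (- (g / (2 * ?n) * y)) * card ?T)"
    by (intro add_mono R sum_mono G)
  also have "\<dots> = (exp (- real (card A)) + card B * exp (- (g / (2 * ?n) * y))) * card ?T"
    by (simp add: algebra_simps)
  finally show ?thesis by (simp add: g_def)
qed

lemma sum_Suc_div_two_power: "(\<Sum>i\<le>I. (real i + 1) / 2 ^ i) = 4 - (real I + 3) / 2 ^ I"
  by (induction I) (simp_all add: field_simps)

lemma sum_half_power_le: "(\<Sum>i\<le>I. (1 / 2 :: real) ^ i) \<le> 2"
proof -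
  have "(\<Sum>i\<le>I. (1 / 2 :: real) ^ i) = 2 - (1 / 2) ^ I"
    by (induction I) (simp_all add: field_simps)
  then show ?thesis by simp
qed

text \<open>
  Chaining over sets \<open>A i\<close> of \<open>4 ^ i * K\<close> leaves: the distance from a vertex of \<open>A (i + 1)\<close> to the
  subtree spanned by \<open>A i\<close> is at most of order \<open>(i + 1) / 2 ^ i * sqrt (K * n)\<close>, and these sum up.
\<close>

lemma card_tall_slot_trees:
  fixes own :: "'s \<Rightarrow> 'v" and \<delta> \<eta> :: real
  assumes fin: "finite W" "finite S" and WS: "card W = card S" and r: "card (root_slots W S own) = 1"
    and \<delta>: "0 < \<delta>" "\<delta> \<le> 1" "\<delta> * card W \<le> real (card {u \<in> W. slot_deg S own u = 0})"
    and \<eta>: "\<eta> = \<delta> / 864"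
    and K: "4 \<le> K" "real K \<le> \<eta> * card W"
    and h: "(8 / sqrt \<delta> + 32 / sqrt \<eta> + 2) * sqrt (real K * card W) \<le> h"
  shows "card {p \<in> slot_trees W S own. \<exists>v\<in>W. orbit_in W (own \<circ> p) h v} \<le>
    (5 + 1 / \<eta>) * exp (- real K) * card (slot_trees W S own)"
proof -
  let ?n = "real (card W)" and ?T = "slot_trees W S own" and ?L = "{u \<in> W. slot_deg S own u = 0}"
  have \<eta>0: "0 < \<eta>" "\<eta> \<le> 1 / 864" using \<delta> \<eta> by auto
  have Kp: "real K > 0" using K by simp
  have n0: "?n > 0"
  proof -
    have "card W \<noteq> 0" using K by (auto intro!: Nat.gr0I)
    then show ?thesis by simp
  qed
  define Q where "Q = sqrt (real K * ?n)"
  have Q2: "Q\<^sup>2 = real K * ?n" using n0 by (simp add: Q_def)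
  have Q0: "Q > 0" using Kp n0 by (simp add: Q_def)
  have Kn: "K \<le> ?n"
  proof -
    have "\<eta> * ?n \<le> 1 * ?n" using \<eta>0 by (intro mult_right_mono) auto
    then show ?thesis using K by linarith
  qed
  have KQ: "K \<le> Q" unfolding Q_def using Kn by (intro real_le_rsqrt) (simp add: power2_eq_square mult_left_mono)
  have Ke: "real K \<le> exp (real K)" using exp_ge_add_one_self[of "real K"] by linarith
  \<comment> \<open>\<open>I\<close> becomes the last stage before \<open>4 ^ i * K\<close> exceeds
    \<open>\<eta> * n\<close>. One further stage then takes in all of \<open>W\<close>, because
    \<open>card W\<close> is below \<open>4 ^ Suc I * K / \<eta>\<close>.\<close>
  define P where "P j \<longleftrightarrow> \<eta> * ?n < 4 ^ j * real K" for j :: nat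
  have "\<exists>j. P j"
  proof -
    obtain j where "\<eta> * ?n < 4 ^ j" using real_arch_pow[of 4 "\<eta> * ?n"] by auto
    also have "\<dots> \<le> 4 ^ j * real K" using K by simp
    finally show ?thesis by (auto simp: P_def)
  qed
  then have PL: "P (LEAST j. P j)" by (rule LeastI_ex)
  have "\<not> P 0" using K by (simp add: P_def)
  then obtain I where I: "(LEAST j. P j) = Suc I" using PL by (metis not0_implies_Suc)
  have up: "\<eta> * ?n < 4 ^ Suc I * real K" using PL unfolding I by (simp add: P_def)
  have lo: "4 ^ i * real K \<le> \<eta> * ?n" if "i \<le> I" for i
  proof -
    have "\<not> P i" using that I not_less_Least[of i P] by simp
    then show ?thesis by (simp add: P_def)
  qed
  \<comment> \<open>Each of the \<open>I + 2\<close> lengths below is rounded up;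
    \<open>I + 1 \<le> 2 ^ I \<le> Q\<close> absorbs this into the summand 2 of the height
    constant.\<close>
  have two_Q: "2 ^ I \<le> Q"
  proof (rule power2_le_imp_le)
    have "(2 ^ I)\<^sup>2 = (4::real) ^ I" by (simp add: power2_eq_square flip: power_mult_distrib)
    also have "\<dots> \<le> 4 ^ I * real K" using K by simp
    also have "\<dots> \<le> \<eta> * ?n" by (rule lo) simp
    also have "\<dots> \<le> real K * ?n" using \<eta>0 K n0 by (intro mult_right_mono) auto
    finally show "(2 ^ I)\<^sup>2 \<le> Q\<^sup>2" by (simp add: Q2)
  qed (use Q0 in simp)
  have exA: "\<exists>A. A \<subseteq> ?L \<and> card A = 4 ^ i * K" if "i \<le> I" for i
  proof -
    have "real (4 ^ i * K) \<le> \<eta> * ?n" using lo[OF that] by simp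
    also have "\<dots> \<le> \<delta> * ?n" using \<delta> n0 by (simp add: \<eta>)
    finally have "4 ^ i * K \<le> card ?L" using \<delta> by linarith
    then show ?thesis by (rule obtain_subset_with_card_n) blast
  qed
  define A where "A i = (if i \<le> I then (SOME A. A \<subseteq> ?L \<and> card A = 4 ^ i * K) else W)" for i
  have A: "A i \<subseteq> ?L" "card (A i) = 4 ^ i * K" if "i \<le> I" for i
    using someI_ex[OF exA[OF that]] that by (auto simp: A_def)
  have AS: "A (Suc I) = W" by (simp add: A_def)
  have cA: "real (card (A (Suc i))) \<le> 4 ^ Suc i * real K / \<eta>" if "i \<le> I" for i
  proof (cases "i = I")
    case True
    then show ?thesis using up \<eta>0 by (simp add: AS pos_le_divide_eq mult.commute)
  next
    case False
    then have "real (card (A (Suc i))) = 4 ^ Suc i * real K" using A(2)[of "Suc i"] that by simp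
    also have "\<dots> \<le> 4 ^ Suc i * real K / \<eta>"
      using \<eta>0 K by (subst pos_le_divide_eq) (auto intro!: mult_left_le)
    finally show ?thesis .
  qed
  \<comment> \<open>These lengths give exponent at least \<open>2 * K\<close> to the first lines,
    half of which pays for the union over \<open>K\<close> leaves, and at least
    \<open>4 * (i + 1) * K\<close> to stage \<open>i\<close>. The factor \<open>i + 1\<close> pays
    for about \<open>4 ^ Suc i * K / \<eta>\<close> vertices, while the series of
    \<open>(i + 1) / 2 ^ i\<close> still sums to 4.\<close>
  define y where "y i = (case i of 0 \<Rightarrow> nat \<lceil>8 / sqrt \<delta> * Q\<rceil> | Suc i \<Rightarrow> nat \<lceil>8 / sqrt \<eta> * (real i + 1) / 2 ^ i * Q\<rceil>)" for i
  have y0: "8 / sqrt \<delta> * Q \<le> y 0" "y 0 \<le> 8 / sqrt \<delta> * Q + 1"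
  proof -
    have "8 / sqrt \<delta> * Q \<ge> 0" using \<delta> Q0 by simp
    then show "8 / sqrt \<delta> * Q \<le> y 0" "y 0 \<le> 8 / sqrt \<delta> * Q + 1"
      unfolding y_def nat.case by linarith+
  qed
  have yS: "8 / sqrt \<eta> * (real i + 1) / 2 ^ i * Q \<le> y (Suc i)" "y (Suc i) \<le> 8 / sqrt \<eta> * (real i + 1) / 2 ^ i * Q + 1" for i
  proof -
    have "8 / sqrt \<eta> * (real i + 1) / 2 ^ i * Q \<ge> 0" using \<eta>0 Q0 by simp
    then show "8 / sqrt \<eta> * (real i + 1) / 2 ^ i * Q \<le> y (Suc i)" "y (Suc i) \<le> 8 / sqrt \<eta> * (real i + 1) / 2 ^ i * Q + 1"
      unfolding y_def nat.case by linarith+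
  qed
  have ysum: "(\<Sum>i\<le>Suc I. y i) \<le> h"
  proof -
    have "real (\<Sum>i\<le>Suc I. y i) = y 0 + (\<Sum>i\<le>I. real (y (Suc i)))"
      by (simp add: sum.atMost_Suc_shift del: sum.atMost_Suc)
    also have "\<dots> \<le> (8 / sqrt \<delta> * Q + 1) + (\<Sum>i\<le>I. 8 / sqrt \<eta> * (real i + 1) / 2 ^ i * Q + 1)"
      by (intro add_mono sum_mono y0 yS)
    also have "(\<Sum>i\<le>I. 8 / sqrt \<eta> * (real i + 1) / 2 ^ i * Q + 1) = 8 / sqrt \<eta> * Q * (\<Sum>i\<le>I. (real i + 1) / 2 ^ i) + (real I + 1)"
      by (simp add: sum.distrib sum_distrib_left mult_ac)
    also have "\<dots> \<le> 8 / sqrt \<eta> * Q * 4 + Q"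
    proof (intro add_mono mult_left_mono)
      show "(\<Sum>i\<le>I. (real i + 1) / 2 ^ i) \<le> 4" by (simp add: sum_Suc_div_two_power)
      have "I + 1 \<le> 2 ^ I" using less_exp[of I] by (simp add: Suc_le_eq)
      then have "real (I + 1) \<le> real (2 ^ I)" by (rule of_nat_mono)
      then show "real I + 1 \<le> Q" using two_Q by simp
    qed (use \<eta>0 Q0 in auto)
    finally have "real (\<Sum>i\<le>Suc I. y i) \<le> (8 / sqrt \<delta> * Q + 1) + (8 / sqrt \<eta> * Q * 4 + Q)" by simp
    also have "\<dots> \<le> (8 / sqrt \<delta> + 32 / sqrt \<eta> + 2) * Q"
    proof -
      have "1 \<le> Q" using KQ K by linarith
      then show ?thesis by (simp add: algebra_simps)
    qed
    also have "\<dots> \<le> h" using h by (simp add: Q_def)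
    finally show ?thesis by (simp only: of_nat_le_iff)
  qed
  define X0 where "X0 = {p \<in> ?T. \<exists>a\<in>A 0. orbit_in W (own \<circ> p) (y 0) a}"
  define X where "X i = {p \<in> ?T. \<exists>b\<in>A (Suc i). orbit_in (W - ancestors W (own \<circ> p) (A i)) (own \<circ> p) (y (Suc i)) b}" for i
  have finT: "finite ?T" using fin by (rule finite_slot_trees)
  have sub: "{p \<in> ?T. \<exists>v\<in>W. orbit_in W (own \<circ> p) h v} \<subseteq> X0 \<union> (\<Union>i\<le>I. X i)"
  proof
    fix p assume "p \<in> {p \<in> ?T. \<exists>v\<in>W. orbit_in W (own \<circ> p) h v}"
    then obtain v where p: "p \<in> ?T" and v: "v \<in> W" "orbit_in W (own \<circ> p) h v" by auto
    show "p \<in> X0 \<union> (\<Union>i\<le>I. X i)"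
    proof (rule ccontr)
      assume n: "p \<notin> X0 \<union> (\<Union>i\<le>I. X i)"
      have "\<not> orbit_in W (own \<circ> p) (\<Sum>i\<le>Suc I. y i) v"
      proof (rule orbit_in_chain[where A = A])
        show "\<not> orbit_in W (own \<circ> p) (y 0) a" if "a \<in> A 0" for a
          using n p that by (auto simp: X0_def)
        show "\<not> orbit_in (W - ancestors W (own \<circ> p) (A i)) (own \<circ> p) (y (Suc i)) a"
          if i: "i < Suc I" and a: "a \<in> A (Suc i)" for i a
        proof -
          have "p \<notin> X i" using n i by auto
          then show ?thesis using p a unfolding X_def by blast
        qed
        show "v \<in> ancestors W (own \<circ> p) (A (Suc I))"
          using v(1) unfolding AS by (intro ancestors.base)
      qed
      then show False using orbit_in_antimono[OF v(2) ysum] by blast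
    qed
  qed
  have X0: "real (card X0) \<le> 3 * exp (- real K) * card ?T"
  proof -
    have fA: "finite (A 0)" using A(1)[of 0] fin finite_subset by (metis (no_types, lifting) le0 mem_Collect_eq subsetI subset_eq)
    have one: "real (card {p \<in> ?T. orbit_in W (own \<circ> p) (y 0) a}) \<le> 3 * exp (- 2 * real K) * card ?T" if a: "a \<in> A 0" for a
    proof -
      have "real (card {p \<in> ?T. orbit_in W (own \<circ> p) (y 0) a}) \<le> 3 * exp (- (\<delta> * (real (y 0))\<^sup>2 / (32 * ?n))) * card ?T"
      proof (rule card_deep_leaf_le[OF fin WS r \<delta>(1)])
        show "a \<in> W" "slot_deg S own a = 0" using a A(1)[of 0] by auto
        have "\<eta> * ?n \<ge> 4" using K by linarith
        then have "\<delta> * ?n \<ge> 4" using \<eta> by simp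
        then show "\<delta> * ?n + 2 \<le> 2 * real (card ?L)" using \<delta> by linarith
        have "8 / sqrt \<delta> * Q \<le> ?n"
        proof -
          have "real K * ?n \<le> \<eta> * ?n * ?n" using K n0 by (intro mult_right_mono) auto
          then have "Q \<le> sqrt (\<delta> / 64 * ?n\<^sup>2)"
            unfolding Q_def using \<delta> by (intro real_sqrt_le_mono order_trans[OF \<open>real K * ?n \<le> \<eta> * ?n * ?n\<close>])
              (simp add: \<eta> power2_eq_square mult_right_mono)
          also have "\<dots> = sqrt \<delta> / 8 * ?n" using n0 by (simp add: real_sqrt_mult real_sqrt_divide)
          finally show ?thesis using \<delta> by (simp add: field_simps)
        qed
        moreover have "1 \<le> ?n" using Kn K by linarith
        ultimately show "y 0 \<le> 2 * card W" using y0 by linarith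
      qed
      also have "\<dots> \<le> 3 * exp (- 2 * real K) * card ?T"
      proof -
        have "64 / \<delta> * Q\<^sup>2 = (8 / sqrt \<delta> * Q)\<^sup>2" using \<delta> by (simp add: power_mult_distrib power_divide)
        also have "\<dots> \<le> (real (y 0))\<^sup>2" using y0 \<delta> Q0 by (intro power_mono) auto
        finally have "\<delta> * (64 / \<delta> * Q\<^sup>2) / (32 * ?n) \<le> \<delta> * (real (y 0))\<^sup>2 / (32 * ?n)"
          using \<delta> by (intro divide_right_mono mult_left_mono) auto
        moreover have "\<delta> * (64 / \<delta> * Q\<^sup>2) / (32 * ?n) = 2 * real K" using \<delta> n0 by (simp add: Q2)
        ultimately show ?thesis by (intro mult_right_mono mult_left_mono) auto
      qed
      finally show ?thesis .
    qed
    have "X0 = (\<Union>a\<in>A 0. {p \<in> ?T. orbit_in W (own \<circ> p) (y 0) a})" by (auto simp: X0_def)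
    then have "card X0 \<le> (\<Sum>a\<in>A 0. card {p \<in> ?T. orbit_in W (own \<circ> p) (y 0) a})"
      using card_UN_le[OF fA] by simp
    from of_nat_mono[OF this, where 'a = real]
    have "real (card X0) \<le> (\<Sum>a\<in>A 0. real (card {p \<in> ?T. orbit_in W (own \<circ> p) (y 0) a}))" by simp
    also have "\<dots> \<le> (\<Sum>a\<in>A 0. 3 * exp (- 2 * real K) * card ?T)" by (intro sum_mono one)
    also have "\<dots> = real K * (3 * exp (- 2 * real K) * card ?T)" using A(2)[of 0] by simp
    also have "\<dots> \<le> exp (real K) * (3 * exp (- 2 * real K) * card ?T)"
      using Ke by (intro mult_right_mono) auto
    also have "\<dots> = 3 * exp (- real K) * card ?T" by (simp add: exp_add[symmetric] mult_ac)
    finally show ?thesis .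
  qed
  have X: "real (card (X i)) \<le> (exp (- real K) * (1 / 2) ^ i + exp (- real K) * (1 / 2) ^ Suc i / \<eta>) * card ?T" if i: "i \<le> I" for i
  proof -
    have fA: "finite (A (Suc i))"
      using A(1)[of "Suc i"] fin AS by (cases "i = I") (use i in \<open>auto intro: finite_subset\<close>)
    have "real (card (X i)) \<le> (exp (- real (card (A i))) + card (A (Suc i)) * exp (- (sqrt (\<eta> * ?n * card (A i)) / (2 * ?n) * y (Suc i)))) * card ?T"
      unfolding X_def
    proof (rule card_stage_le[OF fin WS r \<delta>(1,3) \<eta> A(1)[OF i] _ _ fA])
      have "(1::nat) * 4 \<le> 4 ^ i * K" using K by (intro mult_mono) auto
      then show "4 \<le> card (A i)" by (simp add: A(2)[OF i])
      show "real (card (A i)) \<le> \<eta> * ?n" using lo[OF i] by (simp add: A(2)[OF i])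
    qed
    also have "\<dots> \<le> (exp (- real K) * (1 / 2) ^ i + exp (- real K) * (1 / 2) ^ Suc i / \<eta>) * card ?T"
    proof (intro mult_right_mono add_mono)
      have half: "exp (- (1::real)) \<le> 1 / 2"
      proof -
        have "(2::real) \<le> exp 1" using exp_ge_add_one_self[of "1::real"] by linarith
        then show ?thesis by (simp add: exp_minus field_simps)
      qed
      have "i < 2 ^ i" by (rule less_exp)
      also have "(2::nat) ^ i \<le> 4 ^ i" by (rule power_mono) auto
      finally have "i + 1 \<le> 4 ^ i" by simp
      then have "real K * (real i + 1) \<le> real K * 4 ^ i"
        by (intro mult_left_mono) (metis of_nat_Suc of_nat_le_iff of_nat_numeral of_nat_power Suc_eq_plus1 add.commute, simp)
      moreover have "real i \<le> real K * real i" using K by (cases i) auto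
      ultimately have "real K + real i \<le> 4 ^ i * real K" by (simp add: algebra_simps)
      then have "exp (- real (card (A i))) \<le> exp (- real K + real i * (- 1))" by (simp add: A(2)[OF i])
      also have "\<dots> = exp (- real K) * exp (- 1) ^ i" by (simp only: exp_add exp_of_nat_mult)
      also have "\<dots> \<le> exp (- real K) * (1 / 2) ^ i" using half by (intro mult_left_mono power_mono) auto
      finally show "exp (- real (card (A i))) \<le> exp (- real K) * (1 / 2) ^ i" .
      have "4 * real K * (real i + 1) = 4 * (real i + 1) * Q\<^sup>2 / ?n"
        using n0 by (simp add: Q2)
      also have "\<dots> = sqrt \<eta> * 2 ^ i * Q / (2 * ?n) * (8 / sqrt \<eta> * (real i + 1) / 2 ^ i * Q)"
        using \<eta>0 n0 by (simp add: field_simps power2_eq_square)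
      also have "\<dots> \<le> sqrt \<eta> * 2 ^ i * Q / (2 * ?n) * y (Suc i)"
        using \<eta>0 Q0 by (intro mult_left_mono yS) auto
      also have "sqrt \<eta> * 2 ^ i * Q = sqrt (\<eta> * ?n * card (A i))"
      proof -
        have "sqrt (4 ^ i) = (2::real) ^ i" by (simp add: real_sqrt_power)
        then show ?thesis by (simp add: Q_def A(2)[OF i] real_sqrt_mult)
      qed
      finally have ex: "4 * real K * (real i + 1) \<le> sqrt (\<eta> * ?n * card (A i)) / (2 * ?n) * y (Suc i)" .
      have "real (card (A (Suc i))) * exp (- (sqrt (\<eta> * ?n * card (A i)) / (2 * ?n) * y (Suc i)))
        \<le> (4 ^ Suc i * real K / \<eta>) * exp (- (2 * real K + real (Suc i) * 8))"
      proof (intro mult_mono cA i)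
        \<comment> \<open>This rests on \<open>K \<ge> 4\<close>. The part \<open>exp (- 8)\<close>
          per index turns \<open>4 ^ Suc i\<close> into at most \<open>(1 / 2) ^ Suc i\<close>, and
          \<open>exp (- 2 * K)\<close> absorbs the factor \<open>K\<close>.\<close>
        have "2 * real K + real (Suc i) * 8 \<le> 4 * real K * (real i + 1)"
        proof -
          have "4 * (real i + 1) \<le> real K * (real i + 1)" using K by (intro mult_right_mono) auto
          moreover have "real K * 1 \<le> real K * (real i + 1)" by (intro mult_left_mono) auto
          moreover have "4 * real K * (real i + 1) = 4 * (real K * (real i + 1))" by simp
          moreover have "real (Suc i) * 8 = 2 * (4 * (real i + 1))" by simp
          ultimately show ?thesis by linarith
        qed
        then show "exp (- (sqrt (\<eta> * ?n * card (A i)) / (2 * ?n) * y (Suc i))) \<le> exp (- (2 * real K + real (Suc i) * 8))"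
          using ex by simp
      qed (use \<eta>0 in auto)
      also have "\<dots> \<le> (4 ^ Suc i * exp (real K) / \<eta>) * (exp (- (2 * real K)) * (1 / 8) ^ Suc i)"
      proof (intro mult_mono divide_right_mono mult_left_mono)
        show "real K \<le> exp (real K)" by (rule Ke)
        have "(8::real) \<le> exp 8" using exp_ge_add_one_self[of "8::real"] by linarith
        then have "exp (- (8::real)) \<le> 1 / 8" by (simp add: exp_minus field_simps)
        then have "exp (- (2 * real K)) * exp (- 8) ^ Suc i \<le> exp (- (2 * real K)) * (1 / 8) ^ Suc i"
          by (intro mult_left_mono power_mono) auto
        moreover have "exp (- (2 * real K + real (Suc i) * 8)) = exp (- (2 * real K)) * exp (- 8) ^ Suc i"
          by (simp only: exp_of_nat_mult[symmetric] exp_add[symmetric]) (simp add: algebra_simps)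
        ultimately show "exp (- (2 * real K + real (Suc i) * 8)) \<le> exp (- (2 * real K)) * (1 / 8) ^ Suc i" by simp
      qed (use \<eta>0 in auto)
      also have "\<dots> = exp (- real K) * (1 / 2) ^ Suc i / \<eta>"
      proof -
        have a: "exp (real K) * exp (- (2 * real K)) = exp (- real K)" by (simp add: exp_add[symmetric])
        have b: "4 ^ Suc i * (1 / 8) ^ Suc i = (1 / 2 :: real) ^ Suc i" by (simp only: power_mult_distrib[symmetric]) simp
        have "(4 ^ Suc i * exp (real K) / \<eta>) * (exp (- (2 * real K)) * (1 / 8) ^ Suc i) =
          (exp (real K) * exp (- (2 * real K))) * (4 ^ Suc i * (1 / 8) ^ Suc i) / \<eta>" by simp
        then show ?thesis unfolding a b .
      qed
      finally show "real (card (A (Suc i))) * exp (- (sqrt (\<eta> * ?n * card (A i)) / (2 * ?n) * y (Suc i)))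
        \<le> exp (- real K) * (1 / 2) ^ Suc i / \<eta>" .
    qed simp
    finally show ?thesis .
  qed
  have finX: "finite (X0 \<union> (\<Union>i\<le>I. X i))"
    by (rule finite_subset[OF _ finT]) (auto simp: X0_def X_def)
  have "card {p \<in> ?T. \<exists>v\<in>W. orbit_in W (own \<circ> p) h v} \<le> card (X0 \<union> (\<Union>i\<le>I. X i))"
    by (rule card_mono[OF finX sub])
  also have "\<dots> \<le> card X0 + card (\<Union>i\<le>I. X i)" by (rule card_Un_le)
  also have "\<dots> \<le> card X0 + (\<Sum>i\<le>I. card (X i))" by (intro add_left_mono card_UN_le) simp
  finally have nat_le: "card {p \<in> ?T. \<exists>v\<in>W. orbit_in W (own \<circ> p) h v} \<le> card X0 + (\<Sum>i\<le>I. card (X i))" .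
  have "real (card {p \<in> ?T. \<exists>v\<in>W. orbit_in W (own \<circ> p) h v}) \<le> real (card X0) + (\<Sum>i\<le>I. real (card (X i)))"
    using of_nat_mono[OF nat_le, where 'a = real] by (simp only: of_nat_add of_nat_sum)
  also have "\<dots> \<le> 3 * exp (- real K) * card ?T +
    (\<Sum>i\<le>I. (exp (- real K) * (1 / 2) ^ i + exp (- real K) * (1 / 2) ^ Suc i / \<eta>) * card ?T)"
    by (intro add_mono X0 sum_mono X) simp
  also have "\<dots> = (3 + (\<Sum>i\<le>I. (1 / 2) ^ i) * (1 + 1 / (2 * \<eta>))) * exp (- real K) * card ?T"
  proof -
    have "(exp (- real K) * (1 / 2) ^ i + exp (- real K) * (1 / 2) ^ Suc i / \<eta>) * card ?T =
      (1 / 2) ^ i * ((1 + 1 / (2 * \<eta>)) * exp (- real K) * card ?T)" for i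
      using \<eta>0 by (simp add: field_simps)
    then show ?thesis by (simp only: sum_distrib_right[symmetric]) (simp add: algebra_simps)
  qed
  also have "\<dots> \<le> (3 + 2 * (1 + 1 / (2 * \<eta>))) * exp (- real K) * card ?T"
    using \<eta>0 by (intro mult_right_mono add_left_mono sum_half_power_le) auto
  also have "\<dots> = (5 + 1 / \<eta>) * exp (- real K) * card ?T" by simp
  finally show ?thesis .
qed

section \<open>Degree sequences with few leaves\<close>

unbundle no vec_syntax
unbundle fps_syntax

definition degree_seqs :: "'i set \<Rightarrow> nat \<Rightarrow> ('i \<Rightarrow> nat) set" where
  "degree_seqs I s = {d \<in> I \<rightarrow>\<^sub>E UNIV. (\<Sum>i\<in>I. d i) = s}"

lemma finite_degree_seqs:
  assumes "finite I"
  shows "finite (degree_seqs I s)"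
proof (rule finite_subset)
  show "degree_seqs I s \<subseteq> I \<rightarrow>\<^sub>E {..s}"
    using assms by (auto simp: degree_seqs_def PiE_iff extensional_def intro: member_le_sum)
  show "finite (I \<rightarrow>\<^sub>E {..s})" using assms by (intro finite_PiE) auto
qed

lemma sum_degree_seqs_insert:
  assumes "finite I" "i \<notin> I"
  shows "(\<Sum>d\<in>degree_seqs (insert i I) s. F d) = (\<Sum>k\<le>s. \<Sum>d\<in>degree_seqs I (s - k). F (d(i := k)))"
proof -
  have "(\<Sum>k\<le>s. \<Sum>d\<in>degree_seqs I (s - k). F (d(i := k))) =
    (\<Sum>(k, d)\<in>(SIGMA k:{..s}. degree_seqs I (s - k)). F (d(i := k)))"
    using assms by (intro sum.Sigma) (auto intro: finite_degree_seqs)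
  also have "\<dots> = (\<Sum>d\<in>degree_seqs (insert i I) s. F d)"
  proof (rule sum.reindex_bij_witness[where j = "\<lambda>(k, d). d(i := k)" and i = "\<lambda>d. (d i, restrict d I)"])
    fix x assume "x \<in> (SIGMA k:{..s}. degree_seqs I (s - k))"
    then obtain k d where x: "x = (k, d)" "k \<le> s" "d \<in> I \<rightarrow>\<^sub>E UNIV" "(\<Sum>i\<in>I. d i) = s - k"
      by (auto simp: degree_seqs_def)
    have "(\<Sum>j\<in>I. (d(i := k)) j) = (\<Sum>i\<in>I. d i)"
      using assms by (intro sum.cong) auto
    then show "(\<lambda>(k, d). d(i := k)) x \<in> degree_seqs (insert i I) s"
      using x assms by (simp add: degree_seqs_def PiE_iff extensional_def)
    have "restrict (d(i := k)) I = d"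
      using x assms by (auto simp: fun_eq_iff PiE_iff extensional_def)
    then show "((\<lambda>(k, d). d(i := k)) x i, restrict ((\<lambda>(k, d). d(i := k)) x) I) = x"
      by (simp add: x)
    show "F ((\<lambda>(k, d). d(i := k)) x) = (case x of (k, d) \<Rightarrow> F (d(i := k)))"
      by (simp add: x)
  next
    fix d assume "d \<in> degree_seqs (insert i I) s"
    then have d: "d \<in> insert i I \<rightarrow>\<^sub>E UNIV" "d i + (\<Sum>i\<in>I. d i) = s"
      using assms by (auto simp: degree_seqs_def)
    show "(\<lambda>(k, d). d(i := k)) (d i, restrict d I) = d"
      using d assms by (auto simp: fun_eq_iff PiE_iff extensional_def)
    show "(d i, restrict d I) \<in> (SIGMA k:{..s}. degree_seqs I (s - k))"
      using d by (auto simp: degree_seqs_def)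
  qed
  finally show ?thesis by simp
qed

text \<open>Multiplying series concatenates sequences, so exchange arguments on offspring numbers
  become inequalities between coefficients.\<close>

lemma sum_prod_degree_seqs:
  fixes c :: "nat \<Rightarrow> 'a :: comm_ring_1" and I :: "'i set"
  assumes "finite I"
  shows "(\<Sum>d\<in>degree_seqs I s. \<Prod>i\<in>I. c (d i)) = (Abs_fps c ^ card I) $ s"
  using assms
proof (induction I arbitrary: s)
  case empty
  have "(degree_seqs {} s :: ('i \<Rightarrow> nat) set) = (if s = 0 then {\<lambda>x. undefined} else {})"
    by (auto simp: degree_seqs_def)
  then show ?case by (cases "s = 0") auto
next
  case (insert i I)
  have "(\<Sum>d\<in>degree_seqs (insert i I) s. \<Prod>j\<in>insert i I. c (d j)) =
    (\<Sum>k\<le>s. \<Sum>d\<in>degree_seqs I (s - k). \<Prod>j\<in>insert i I. c ((d(i := k)) j))"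
    by (rule sum_degree_seqs_insert) fact+
  also have "\<dots> = (\<Sum>k\<le>s. \<Sum>d\<in>degree_seqs I (s - k). c k * (\<Prod>j\<in>I. c (d j)))"
  proof (intro sum.cong refl)
    fix k d
    have "(\<Prod>j\<in>I. c ((d(i := k)) j)) = (\<Prod>j\<in>I. c (d j))"
      using insert.hyps by (intro prod.cong) auto
    then show "(\<Prod>j\<in>insert i I. c ((d(i := k)) j)) = c k * (\<Prod>j\<in>I. c (d j))"
      using insert.hyps by simp
  qed
  also have "\<dots> = (\<Sum>k\<le>s. c k * (Abs_fps c ^ card I) $ (s - k))"
    by (simp add: sum_distrib_left[symmetric] insert.IH)
  also have "\<dots> = (Abs_fps c ^ card (insert i I)) $ s"
    using insert.hyps by (simp add: fps_mult_nth atMost_atLeast0)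
  finally show ?case .
qed

section \<open>Coefficients of powers of nonnegative series\<close>

lemma fps_mult_nth_nonneg:
  fixes f g :: "real fps"
  assumes "\<And>i. f $ i \<ge> 0" "\<And>i. g $ i \<ge> 0"
  shows "(f * g) $ i \<ge> 0"
  using assms by (auto simp: fps_mult_nth intro!: sum_nonneg)

lemma fps_power_nth_nonneg:
  fixes f :: "real fps"
  assumes "\<And>i. f $ i \<ge> 0"
  shows "(f ^ n) $ i \<ge> 0"
proof (induction n arbitrary: i)
  case (Suc n)
  then show ?case using assms fps_mult_nth_nonneg[of f "f ^ n"] by simp
qed (simp add: fps_one_nth)

lemma fps_mult_nth_ge:
  fixes f g :: "real fps"
  assumes "\<And>i. f $ i \<ge> 0" "\<And>i. g $ i \<ge> 0"
  shows "f $ i * g $ j \<le> (f * g) $ (i + j)"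
proof -
  have "f $ i * g $ (i + j - i) \<le> (\<Sum>k=0..i+j. f $ k * g $ (i + j - k))"
    using assms by (intro member_le_sum) auto
  then show ?thesis by (simp add: fps_mult_nth)
qed

lemma fps_binomial_nth:
  fixes f g :: "real fps"
  shows "((f + g) ^ n) $ s = (\<Sum>k\<le>n. real (n choose k) * (f ^ k * g ^ (n - k)) $ s)"
  by (simp add: binomial_ring fps_sum_nth mult.assoc fps_mult_of_nat_nth)

lemma fps_binomial_nth_ge:
  fixes f g :: "real fps"
  assumes "\<And>i. f $ i \<ge> 0" "\<And>i. g $ i \<ge> 0" "k \<le> n"
  shows "real (n choose k) * (f ^ k * g ^ (n - k)) $ s \<le> ((f + g) ^ n) $ s"
  unfolding fps_binomial_nth using assms
  by (intro member_le_sum mult_nonneg_nonneg fps_mult_nth_nonneg fps_power_nth_nonneg) auto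

lemma fps_const_X_power_mult_nth:
  fixes f :: "real fps"
  shows "((fps_const a * fps_X) ^ k * f) $ s = (if s < k then 0 else a ^ k * f $ (s - k))"
  by (simp add: power_mult_distrib fps_const_power mult.assoc fps_X_power_mult_nth)

text \<open>\<open>j\<close> entries of size at most \<open>M\<close> have total at most
  \<open>M * j\<close>. This feeds the pigeonhole choice of a likely total.\<close>

lemma fps_power_sum_ge:
  fixes f :: "real fps"
  assumes "\<And>i. f $ i \<ge> 0"
  shows "(\<Sum>k\<le>M. f $ k) ^ j \<le> (\<Sum>s\<le>M * j. (f ^ j) $ s)"
proof (induction j)
  case (Suc j)
  have nn: "(f ^ j) $ i \<ge> 0" for i by (rule fps_power_nth_nonneg[OF assms])
  have "(\<Sum>k\<le>M. f $ k) ^ Suc j \<le> (\<Sum>k\<le>M. f $ k) * (\<Sum>s\<le>M * j. (f ^ j) $ s)"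
    using Suc assms by (auto intro!: mult_left_mono sum_nonneg)
  also have "\<dots> = (\<Sum>k\<le>M. \<Sum>t\<le>M * j. f $ k * (f ^ j) $ t)"
    by (rule sum_product)
  also have "\<dots> = (\<Sum>x\<in>{..M} \<times> {..M * j}. f $ (fst x) * (f ^ j) $ (snd x))"
    by (simp add: sum.cartesian_product case_prod_beta)
  also have "\<dots> \<le> (\<Sum>x\<in>(SIGMA s:{..M * Suc j}. {0..s}). f $ snd x * (f ^ j) $ (fst x - snd x))"
  proof (rule sum_le_included[where i = "\<lambda>x. (snd x, fst x - snd x)"])
    show "\<forall>x\<in>{..M} \<times> {..M * j}. \<exists>y\<in>(SIGMA s:{..M * Suc j}. {0..s}).
        (snd y, fst y - snd y) = x \<and> f $ fst x * (f ^ j) $ snd x \<le> f $ snd y * (f ^ j) $ (fst y - snd y)"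
    proof
      fix x assume "x \<in> {..M} \<times> {..M * j}"
      then show "\<exists>y\<in>(SIGMA s:{..M * Suc j}. {0..s}).
        (snd y, fst y - snd y) = x \<and> f $ fst x * (f ^ j) $ snd x \<le> f $ snd y * (f ^ j) $ (fst y - snd y)"
        by (intro bexI[of _ "(fst x + snd x, fst x)"]) auto
    qed
  qed (use assms nn in auto)
  also have "\<dots> = (\<Sum>s\<le>M * Suc j. (f ^ Suc j) $ s)"
    by (simp add: fps_mult_nth sum.Sigma case_prod_beta)
  finally show ?case .
qed simp

lemma fps_power_nth_eq_0:
  fixes f :: "real fps"
  assumes "\<And>i. i < m \<Longrightarrow> f $ i = 0" "s < m * j"
  shows "(f ^ j) $ s = 0"
  using assms(2)
proof (induction j arbitrary: s)
  case (Suc j)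
  have "f $ i * (f ^ j) $ (s - i) = 0" if "i \<le> s" for i
  proof (cases "i < m")
    case False
    then have "s - i < m * j" using Suc.prems that by simp
    then show ?thesis using Suc.IH by simp
  qed (use assms in simp)
  then have "(\<Sum>i=0..s. f $ i * (f ^ j) $ (s - i)) = 0" by (intro sum.neutral) auto
  then show ?case by (simp add: fps_mult_nth)
qed simp

section \<open>Exchanging ones for balanced blocks\<close>

lemma sums_pmf_nat: "pmf \<mu> sums (1 :: real)" for \<mu> :: "nat pmf"
proof -
  have "(\<lambda>i. measure (measure_pmf \<mu>) {i}) sums measure (measure_pmf \<mu>) (\<Union>i. {i})"
    by (intro measure_pmf.finite_measure_UNION) (auto simp: disjoint_family_on_def)
  moreover have "(\<Union>i. {i}) = (UNIV :: nat set)" by auto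
  ultimately show ?thesis by (simp add: measure_pmf_single)
qed

text \<open>
  Sequences of \<open>L\<close> offspring numbers with total \<open>L\<close> can replace \<open>L\<close> ones without changing the total.
  By pigeonhole some total \<open>s\<close> of \<open>j\<close> offspring numbers \<open>\<ge> 2\<close> is likely; balancing them with \<open>s - j\<close>
  zeros and spreading these \<open>s\<close> entries over \<open>L = s * q\<close> positions gains the factor
  \<open>binomial L s \<ge> q ^ s\<close>, which beats \<open>\<epsilon> ^ s\<close>.
\<close>

lemma exists_balanced_block:
  fixes \<mu> :: "nat pmf" and \<epsilon> :: real
  assumes \<epsilon>: "0 < \<epsilon>" "\<epsilon> < 1" and h1: "pmf \<mu> 0 + pmf \<mu> 1 < 1 - \<epsilon>"
    and h2: "pmf \<mu> 0 / (pmf \<mu> 0 + pmf \<mu> 1) > \<epsilon>" and q: "9 \<le> \<epsilon> * real q"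
  shows "\<exists>L>0. (Abs_fps (pmf \<mu>) ^ L) $ L \<ge> exp (real L / real q) * pmf \<mu> 1 ^ L"
proof -
  \<comment> \<open>\<open>H\<close> collects the offspring numbers of at least 2, and
    \<open>g\<close> adds the zeros. With the ones as a separate summand, the binomial formula
    chooses the positions of a block that differ from one.\<close>
  define H :: "real fps" where "H = Abs_fps (\<lambda>k. if k < 2 then 0 else pmf \<mu> k)"
  define g where "g = fps_const (pmf \<mu> 0) + H"
  define f where "f = Abs_fps (pmf \<mu>)"
  have f: "f = fps_const (pmf \<mu> 1) * fps_X + g"
    by (rule fps_ext) (auto simp: f_def g_def H_def less_Suc_eq numeral_2_eq_2)
  have H0: "H $ i \<ge> 0" for i by (simp add: H_def)
  have g0: "g $ i \<ge> 0" for i by (simp add: g_def H0)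
  have mu1: "0 \<le> pmf \<mu> 1" "pmf \<mu> 1 \<le> 1" by (auto simp: pmf_le_1)
  have mu0: "\<epsilon> * pmf \<mu> 1 \<le> pmf \<mu> 0"
  proof -
    have "pmf \<mu> 0 + pmf \<mu> 1 \<noteq> 0" using h2 \<epsilon> by auto
    then have "pmf \<mu> 0 + pmf \<mu> 1 > 0" by (metis add_nonneg_nonneg less_eq_real_def pmf_nonneg)
    then have "\<epsilon> * (pmf \<mu> 0 + pmf \<mu> 1) < pmf \<mu> 0" using h2 by (simp add: pos_less_divide_eq)
    moreover have "\<epsilon> * pmf \<mu> 1 \<le> \<epsilon> * (pmf \<mu> 0 + pmf \<mu> 1)" using \<epsilon> by simp
    ultimately show ?thesis by linarith
  qed
  have q0: "real q > 0" using q \<epsilon> by (cases "q = 0") auto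
  obtain M where M: "\<epsilon> \<le> (\<Sum>k\<le>M. H $ k)" "M > 0"
  proof -
    have "(\<lambda>N. \<Sum>k<N. pmf \<mu> k) \<longlonglongrightarrow> 1" using sums_pmf_nat by (simp add: sums_def)
    then have "\<forall>\<^sub>F N in sequentially. (\<Sum>k<N. pmf \<mu> k) > \<epsilon> + (pmf \<mu> 0 + pmf \<mu> 1)"
      by (rule order_tendstoD) (use h1 in simp)
    then obtain N0 where N0: "\<And>N. N \<ge> N0 \<Longrightarrow> (\<Sum>k<N. pmf \<mu> k) > \<epsilon> + (pmf \<mu> 0 + pmf \<mu> 1)"
      by (auto simp: eventually_sequentially)
    define N where "N = N0 + 2"
    have "(\<Sum>k<Suc N. pmf \<mu> k) = (\<Sum>k<Suc N. H $ k + (if k < 2 then pmf \<mu> k else 0))"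
      by (intro sum.cong) (auto simp: H_def)
    also have "\<dots> = (\<Sum>k<Suc N. H $ k) + (\<Sum>k | k < Suc N \<and> k < 2. pmf \<mu> k)"
      by (simp add: sum.distrib sum.If_cases Int_def del: sum.lessThan_Suc)
    also have "{k. k < Suc N \<and> k < 2} = {0, 1}" by (auto simp: N_def)
    finally have "\<epsilon> \<le> (\<Sum>k\<le>N. H $ k)"
      using N0[of "Suc N"] by (simp add: N_def lessThan_Suc_atMost)
    then show ?thesis using that[of N] by (simp add: N_def)
  qed
  \<comment> \<open>This makes the number \<open>M * j + 1\<close> of possible totals at most
    \<open>(j + 1)\<^sup>2 \<le> exp (2 * j)\<close>, and \<open>2 * j \<le> s\<close> because all
    entries are at least 2.\<close>
  define j where "j = M + 1"
  obtain s where s: "\<epsilon> ^ j / (M * j + 1) \<le> (H ^ j) $ s"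
  proof (rule ccontr)
    assume "\<not> thesis"
    then have "(H ^ j) $ s < \<epsilon> ^ j / (M * j + 1)" for s using that not_le by blast
    then have "(\<Sum>s\<le>M * j. (H ^ j) $ s) < (\<Sum>s\<le>M * j. \<epsilon> ^ j / (M * j + 1))"
      by (intro sum_strict_mono) auto
    also have "\<dots> = real (M * j + 1) * (\<epsilon> ^ j / real (M * j + 1))" by simp
    also have "\<dots> = \<epsilon> ^ j"
    proof -
      have "real (M * j + 1) > 0" by (simp only: of_nat_0_less_iff)
      then have "real (M * j + 1) \<noteq> 0" by linarith
      then show ?thesis by (subst times_divide_eq_right) (rule nonzero_mult_div_cancel_left)
    qed
    also have "\<dots> \<le> (\<Sum>k\<le>M. H $ k) ^ j" using M \<epsilon> by (intro power_mono) auto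
    also have "\<dots> \<le> (\<Sum>s\<le>M * j. (H ^ j) $ s)" by (rule fps_power_sum_ge[OF H0])
    finally show False by simp
  qed
  have s2: "2 * j \<le> s"
  proof (rule ccontr)
    assume "\<not> 2 * j \<le> s"
    then have "(H ^ j) $ s = 0" by (intro fps_power_nth_eq_0[of 2]) (auto simp: H_def)
    moreover have "real (M * j + 1) > 0" by (simp only: of_nat_0_less_iff)
    then have "\<epsilon> ^ j / real (M * j + 1) > 0" using \<epsilon> by (intro divide_pos_pos zero_less_power)
    ultimately show False using s by simp
  qed
  have s0: "s > 0" using s2 by (simp add: j_def)
  define L where "L = s * q"
  have q1: "q \<ge> 1" using q0 by simp
  have sL: "s \<le> L" using q1 by (simp add: L_def)
  \<comment> \<open>The \<open>j\<close> large numbers with total \<open>s\<close> and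
    \<open>s - j\<close> zeros together fill \<open>s\<close> positions with total
    \<open>s\<close>.\<close>
  have gs: "pmf \<mu> 0 ^ (s - j) * (H ^ j) $ s \<le> (g ^ s) $ s"
  proof -
    have "1 * (pmf \<mu> 0 ^ (s - j) * (H ^ j) $ s) \<le> real (s choose (s - j)) * (pmf \<mu> 0 ^ (s - j) * (H ^ j) $ s)"
      using s2 by (intro mult_right_mono mult_nonneg_nonneg fps_power_nth_nonneg H0) (auto simp: Suc_le_eq)
    also have "\<dots> = real (s choose (s - j)) * (fps_const (pmf \<mu> 0) ^ (s - j) * H ^ (s - (s - j))) $ s"
      using s2 by (simp add: fps_const_power)
    also have "\<dots> \<le> (g ^ s) $ s" unfolding g_def
      by (rule fps_binomial_nth_ge) (auto simp: H0)
    finally show ?thesis by simp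
  qed
  \<comment> \<open>The constant 9 exceeds \<open>exp 2\<close>: of
    \<open>(q * \<epsilon>) ^ s \<ge> exp (2 * s)\<close>, one factor \<open>exp s\<close> pays for
    the pigeonhole loss, and the other is the gain \<open>exp (L / q)\<close>.\<close>
  have "exp (real s) * pmf \<mu> 1 ^ L \<le> (real q * \<epsilon>) ^ s / (M * j + 1) * pmf \<mu> 1 ^ L"
  proof (rule mult_right_mono)
    have "(M * j + 1) \<le> real (j + 1) ^ 2"
      by (simp add: j_def power2_eq_square algebra_simps)
    also have "\<dots> \<le> exp (real j) ^ 2"
      using exp_ge_add_one_self[of "real j"] by (intro power_mono) auto
    also have "\<dots> = exp (real (2 * j))" by (simp add: exp_of_nat_mult[symmetric])
    also have "\<dots> \<le> exp (real s)" using s2 by simp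
    finally have 1: "real (M * j + 1) \<le> exp (real s)" by simp
    have "exp (real s) * real (M * j + 1) \<le> exp (real s) * exp (real s)"
      using 1 by (intro mult_left_mono) auto
    also have "\<dots> = (exp 1 ^ 2) ^ s"
      by (simp add: exp_of_nat_mult[symmetric] exp_add[symmetric] power_mult[symmetric])
    also have "\<dots> \<le> (3 ^ 2) ^ s" using exp_le by (intro power_mono) auto
    also have "\<dots> \<le> (real q * \<epsilon>) ^ s" using q by (intro power_mono) (auto simp: mult.commute)
    finally have "exp (real s) * real (M * j + 1) \<le> (real q * \<epsilon>) ^ s" .
    moreover have "real (M * j + 1) > 0" by (simp only: of_nat_0_less_iff)
    ultimately show "exp (real s) \<le> (real q * \<epsilon>) ^ s / real (M * j + 1)"
      by (simp only: pos_le_divide_eq)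
  qed (use mu1 in simp)
  \<comment> \<open>Only \<open>s - j\<close> of the replaced ones are compared with zeros, through
    \<open>\<epsilon> * pmf \<mu> 1 \<le> pmf \<mu> 0\<close>. At the \<open>j\<close> positions of
    large numbers, where \<open>\<epsilon> ^ j\<close> is available, \<open>pmf \<mu> 1\<close> is
    bounded by 1.\<close>
  also have "\<dots> \<le> (real q ^ s * \<epsilon> ^ s / (M * j + 1)) * pmf \<mu> 1 ^ (L - j)"
    using mu1 \<epsilon> by (simp add: power_mult_distrib) (intro mult_left_mono divide_right_mono power_decreasing; simp)
  also have "\<dots> = real q ^ s * (pmf \<mu> 1 ^ (L - s) * ((\<epsilon> * pmf \<mu> 1) ^ (s - j) * (\<epsilon> ^ j / (M * j + 1))))"
  proof -
    have "pmf \<mu> 1 ^ (L - j) = pmf \<mu> 1 ^ (L - s) * pmf \<mu> 1 ^ (s - j)"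
      using s2 sL by (simp add: power_add[symmetric])
    moreover have "\<epsilon> ^ s = \<epsilon> ^ (s - j) * \<epsilon> ^ j" using s2 by (simp add: power_add[symmetric])
    ultimately show ?thesis by (simp add: power_mult_distrib)
  qed
  also have "\<dots> \<le> real (L choose s) * (pmf \<mu> 1 ^ (L - s) * (g ^ s) $ s)"
  proof (intro mult_mono)
    have "(real L / real s) ^ s \<le> real (L choose s)" by (rule binomial_ge_n_over_k_pow_k[OF sL])
    then show "real q ^ s \<le> real (L choose s)" using s0 by (simp add: L_def)
    have "(\<epsilon> * pmf \<mu> 1) ^ (s - j) * (\<epsilon> ^ j / (M * j + 1)) \<le> pmf \<mu> 0 ^ (s - j) * (H ^ j) $ s"
      using mu0 mu1 \<epsilon> s by (intro mult_mono power_mono) auto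
    then show "(\<epsilon> * pmf \<mu> 1) ^ (s - j) * (\<epsilon> ^ j / (M * j + 1)) \<le> (g ^ s) $ s" using gs by linarith
  qed (use mu1 \<epsilon> in auto)
  also have "\<dots> = real (L choose (L - s)) * ((fps_const (pmf \<mu> 1) * fps_X) ^ (L - s) * g ^ (L - (L - s))) $ L"
    using sL binomial_symmetric[OF sL] by (simp add: fps_const_X_power_mult_nth)
  also have "\<dots> \<le> (f ^ L) $ L" unfolding f
    by (rule fps_binomial_nth_ge) (auto simp: g0 mu1)
  finally have "exp (real s) * pmf \<mu> 1 ^ L \<le> (f ^ L) $ L" .
  moreover have "real L / real q = real s" using q0 by (simp add: L_def)
  moreover have "L > 0" using sL s0 by simp
  ultimately show ?thesis unfolding f_def by (intro exI[of _ L]) simp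
qed

text \<open>Concatenating blocks multiplies the gain. A remainder shorter than \<open>L\<close> is
  filled with ones and gains nothing; the factor \<open>exp (- c * real L)\<close> compensates for
  that.\<close>

lemma balanced_coeff_ge:
  fixes \<mu> :: "nat pmf" and c :: real
  assumes L: "L > 0" "(Abs_fps (pmf \<mu>) ^ L) $ L \<ge> exp (c * real L) * pmf \<mu> 1 ^ L" and c: "c \<ge> 0"
  shows "exp (- c * real L) * (exp (c * real j) * pmf \<mu> 1 ^ j) \<le> (Abs_fps (pmf \<mu>) ^ j) $ j"
proof (induction j rule: less_induct)
  case (less j)
  let ?f = "Abs_fps (pmf \<mu>)"
  have nn: "?f $ i \<ge> 0" for i by simp
  have nnp: "(?f ^ m) $ i \<ge> 0" for m i by (rule fps_power_nth_nonneg[OF nn])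
  show ?case
  proof (cases "j < L")
    case True
    have "pmf \<mu> 1 ^ k \<le> (?f ^ k) $ k" for k
    proof (induction k)
      case (Suc k)
      have "pmf \<mu> 1 ^ Suc k \<le> ?f $ 1 * (?f ^ k) $ k"
        using Suc by (simp add: mult_left_mono)
      also have "\<dots> \<le> (?f * ?f ^ k) $ (1 + k)" by (rule fps_mult_nth_ge[OF nn nnp])
      finally show ?case by simp
    qed simp
    moreover have "exp (- c * real L) * exp (c * real j) \<le> 1"
      using True c by (simp add: exp_add[symmetric] mult_left_mono)
    ultimately have "(exp (- c * real L) * exp (c * real j)) * pmf \<mu> 1 ^ j \<le> 1 * (?f ^ j) $ j"
      by (intro mult_mono) auto
    then show ?thesis by (simp add: mult.assoc)
  next
    case False
    then obtain i where i: "j = L + i" by (metis le_add_diff_inverse not_less)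
    have "exp (- c * real L) * (exp (c * real j) * pmf \<mu> 1 ^ j) =
      (exp (c * real L) * pmf \<mu> 1 ^ L) * (exp (- c * real L) * (exp (c * real i) * pmf \<mu> 1 ^ i))"
      by (simp add: i algebra_simps exp_add power_add)
    also have "\<dots> \<le> (?f ^ L) $ L * (?f ^ i) $ i"
      using L i nnp by (intro mult_mono L(2) less.IH) auto
    also have "\<dots> \<le> (?f ^ L * ?f ^ i) $ (L + i)" by (rule fps_mult_nth_ge[OF nnp nnp])
    finally show ?thesis by (simp add: i power_add)
  qed
qed

text \<open>
  Few zeros among \<open>n\<close> numbers with total \<open>n - 1\<close> force almost all of them to be one; this is bounded by
  the expectation of \<open>2\<close> to the number of ones, that is, by a coefficient of
  \<open>(f + pmf \<mu> 1 * X) ^ n\<close> with \<open>f\<close> the generating function of \<open>\<mu>\<close>.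
\<close>

lemma few_leaves_rare:
  fixes \<epsilon> :: real
  assumes \<epsilon>: "0 < \<epsilon>" "\<epsilon> < 1"
  obtains \<delta> c :: real where "0 < \<delta>" "\<delta> \<le> 1" "0 < c"
    "\<And>\<mu> :: nat pmf. pmf \<mu> 0 + pmf \<mu> 1 < 1 - \<epsilon> \<Longrightarrow> pmf \<mu> 0 / (pmf \<mu> 0 + pmf \<mu> 1) > \<epsilon> \<Longrightarrow>
       \<exists>N. \<forall>n\<ge>N. (\<Sum>d | d \<in> degree_seqs {..<n} (n - 1) \<and> real (card {i. i < n \<and> d i = 0}) < \<delta> * n. \<Prod>i<n. pmf \<mu> (d i))
         \<le> exp (- c * n) * (\<Sum>d\<in>degree_seqs {..<n} (n - 1). \<Prod>i<n. pmf \<mu> (d i))"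
proof -
  define q where "q = nat \<lceil>9 / \<epsilon>\<rceil>"
  have q: "9 \<le> \<epsilon> * real q"
  proof -
    have "9 / \<epsilon> \<le> real q" unfolding q_def by (rule real_nat_ceiling_ge)
    then show ?thesis using \<epsilon> by (simp add: divide_le_eq mult.commute)
  qed
  have q0: "real q > 0" using q \<epsilon> by (cases "q = 0") auto
  define a where "a = 1 / real q"
  have a: "a > 0" using q0 by (simp add: a_def)
  \<comment> \<open>\<open>2 * \<rho> = 1 + exp (- a)\<close> will bound the growth per vertex after
    the exchange, so \<open>l\<close> is the saving against 2. Of it,
    \<open>2 * \<delta> * ln 2 = l / 2\<close> is spent on the permitted zeros and
    \<open>c = l / 4\<close> on the factor \<zeta>; \<open>c\<close> remains.\<close>
  define \<rho> where "\<rho> = (1 + exp (- a)) / 2"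
  have \<rho>: "\<rho> < 1" "\<rho> > 1 / 2" using a by (auto simp: \<rho>_def)
  define l where "l = - ln \<rho>"
  have l: "l > 0" "exp (- l) = \<rho>" using \<rho> by (auto simp: l_def)
  have l2: "l \<le> ln 2"
  proof -
    have "ln (1 / 2) \<le> ln \<rho>" using \<rho> by (intro ln_mono) auto
    then show ?thesis by (simp add: l_def ln_div)
  qed
  define \<delta> where "\<delta> = l / (4 * ln 2)"
  define c where "c = l / 4"
  have \<delta>: "0 < \<delta>" "\<delta> \<le> 1" using l l2 by (auto simp: \<delta>_def divide_le_eq)
  have c: "c > 0" using l by (simp add: c_def)
  show ?thesis
  proof (rule that[OF \<delta> c])
    fix \<mu> :: "nat pmf"
    assume h: "pmf \<mu> 0 + pmf \<mu> 1 < 1 - \<epsilon>" "pmf \<mu> 0 / (pmf \<mu> 0 + pmf \<mu> 1) > \<epsilon>"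
    define f where "f = Abs_fps (pmf \<mu>)"
    have fnn: "(f ^ m) $ i \<ge> 0" for m i unfolding f_def by (rule fps_power_nth_nonneg) simp
    obtain L where L: "L > 0" "(f ^ L) $ L \<ge> exp (a * real L) * pmf \<mu> 1 ^ L"
      using exists_balanced_block[OF \<epsilon> h q] by (auto simp: a_def f_def)
    define \<zeta> where "\<zeta> = exp (a * real L)"
    have z: "pmf \<mu> 1 ^ j \<le> \<zeta> * exp (- a) ^ j * (f ^ j) $ j" for j
    proof -
      have "exp (- a * real L) * (exp (a * real j) * pmf \<mu> 1 ^ j) \<le> (f ^ j) $ j"
        unfolding f_def using L a by (intro balanced_coeff_ge) (auto simp: f_def)
      then have le: "\<zeta> * exp (- a) ^ j * (exp (- a * real L) * (exp (a * real j) * pmf \<mu> 1 ^ j)) \<le> \<zeta> * exp (- a) ^ j * (f ^ j) $ j"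
        by (intro mult_left_mono) (auto simp: \<zeta>_def)
      have e1: "\<zeta> * exp (- a * real L) = 1" by (simp add: \<zeta>_def exp_add[symmetric])
      have e2: "exp (- a) ^ j * exp (a * real j) = 1"
        by (simp add: exp_of_nat_mult[symmetric] exp_add[symmetric] mult.commute)
      have e3: "\<zeta> * exp (- a) ^ j * (exp (- a * real L) * (exp (a * real j) * pmf \<mu> 1 ^ j)) =
        (\<zeta> * exp (- a * real L)) * (exp (- a) ^ j * exp (a * real j)) * pmf \<mu> 1 ^ j" by (simp only: mult_ac)
      show ?thesis using le unfolding e3 e1 e2 by simp
    qed
    show "\<exists>N. \<forall>n\<ge>N. (\<Sum>d | d \<in> degree_seqs {..<n} (n - 1) \<and> real (card {i. i < n \<and> d i = 0}) < \<delta> * n. \<Prod>i<n. pmf \<mu> (d i))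
         \<le> exp (- c * n) * (\<Sum>d\<in>degree_seqs {..<n} (n - 1). \<Prod>i<n. pmf \<mu> (d i))"
    proof (intro exI allI impI)
      \<comment> \<open>The block length \<open>L\<close>, and with it \<zeta>, depends on \<mu>, so
        the threshold does too; beyond it \<zeta> is at most \<open>exp (c * n)\<close>.\<close>
      fix n assume n: "n \<ge> nat \<lceil>a * real L / c\<rceil> + 1"
      have n1: "n \<ge> 1" using n by simp
      have "a * real L / c \<le> real n" using n by linarith
      then have \<zeta>n: "\<zeta> \<le> exp (c * n)" using c by (simp add: \<zeta>_def divide_le_eq mult.commute)
      let ?D = "degree_seqs {..<n} (n - 1)"
      let ?B = "{d. d \<in> ?D \<and> real (card {i. i < n \<and> d i = 0}) < \<delta> * n}"
      let ?F = "(f ^ n) $ (n - 1)"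
      define c2 where "c2 k = (if k = 1 then 2 * pmf \<mu> 1 else pmf \<mu> k)" for k
      have F: "(\<Sum>d\<in>?D. \<Prod>i<n. pmf \<mu> (d i)) = ?F"
        by (simp add: sum_prod_degree_seqs f_def)
      have F2: "(\<Sum>d\<in>?D. \<Prod>i<n. c2 (d i)) = ((fps_const (pmf \<mu> 1) * fps_X + f) ^ n) $ (n - 1)"
      proof -
        have "Abs_fps c2 = fps_const (pmf \<mu> 1) * fps_X + f"
          by (rule fps_ext) (auto simp: c2_def f_def)
        then show ?thesis by (simp add: sum_prod_degree_seqs)
      qed
      have "((fps_const (pmf \<mu> 1) * fps_X + f) ^ n) $ (n - 1) =
        (\<Sum>k\<le>n. real (n choose k) * ((fps_const (pmf \<mu> 1) * fps_X) ^ k * f ^ (n - k)) $ (n - 1))"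
        by (rule fps_binomial_nth)
      also have "\<dots> \<le> (\<Sum>k\<le>n. real (n choose k) * (\<zeta> * exp (- a) ^ k * ?F))"
      proof (intro sum_mono mult_left_mono)
        fix k assume "k \<in> {..n}"
        show "((fps_const (pmf \<mu> 1) * fps_X) ^ k * f ^ (n - k)) $ (n - 1) \<le> \<zeta> * exp (- a) ^ k * ?F"
        proof (cases "n - 1 < k")
          case True
          then show ?thesis by (subst fps_const_X_power_mult_nth) (simp add: fnn \<zeta>_def)
        next
          case False
          \<comment> \<open>The \<open>k\<close> selected ones are exchanged for arbitrary numbers
            with total \<open>k\<close> at the price \<open>\<zeta> * exp (- a) ^ k\<close>; the
            result is again counted by \<open>?F\<close>.\<close>
          have "pmf \<mu> 1 ^ k * (f ^ (n - k)) $ (n - 1 - k) \<le> (\<zeta> * exp (- a) ^ k * (f ^ k) $ k) * (f ^ (n - k)) $ (n - 1 - k)"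
            by (intro mult_right_mono z fnn)
          also have "\<dots> = \<zeta> * exp (- a) ^ k * ((f ^ k) $ k * (f ^ (n - k)) $ (n - 1 - k))" by simp
          also have "\<dots> \<le> \<zeta> * exp (- a) ^ k * (f ^ k * f ^ (n - k)) $ (k + (n - 1 - k))"
            by (intro mult_left_mono fps_mult_nth_ge fnn) (auto simp: \<zeta>_def)
          also have "k + (n - 1 - k) = n - 1" using False by simp
          also have "f ^ k * f ^ (n - k) = f ^ n" using False by (simp add: power_add[symmetric])
          finally show ?thesis using False by (simp add: fps_const_X_power_mult_nth)
        qed
      qed simp
      also have "\<dots> = \<zeta> * (1 + exp (- a)) ^ n * ?F"
      proof -
        have "(1 + exp (- a)) ^ n = (\<Sum>k\<le>n. real (n choose k) * exp (- a) ^ k)"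
          by (subst add.commute, subst binomial_ring) simp
        then show ?thesis by (simp add: sum_distrib_left sum_distrib_right mult_ac)
      qed
      finally have F2': "(\<Sum>d\<in>?D. \<Prod>i<n. c2 (d i)) \<le> \<zeta> * (1 + exp (- a)) ^ n * ?F" using F2 by simp
      have pw: "2 powr ((1 - 2 * \<delta>) * n) * (\<Prod>i<n. pmf \<mu> (d i)) \<le> (\<Prod>i<n. c2 (d i))" if d: "d \<in> ?B" for d
      proof -
        let ?Z = "{i. i < n \<and> d i = 0}" and ?O = "{i. i < n \<and> d i = 1}"
        have "(\<Sum>i<n. d i) = n - 1" using d by (auto simp: degree_seqs_def)
        \<comment> \<open>An entry 0 falls short of 2 by two, an entry 1 by one; the total
          \<open>n - 1\<close> forces these shortfalls to add up to more than
          \<open>n\<close>.\<close>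
        moreover have "(\<Sum>i<n. 2) \<le> (\<Sum>i<n. d i + (if d i = 0 then 2 else 0) + (if d i = 1 then 1 else 0))"
          by (intro sum_mono) auto
        then have "2 * n \<le> (\<Sum>i<n. d i) + 2 * card ?Z + card ?O"
          by (simp add: sum.distrib sum.If_cases Int_def)
        ultimately have "real n \<le> 2 * real (card ?Z) + real (card ?O)" using n1 by linarith
        then have o: "(1 - 2 * \<delta>) * n \<le> real (card ?O)" using d by (simp add: algebra_simps)
        have "(\<Prod>i<n. c2 (d i)) = (\<Prod>i<n. (if d i = 1 then 2 else 1) * pmf \<mu> (d i))"
          by (intro prod.cong) (auto simp: c2_def)
        also have "\<dots> = 2 ^ card ?O * (\<Prod>i<n. pmf \<mu> (d i))"
          by (simp add: prod.distrib prod.If_cases Int_def)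
        also have "\<dots> \<ge> 2 powr ((1 - 2 * \<delta>) * n) * (\<Prod>i<n. pmf \<mu> (d i))"
        proof (rule mult_right_mono)
          have "2 powr ((1 - 2 * \<delta>) * n) \<le> 2 powr real (card ?O)" using o by simp
          then show "2 powr ((1 - 2 * \<delta>) * n) \<le> 2 ^ card ?O" by (simp add: powr_realpow)
        qed (auto intro: prod_nonneg)
        finally show ?thesis .
      qed
      have "2 powr ((1 - 2 * \<delta>) * n) * (\<Sum>d\<in>?B. \<Prod>i<n. pmf \<mu> (d i)) \<le> (\<Sum>d\<in>?B. \<Prod>i<n. c2 (d i))"
        unfolding sum_distrib_left by (intro sum_mono pw)
      also have "\<dots> \<le> (\<Sum>d\<in>?D. \<Prod>i<n. c2 (d i))"
        by (intro sum_mono2 finite_degree_seqs) (auto simp: c2_def intro!: prod_nonneg)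
      also have "\<dots> \<le> \<zeta> * (1 + exp (- a)) ^ n * ?F" by (rule F2')
      also have "\<dots> \<le> exp (c * n) * (1 + exp (- a)) ^ n * ?F"
        using \<zeta>n by (intro mult_right_mono fnn) (auto intro: add_nonneg_nonneg)
      also have "\<dots> = 2 powr ((1 - 2 * \<delta>) * n) * (exp (- c * n) * ?F)"
      proof -
        have "(1 + exp (- a)) = 2 * exp (- l)" using l by (simp add: \<rho>_def)
        also have "\<dots> = exp (ln 2 - l)" by (simp add: exp_diff exp_minus divide_inverse)
        finally have "exp (c * n) * (1 + exp (- a)) ^ n = exp (c * n + real n * (ln 2 - l))"
          by (simp add: exp_of_nat_mult[symmetric] exp_add)
        also have "c * n + real n * (ln 2 - l) = ((1 - 2 * \<delta>) * n) * ln 2 + (- c * n)"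
          by (simp add: c_def \<delta>_def field_simps)
        also have "exp \<dots> = 2 powr ((1 - 2 * \<delta>) * n) * exp (- c * n)"
          by (simp only: exp_add) (simp add: powr_def)
        finally show ?thesis by simp
      qed
      finally have "(\<Sum>d\<in>?B. \<Prod>i<n. pmf \<mu> (d i)) \<le> exp (- c * n) * ?F" by simp
      then show "(\<Sum>d\<in>?B. \<Prod>i<n. pmf \<mu> (d i)) \<le> exp (- c * n) * (\<Sum>d\<in>?D. \<Prod>i<n. pmf \<mu> (d i))"
        unfolding F .
    qed
  qed
qed

section \<open>Labeled plane trees\<close>

text \<open>The label \<open>n\<close>, which is not a vertex, owns the single slot that the root of the plane tree occupies.\<close>

definition child_slots :: "nat \<Rightarrow> (nat \<Rightarrow> nat) \<Rightarrow> (nat \<times> nat) set" where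
  "child_slots n d = insert (n, 0) (SIGMA v:{..<n}. {..<d v})"

lemma finite_child_slots: "finite (child_slots n d)"
  by (simp add: child_slots_def)

lemma card_child_slots: "card (child_slots n d) = Suc (\<Sum>v<n. d v)"
  by (simp add: child_slots_def)

lemma root_slots_child_slots: "root_slots {..<n} (child_slots n d) fst = {(n, 0)}"
  by (auto simp: root_slots_def child_slots_def)

lemma slot_deg_child_slots:
  assumes "v < n"
  shows "slot_deg (child_slots n d) fst v = d v"
proof -
  have "{s \<in> child_slots n d. fst s = v} = {v} \<times> {..<d v}"
    using assms by (auto simp: child_slots_def)
  then show ?thesis by (simp add: slot_deg_def)
qed

definition plane_trees :: "nat \<Rightarrow> nat list set set" where
  "plane_trees n = {t. plane_tree t \<and> card t = n}"

definition labelings :: "nat \<Rightarrow> 'a set \<Rightarrow> (nat \<Rightarrow> 'a) set" where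
  "labelings n t = {l \<in> {..<n} \<rightarrow>\<^sub>E t. bij_betw l {..<n} t}"

lemma finite_labelings: "finite t \<Longrightarrow> finite (labelings n t)"
  unfolding labelings_def by (rule finite_subset[of _ "{..<n} \<rightarrow>\<^sub>E t"]) (auto intro: finite_PiE)

lemma labelings_nonempty:
  assumes "finite t" "card t = n"
  shows "labelings n t \<noteq> {}"
proof -
  obtain g where g: "bij_betw g {..<n} t"
    using finite_same_card_bij[of "{..<n}" t] assms by auto
  then have "restrict g {..<n} \<in> labelings n t"
    unfolding labelings_def by (auto intro: bij_betw_apply simp: bij_betw_def inj_on_def)
  then show ?thesis by auto
qed

text \<open>Labelings are transported along a bijection. Their number being the same for all trees
  of one size is enough, since the common value cancels in quotients.\<close>

lemma card_labelings_le:
  assumes t: "finite t" and t': "finite t'" "card t = card t'"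
  shows "card (labelings n t) \<le> card (labelings n t')"
proof -
  obtain g where g: "bij_betw g t t'" using finite_same_card_bij assms by blast
  show ?thesis
  proof (rule card_inj_on_le[where f = "\<lambda>l. restrict (g \<circ> l) {..<n}"])
    show "inj_on (\<lambda>l. restrict (g \<circ> l) {..<n}) (labelings n t)"
    proof (rule inj_onI)
      fix l l' assume l: "l \<in> labelings n t" "l' \<in> labelings n t"
        and eq: "restrict (g \<circ> l) {..<n} = restrict (g \<circ> l') {..<n}"
      show "l = l'"
      proof (rule PiE_ext)
        show "l \<in> {..<n} \<rightarrow>\<^sub>E t" "l' \<in> {..<n} \<rightarrow>\<^sub>E t" using l by (auto simp: labelings_def)
        fix x assume x: "x \<in> {..<n}"
        have "g (l x) = g (l' x)" using fun_cong[OF eq, of x] x by simp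
        moreover have "l x \<in> t" "l' x \<in> t" using l x by (auto simp: labelings_def)
        ultimately show "l x = l' x" using g by (auto simp: bij_betw_def inj_on_def)
      qed
    qed
    show "(\<lambda>l. restrict (g \<circ> l) {..<n}) ` labelings n t \<subseteq> labelings n t'"
    proof
      fix m assume "m \<in> (\<lambda>l. restrict (g \<circ> l) {..<n}) ` labelings n t"
      then obtain l where l: "l \<in> labelings n t" "m = restrict (g \<circ> l) {..<n}" by auto
      have "bij_betw (g \<circ> l) {..<n} t'"
        using l g by (intro bij_betw_trans) (auto simp: labelings_def)
      then have "bij_betw m {..<n} t'"
        by (rule bij_betw_cong[THEN iffD1, rotated]) (simp add: l)
      then show "m \<in> labelings n t'"
        unfolding labelings_def using l(2) by (auto dest: bij_betwE)
    qed
    show "finite (labelings n t')" using t' by (simp add: finite_labelings)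
  qed
qed

lemma card_labelings:
  assumes "finite t" "finite t'" "card t = card t'"
  shows "card (labelings n t) = card (labelings n t')"
  using card_labelings_le[of t t'] card_labelings_le[of t' t] assms by (intro antisym) auto

section \<open>Encoding labeled plane trees by degrees and slots\<close>

definition tree_code :: "nat \<Rightarrow> nat list set \<times> (nat \<Rightarrow> nat list) \<Rightarrow> (nat \<Rightarrow> nat) \<times> (nat \<Rightarrow> nat \<times> nat)" where
  "tree_code n = (\<lambda>(t, l). (restrict (\<lambda>v. num_children t (l v)) {..<n},
     restrict (\<lambda>v. if l v = [] then (n, 0) else (inv_into {..<n} l (butlast (l v)), last (l v))) {..<n}))"

definition labeled_plane_trees :: "nat \<Rightarrow> (nat list set \<times> (nat \<Rightarrow> nat list)) set" where
  "labeled_plane_trees n = (SIGMA t:plane_trees n. labelings n t)"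

definition tree_codes :: "nat \<Rightarrow> ((nat \<Rightarrow> nat) \<times> (nat \<Rightarrow> nat \<times> nat)) set" where
  "tree_codes n = (SIGMA d:degree_seqs {..<n} (n - 1). slot_trees {..<n} (child_slots n d) fst)"

lemma finite_plane_tree: "plane_tree t \<Longrightarrow> finite t"
  by (simp add: plane_tree_def)

lemma plane_tree_butlast:
  assumes "plane_tree t" "u \<in> t" "u \<noteq> []"
  shows "butlast u \<in> t"
proof -
  have "butlast u @ [last u] \<in> t" using assms by simp
  then show ?thesis using assms(1) unfolding plane_tree_def by blast
qed

lemma tree_code_cases:
  assumes x: "(t, l) \<in> labeled_plane_trees n" and c: "tree_code n (t, l) = (d, p)" and v: "v < n"
  shows "l v = [] \<and> p v = (n, 0) \<or>
    (\<exists>w j. w < n \<and> p v = (w, j) \<and> l v = l w @ [j])"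
proof (cases "l v = []")
  case True
  then show ?thesis using c v by (auto simp: tree_code_def)
next
  case False
  have t: "plane_tree t" and l: "bij_betw l {..<n} t"
    using x by (auto simp: labeled_plane_trees_def plane_trees_def labelings_def)
  have "l v \<in> t" using l v by (auto dest: bij_betwE)
  then have b: "butlast (l v) \<in> t" using plane_tree_butlast[OF t] False by simp
  define w where "w = inv_into {..<n} l (butlast (l v))"
  have "w \<in> {..<n}" "l w = butlast (l v)"
    using b l unfolding w_def bij_betw_def by (auto intro!: inv_into_into f_inv_into_f)
  moreover have "p v = (w, last (l v))" using c v False by (auto simp: tree_code_def w_def)
  ultimately show ?thesis using False by auto
qed

lemma tree_code_extensional:
  assumes "tree_code n (t, l) = (d, p)"
  shows "d \<in> extensional {..<n}" "p \<in> extensional {..<n}"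
proof -
  have "d = restrict (\<lambda>v. num_children t (l v)) {..<n}"
    "p = restrict (\<lambda>v. if l v = [] then (n, 0) else (inv_into {..<n} l (butlast (l v)), last (l v))) {..<n}"
    using assms by (simp_all add: tree_code_def)
  then show "d \<in> extensional {..<n}" "p \<in> extensional {..<n}" by (simp_all only: restrict_extensional)
qed

lemma tree_code_in_tree_codes:
  assumes x: "(t, l) \<in> labeled_plane_trees n"
  shows "tree_code n (t, l) \<in> tree_codes n"
proof -
  obtain d p where c: "tree_code n (t, l) = (d, p)" by fastforce
  note cases = tree_code_cases[OF x c]
  have t: "plane_tree t" and l: "bij_betw l {..<n} t" and ct: "card t = n"
    using x by (auto simp: labeled_plane_trees_def plane_trees_def labelings_def)
  have d: "d v = num_children t (l v)" if "v < n" for v using c that by (auto simp: tree_code_def)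
  note E = tree_code_extensional[OF c]
  have linj: "l v = l w \<Longrightarrow> v < n \<Longrightarrow> w < n \<Longrightarrow> v = w" for v w
    using l by (auto simp: bij_betw_def inj_on_def)
  have inj: "inj_on p {..<n}"
  proof (rule inj_onI)
    fix v v' assume v: "v \<in> {..<n}" "v' \<in> {..<n}" and eq: "p v = p v'"
    show "v = v'" using cases[of v] cases[of v'] v eq by (intro linj) auto
  qed
  have im: "p ` {..<n} = child_slots n d"
  proof (intro equalityI subsetI)
    fix s assume "s \<in> p ` {..<n}"
    then obtain v where v: "v < n" "s = p v" by auto
    from cases[OF v(1)] show "s \<in> child_slots n d"
    proof
      assume "\<exists>w j. w < n \<and> p v = (w, j) \<and> l v = l w @ [j]"
      then obtain w j where w: "w < n" "p v = (w, j)" "l v = l w @ [j]" by auto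
      have "l v \<in> t" using l v by (auto dest: bij_betwE)
      then have "j < d w" using plane_tree_snoc_iff[OF t, of "l w" j] w d by simp
      then show ?thesis using w v by (simp add: child_slots_def)
    qed (use v in \<open>auto simp: child_slots_def\<close>)
  next
    fix s assume s: "s \<in> child_slots n d"
    define u where "u = (if s = (n, 0) then [] else l (fst s) @ [snd s])"
    have "u \<in> t"
    proof (cases "s = (n, 0)")
      case True
      then show ?thesis using t by (simp add: u_def plane_tree_def)
    next
      case False
      then have "fst s < n" "snd s < d (fst s)" using s by (auto simp: child_slots_def)
      then show ?thesis using plane_tree_snoc_iff[OF t, of "l (fst s)" "snd s"] d False by (simp add: u_def)
    qed
    then obtain v where v: "v < n" "l v = u" using l by (auto simp: bij_betw_def)
    have "p v = s"
    proof (cases "s = (n, 0)")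
      case True
      then show ?thesis using cases[OF v(1)] v by (auto simp: u_def)
    next
      case False
      then have f: "fst s < n" using s by (auto simp: child_slots_def)
      have "l v = l (fst s) @ [snd s]" using v False by (simp add: u_def)
      then show ?thesis using cases[OF v(1)] linj f by (cases s) auto
    qed
    then show "s \<in> p ` {..<n}" using v by auto
  qed
  have bij: "bij_betw p {..<n} (child_slots n d)" using inj im by (simp add: bij_betw_def)
  have "n = card (child_slots n d)" using bij_betw_same_card[OF bij] by simp
  then have "(\<Sum>v<n. d v) = n - 1" by (simp add: card_child_slots)
  then have "d \<in> degree_seqs {..<n} (n - 1)" using E by (simp add: degree_seqs_def PiE_iff)
  moreover have "p \<in> slot_trees {..<n} (child_slots n d) fst"
    unfolding slot_trees_def
  proof (intro CollectI conjI bij exI[of _ "\<lambda>v. length (l v)"] ballI impI)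
    show "p \<in> {..<n} \<rightarrow>\<^sub>E child_slots n d" using E im by (auto simp: PiE_iff)
    fix v assume "v \<in> {..<n}" "fst (p v) \<in> {..<n}"
    then show "length (l (fst (p v))) < length (l v)" using cases[of v] by auto
  qed
  ultimately show ?thesis by (simp add: c tree_codes_def)
qed

text \<open>Addresses are recovered by induction on their length: the root from
  \<open>(n, 0)\<close>, any other from the address of its parent and the slot index. The tree is
  the range of the labeling.\<close>

lemma inj_on_tree_code: "inj_on (tree_code n) (labeled_plane_trees n)"
proof (rule inj_onI)
  fix x y assume x: "x \<in> labeled_plane_trees n" and y: "y \<in> labeled_plane_trees n"
    and eq: "tree_code n x = tree_code n y"
  obtain t l where xt: "x = (t, l)" by (cases x)
  obtain t' l' where yt: "y = (t', l')" by (cases y)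
  obtain d p where c: "tree_code n x = (d, p)" by fastforce
  note cx = tree_code_cases[OF x[unfolded xt] c[unfolded xt]]
  note cy = tree_code_cases[OF y[unfolded yt] c[unfolded eq yt]]
  have same: "l v = l' v" if "v < n" for v
    using that
  proof (induction "length (l v)" arbitrary: v rule: less_induct)
    case less
    from cx[OF less.prems] show ?case
    proof
      assume "l v = [] \<and> p v = (n, 0)"
      then show ?thesis using cy[OF less.prems] by auto
    next
      assume "\<exists>w j. w < n \<and> p v = (w, j) \<and> l v = l w @ [j]"
      then obtain w j where w: "w < n" "p v = (w, j)" "l v = l w @ [j]" by auto
      have "l w = l' w" using w by (intro less.hyps) auto
      then show ?thesis using cy[OF less.prems] w by auto
    qed
  qed
  have "l = l'"
    using x y same
    by (intro extensionalityI[of l "{..<n}" l']) (auto simp: xt yt labeled_plane_trees_def labelings_def PiE_iff)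
  moreover have "t = l ` {..<n}" "t' = l' ` {..<n}"
    using x y by (auto simp: xt yt labeled_plane_trees_def labelings_def bij_betw_def)
  ultimately show "x = y" by (simp add: xt yt)
qed

lemma tree_code_surj:
  assumes "(d, p) \<in> tree_codes n" and n: "n \<ge> 1"
  shows "\<exists>x\<in>labeled_plane_trees n. tree_code n x = (d, p)"
proof -
  have d: "d \<in> {..<n} \<rightarrow>\<^sub>E UNIV" and pe: "p \<in> {..<n} \<rightarrow>\<^sub>E child_slots n d"
    and bij: "bij_betw p {..<n} (child_slots n d)"
    using assms by (auto simp: tree_codes_def degree_seqs_def slot_trees_def)
  obtain f :: "nat \<Rightarrow> nat" where f: "\<And>v. v < n \<Longrightarrow> fst (p v) < n \<Longrightarrow> f (fst (p v)) < f v"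
    using assms by (auto simp: tree_codes_def slot_trees_def)
  \<comment> \<open>Addresses are built by following parent slots towards the root, with a numeral
    as fuel. Any fuel above the rank \<open>f v\<close> gives the same address.\<close>
  define a where "a = rec_nat (\<lambda>v. []) (\<lambda>_ A v. if fst (p v) < n then A (fst (p v)) @ [snd (p v)] else [])"
  have a0: "a 0 v = []" for v by (simp add: a_def)
  have aS: "a (Suc k) v = (if fst (p v) < n then a k (fst (p v)) @ [snd (p v)] else [])" for k v
    by (simp add: a_def)
  have stable: "a k v = a m v" if "f v < k" "f v < m" "v < n" for k m v
    using that
  proof (induction "f v" arbitrary: v k m rule: less_induct)
    case less
    obtain k' m' where km: "k = Suc k'" "m = Suc m'" using less.prems by (cases k; cases m) auto
    show ?case
    proof (cases "fst (p v) < n")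
      case True
      then have "f (fst (p v)) < f v" using f less.prems by simp
      then have "a k' (fst (p v)) = a m' (fst (p v))" using less.prems True km by (intro less.hyps) auto
      then show ?thesis by (simp add: km aS)
    qed (simp add: km aS)
  qed
  define l where "l = restrict (\<lambda>v. a (Suc (f v)) v) {..<n}"
  have lrec: "l v = (if fst (p v) < n then l (fst (p v)) @ [snd (p v)] else [])" if v: "v < n" for v
  proof (cases "fst (p v) < n")
    case True
    have "a (f v) (fst (p v)) = a (Suc (f (fst (p v)))) (fst (p v))"
      using f[OF v True] True by (intro stable) auto
    then show ?thesis using True v by (simp add: l_def aS)
  qed (simp add: l_def aS v)
  have pslot: "fst (p v) < n \<and> snd (p v) < d (fst (p v)) \<or> p v = (n, 0)" if "v < n" for v
  proof -
    have "p v \<in> child_slots n d" using bij that by (auto dest: bij_betwE)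
    then show ?thesis by (auto simp: child_slots_def)
  qed
  have pinj: "p v = p w \<Longrightarrow> v < n \<Longrightarrow> w < n \<Longrightarrow> v = w" for v w
    using bij by (auto simp: bij_betw_def inj_on_def)
  have linj: "v = w" if "l v = l w" "v < n" "w < n" for v w
    using that
  proof (induction "f v" arbitrary: v w rule: less_induct)
    case less
    show ?case
    proof (cases "fst (p v) < n")
      case True
      then have w: "fst (p w) < n" "l (fst (p v)) = l (fst (p w))" "snd (p v) = snd (p w)"
        using less.prems lrec[of v] lrec[of w] by (auto split: if_splits)
      have "fst (p v) = fst (p w)"
        using f[OF _ True] less.prems True w by (intro less.hyps) auto
      then have "p v = p w" using w(3) by (rule prod_eqI)
      then show ?thesis using less.prems by (intro pinj) auto
    next
      case False
      then have "\<not> fst (p w) < n" using less.prems lrec[of v] lrec[of w] by (auto split: if_splits)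
      then show ?thesis using False pslot[of v] pslot[of w] less.prems by (intro pinj) auto
    qed
  qed
  define t where "t = l ` {..<n}"
  have snoc: "u @ [j] \<in> t \<longleftrightarrow> (\<exists>w<n. u = l w \<and> j < d w)" for u j
  proof
    assume "u @ [j] \<in> t"
    then obtain v where v: "v < n" "l v = u @ [j]" by (auto simp: t_def)
    then show "\<exists>w<n. u = l w \<and> j < d w"
      using lrec[OF v(1)] pslot[OF v(1)] by (auto split: if_splits)
  next
    assume "\<exists>w<n. u = l w \<and> j < d w"
    then obtain w where w: "w < n" "u = l w" "j < d w" by auto
    then have "(w, j) \<in> child_slots n d" by (simp add: child_slots_def)
    then have "(w, j) \<in> p ` {..<n}" using bij_betw_imp_surj_on[OF bij] by simp
    then obtain v where "v < n" "p v = (w, j)" by (metis imageE lessThan_iff)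
    then show "u @ [j] \<in> t" using lrec[of v] w by (auto simp: t_def intro!: rev_image_eqI[of v])
  qed
  have root: "[] \<in> t"
  proof -
    have "(n, 0) \<in> child_slots n d" by (simp add: child_slots_def)
    then have "(n, 0) \<in> p ` {..<n}" using bij_betw_imp_surj_on[OF bij] by simp
    then obtain v where "v < n" "p v = (n, 0)" by (metis imageE lessThan_iff)
    then show ?thesis using lrec[of v] by (force simp: t_def)
  qed
  have pt: "plane_tree t"
    unfolding plane_tree_def snoc using root by (auto simp: t_def)
  have lbij: "bij_betw l {..<n} t" using linj by (auto simp: bij_betw_def inj_on_def t_def)
  have ct: "card t = n" using bij_betw_same_card[OF lbij] by simp
  have lE: "l \<in> {..<n} \<rightarrow>\<^sub>E t" using lbij by (auto simp: l_def dest: bij_betwE)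
  have x: "(t, l) \<in> labeled_plane_trees n"
    using pt ct lbij lE by (simp add: labeled_plane_trees_def plane_trees_def labelings_def)
  have nc: "num_children t (l v) = d v" if "v < n" for v
  proof -
    have "{j. l v @ [j] \<in> t} = {..<d v}" using linj that by (auto simp: snoc)
    then show ?thesis by (simp add: num_children_def)
  qed
  obtain d' p' where c: "tree_code n (t, l) = (d', p')" by fastforce
  have "d' = d"
  proof (rule PiE_ext)
    show "d' \<in> {..<n} \<rightarrow>\<^sub>E UNIV" using tree_code_extensional(1)[OF c] by (simp add: PiE_iff)
    show "d' v = d v" if "v \<in> {..<n}" for v using c that nc by (auto simp: tree_code_def)
  qed (rule d)
  moreover have "p' = p"
  proof (rule extensionalityI)
    show "p' \<in> extensional {..<n}" by (rule tree_code_extensional(2)[OF c])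
    show "p \<in> extensional {..<n}" using pe by (simp add: PiE_iff)
    fix v assume "v \<in> {..<n}"
    then have v: "v < n" by simp
    from tree_code_cases[OF x c v] show "p' v = p v"
    proof
      assume "l v = [] \<and> p' v = (n, 0)"
      then show ?thesis using lrec[OF v] pslot[OF v] by (auto split: if_splits)
    next
      assume "\<exists>w j. w < n \<and> p' v = (w, j) \<and> l v = l w @ [j]"
      then obtain w j where w: "w < n" "p' v = (w, j)" "l v = l w @ [j]" by auto
      then have "fst (p v) < n" "l w = l (fst (p v))" "j = snd (p v)"
        using lrec[OF v] by (auto split: if_splits)
      then show ?thesis using linj[of w "fst (p v)"] w by (cases "p v") auto
    qed
  qed
  ultimately show ?thesis using x c by auto
qed

lemma bij_betw_tree_code:
  assumes "n \<ge> 1"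
  shows "bij_betw (tree_code n) (labeled_plane_trees n) (tree_codes n)"
  unfolding bij_betw_def
proof (intro conjI inj_on_tree_code equalityI subsetI)
  fix y assume "y \<in> tree_codes n"
  then show "y \<in> tree_code n ` labeled_plane_trees n"
    using tree_code_surj[of "fst y" "snd y" n] assms by force
qed (use tree_code_in_tree_codes in auto)

text \<open>The slot \<open>(n, 0)\<close> has owner \<open>n\<close>, outside
  \<open>{..<n}\<close>, so the orbit leaves exactly after the vertex with the empty
  address.\<close>

lemma orbit_in_tree_code:
  assumes x: "(t, l) \<in> labeled_plane_trees n" and c: "tree_code n (t, l) = (d, p)" and v: "v < n"
  shows "orbit_in {..<n} (fst \<circ> p) h v \<longleftrightarrow> h \<le> length (l v)"
  using v
proof (induction h arbitrary: v)
  case (Suc h)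
  from tree_code_cases[OF x c Suc.prems] show ?case
  proof
    assume "l v = [] \<and> p v = (n, 0)"
    then show ?thesis by (auto dest: orbit_in_mem)
  next
    assume "\<exists>w j. w < n \<and> p v = (w, j) \<and> l v = l w @ [j]"
    then show ?thesis using Suc by auto
  qed
qed simp

lemma ht_ge_iff:
  assumes x: "(t, l) \<in> labeled_plane_trees n" and c: "tree_code n (t, l) = (d, p)"
  shows "h \<le> ht t \<longleftrightarrow> (\<exists>v\<in>{..<n}. orbit_in {..<n} (fst \<circ> p) h v)"
proof -
  have t: "finite t" "t \<noteq> {}" and l: "t = l ` {..<n}"
    using x by (auto simp: labeled_plane_trees_def plane_trees_def labelings_def plane_tree_def bij_betw_def)
  have "h \<le> ht t \<longleftrightarrow> (\<exists>u\<in>t. h \<le> length u)"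
    unfolding ht_def using t by (subst Max_ge_iff) auto
  also have "\<dots> \<longleftrightarrow> (\<exists>v\<in>{..<n}. orbit_in {..<n} (fst \<circ> p) h v)"
    using orbit_in_tree_code[OF x c] by (auto simp: l)
  finally show ?thesis .
qed

lemma finite_tree_codes: "finite (tree_codes n)"
  unfolding tree_codes_def
  by (intro finite_SigmaI finite_degree_seqs finite_slot_trees finite_child_slots) auto

lemma finite_plane_trees:
  assumes "n \<ge> 1"
  shows "finite (plane_trees n)"
proof -
  have "finite (labeled_plane_trees n)"
    using bij_betw_finite[OF bij_betw_tree_code[OF assms]] finite_tree_codes by simp
  moreover have "plane_trees n \<subseteq> fst ` labeled_plane_trees n"
  proof
    fix t assume t: "t \<in> plane_trees n"
    then obtain l where "l \<in> labelings n t"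
      using labelings_nonempty[of t n] by (auto simp: plane_trees_def plane_tree_def)
    with t have "(t, l) \<in> labeled_plane_trees n" by (simp add: labeled_plane_trees_def)
    then show "t \<in> fst ` labeled_plane_trees n" by force
  qed
  ultimately show ?thesis by (meson finite_imageI finite_subset)
qed

section \<open>From weights of plane trees to counts of slot trees\<close>

definition tall_slot_trees :: "nat \<Rightarrow> nat \<Rightarrow> (nat \<Rightarrow> nat) \<Rightarrow> (nat \<Rightarrow> nat \<times> nat) set" where
  "tall_slot_trees n h d =
    {p \<in> slot_trees {..<n} (child_slots n d) fst. \<exists>v\<in>{..<n}. orbit_in {..<n} (fst \<circ> p) h v}"

text \<open>The weight of a tree depends only on its degrees, and all trees of size \<open>n\<close>
  have equally many labelings; summing over labeled trees in two orders separates the weight from a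
  uniform count.\<close>

lemma sum_plane_trees:
  fixes \<mu> :: "nat \<Rightarrow> real"
  assumes n: "n \<ge> 1"
  shows "card (labelings n {..<n}) * (\<Sum>t | t \<in> plane_trees n \<and> h \<le> ht t. \<Prod>u\<in>t. \<mu> (num_children t u)) =
    (\<Sum>d\<in>degree_seqs {..<n} (n - 1). (\<Prod>v<n. \<mu> (d v)) * card (tall_slot_trees n h d))"
proof -
  let ?w = "\<lambda>t. \<Prod>u\<in>t. \<mu> (num_children t u)"
  define G where "G = (\<lambda>(d :: nat \<Rightarrow> nat, p :: nat \<Rightarrow> nat \<times> nat). if \<exists>v\<in>{..<n}. orbit_in {..<n} (fst \<circ> p) h v then \<Prod>v<n. \<mu> (d v) else 0)"
  have fin: "finite (plane_trees n)" by (rule finite_plane_trees[OF n])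
  have ft: "finite t" if "t \<in> plane_trees n" for t using that by (simp add: plane_trees_def plane_tree_def)
  have "(\<Sum>d\<in>degree_seqs {..<n} (n - 1). (\<Prod>v<n. \<mu> (d v)) * card (tall_slot_trees n h d)) =
    (\<Sum>d\<in>degree_seqs {..<n} (n - 1). \<Sum>p\<in>slot_trees {..<n} (child_slots n d) fst. G (d, p))"
  proof (rule sum.cong[OF refl])
    fix d
    have "finite (slot_trees {..<n} (child_slots n d) fst)" by (intro finite_slot_trees finite_child_slots) simp
    then show "(\<Prod>v<n. \<mu> (d v)) * card (tall_slot_trees n h d) = (\<Sum>p\<in>slot_trees {..<n} (child_slots n d) fst. G (d, p))"
      by (simp add: G_def sum.If_cases tall_slot_trees_def Int_def mult.commute)
  qed
  also have "\<dots> = (\<Sum>y\<in>tree_codes n. G y)"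
    unfolding tree_codes_def by (subst sum.Sigma) (auto intro!: finite_degree_seqs finite_slot_trees finite_child_slots)
  also have "\<dots> = (\<Sum>x\<in>labeled_plane_trees n. G (tree_code n x))"
    by (rule sum.reindex_bij_betw[OF bij_betw_tree_code[OF n], symmetric])
  also have "\<dots> = (\<Sum>x\<in>labeled_plane_trees n. if h \<le> ht (fst x) then ?w (fst x) else 0)"
  proof (rule sum.cong[OF refl])
    fix x assume x: "x \<in> labeled_plane_trees n"
    obtain t l where xt: "x = (t, l)" by (cases x)
    obtain d p where c: "tree_code n (t, l) = (d, p)" by fastforce
    have l: "bij_betw l {..<n} t" using x by (auto simp: xt labeled_plane_trees_def labelings_def)
    have "(\<Prod>v<n. \<mu> (d v)) = (\<Prod>v<n. \<mu> (num_children t (l v)))"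
      using c by (intro prod.cong) (auto simp: tree_code_def)
    also have "\<dots> = ?w t" by (rule prod.reindex_bij_betw[OF l])
    finally show "G (tree_code n x) = (if h \<le> ht (fst x) then ?w (fst x) else 0)"
      using ht_ge_iff[OF x[unfolded xt] c, of h] by (simp add: xt c G_def)
  qed
  also have "\<dots> = (\<Sum>t\<in>plane_trees n. \<Sum>l\<in>labelings n t. if h \<le> ht t then ?w t else 0)"
    unfolding labeled_plane_trees_def using fin ft
    by (subst sum.Sigma) (auto simp: finite_labelings case_prod_beta)
  also have "\<dots> = (\<Sum>t\<in>plane_trees n. card (labelings n {..<n}) * (if h \<le> ht t then ?w t else 0))"
  proof (rule sum.cong[OF refl])
    fix t assume t: "t \<in> plane_trees n"
    have "card (labelings n t) = card (labelings n {..<n})"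
      using ft[OF t] t by (intro card_labelings) (auto simp: plane_trees_def)
    then show "(\<Sum>l\<in>labelings n t. if h \<le> ht t then ?w t else 0) = card (labelings n {..<n}) * (if h \<le> ht t then ?w t else 0)"
      by simp
  qed
  also have "\<dots> = card (labelings n {..<n}) * (\<Sum>t | t \<in> plane_trees n \<and> h \<le> ht t. ?w t)"
    using fin by (simp add: sum_distrib_left[symmetric] sum.If_cases Int_def)
  finally show ?thesis by simp
qed

text \<open>The case \<open>h = 0\<close> gives the probability of the conditioning event, so
  numerator and denominator of the conditional probability are instances of one formula.\<close>

lemma prob_tall_family_tree:
  assumes n: "n \<ge> 1"
  shows "\<P>(\<xi> in branching \<mu>. h \<le> ht (family_tree \<xi>) \<and> finite (family_tree \<xi>) \<and> card (family_tree \<xi>) = n) =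
    (\<Sum>t | t \<in> plane_trees n \<and> h \<le> ht t. \<Prod>u\<in>t. pmf \<mu> (num_children t u))"
proof -
  interpret prob_space "branching \<mu>" by (rule prob_space_branching)
  let ?S = "{t. t \<in> plane_trees n \<and> h \<le> ht t}"
  have "{\<xi> \<in> space (branching \<mu>). h \<le> ht (family_tree \<xi>) \<and> finite (family_tree \<xi>) \<and> card (family_tree \<xi>) = n} =
    (\<Union>t\<in>?S. {\<xi>. family_tree \<xi> = t})"
    using plane_tree_family_tree finite_plane_tree by (auto simp: plane_trees_def)
  moreover have "prob (\<Union>t\<in>?S. {\<xi>. family_tree \<xi> = t}) = (\<Sum>t\<in>?S. prob {\<xi>. family_tree \<xi> = t})"
  proof (rule finite_measure_finite_Union)
    show "finite ?S" using finite_plane_trees[OF n] by simp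
    show "(\<lambda>t. {\<xi>. family_tree \<xi> = t}) ` ?S \<subseteq> events"
    proof (safe)
      fix t assume "t \<in> plane_trees n"
      then have "{\<xi>. family_tree \<xi> = t} = {\<xi>. finite (family_tree \<xi>) \<and> family_tree \<xi> = t}"
        by (auto simp: plane_trees_def dest: finite_plane_tree)
      then show "{\<xi>. family_tree \<xi> = t} \<in> events"
        using family_tree_event_in_sets[of "\<lambda>s. s = t" \<mu>] by simp
    qed
  qed (auto simp: disjoint_family_on_def)
  moreover have "prob {\<xi>. family_tree \<xi> = t} = (\<Prod>u\<in>t. pmf \<mu> (num_children t u))" if "t \<in> ?S" for t
    using prob_family_tree[of t \<mu>] that by (simp add: plane_trees_def)
  ultimately show ?thesis by simp
qed

section \<open>The conditioned branching tree\<close>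

lemma plane_tree_take:
  assumes "plane_tree t" "u \<in> t"
  shows "take i u \<in> t"
  using assms(2)
proof (induction u rule: rev_induct)
  case Nil
  then show ?case by simp
next
  case (snoc j u)
  then have "u \<in> t" using plane_tree_butlast[OF assms(1), of "u @ [j]"] by simp
  then show ?case using snoc by (cases "i \<le> length u") auto
qed

text \<open>The prefixes of a deepest address are \<open>ht t + 1\<close> distinct vertices.\<close>

lemma ht_less_card:
  assumes t: "plane_tree t"
  shows "ht t < card t"
proof -
  have fin: "finite t" and ne: "t \<noteq> {}" using t by (auto simp: plane_tree_def)
  then have "ht t \<in> length ` t" unfolding ht_def by (intro Max_in) auto
  then obtain u where u: "u \<in> t" "length u = ht t" by auto
  have "inj_on (\<lambda>i. take i u) {..length u}"
    by (rule inj_onI) (metis atMost_iff length_take min.absorb2)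
  then have "card ((\<lambda>i. take i u) ` {..length u}) = Suc (length u)" by (simp add: card_image)
  moreover have "card ((\<lambda>i. take i u) ` {..length u}) \<le> card t"
    using plane_tree_take[OF t u(1)] by (intro card_mono fin) auto
  ultimately show ?thesis using u by simp
qed

lemma card_slot_trees_degree_seqs:
  assumes "n \<ge> 1" "d \<in> degree_seqs {..<n} (n - 1)"
  shows "card (slot_trees {..<n} (child_slots n d) fst) = fact (n - 1)"
proof -
  have "card (child_slots n d) = Suc (n - 1)"
    using assms by (simp add: card_child_slots degree_seqs_def)
  then show ?thesis
    using assms card_slot_trees[of "{..<n}" "child_slots n d" "n - 1" fst]
    by (simp add: finite_child_slots root_slots_child_slots)
qed

text \<open>Since no degree sequence carries more slot trees than another, bounds on the tall
  fraction average under the offspring weights alone. Sequences with few leaves are counted entirely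
  as tall, and their share is at most \<open>B\<close>.\<close>

lemma prob_tall_le:
  fixes \<mu> :: "nat pmf" and \<delta> \<eta> B :: real
  assumes n: "n \<ge> 1"
    and \<delta>: "0 < \<delta>" "\<delta> \<le> 1" and \<eta>: "\<eta> = \<delta> / 864"
    and K: "4 \<le> K" "real K \<le> \<eta> * n"
    and h: "(8 / sqrt \<delta> + 32 / sqrt \<eta> + 2) * sqrt (real K * n) \<le> h"
    and B: "(\<Sum>d | d \<in> degree_seqs {..<n} (n - 1) \<and> real (card {i. i < n \<and> d i = 0}) < \<delta> * n. \<Prod>i<n. pmf \<mu> (d i))
       \<le> B * (\<Sum>d\<in>degree_seqs {..<n} (n - 1). \<Prod>i<n. pmf \<mu> (d i))"
  shows "(\<Sum>t | t \<in> plane_trees n \<and> h \<le> ht t. \<Prod>u\<in>t. pmf \<mu> (num_children t u)) \<le>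
    ((5 + 1 / \<eta>) * exp (- real K) + B) * (\<Sum>t | t \<in> plane_trees n \<and> 0 \<le> ht t. \<Prod>u\<in>t. pmf \<mu> (num_children t u))"
proof -
  let ?D = "degree_seqs {..<n} (n - 1)" and ?w = "\<lambda>d. \<Prod>v<n. pmf \<mu> (d v)"
  let ?bad = "\<lambda>d. real (card {i. i < n \<and> d i = 0}) < \<delta> * n"
  let ?T = "\<lambda>d. slot_trees {..<n} (child_slots n d) fst"
  let ?L = "real (card (labelings n {..<n}))" and ?c = "(5 + 1 / \<eta>) * exp (- real K)"
  have finD: "finite ?D" by (intro finite_degree_seqs) simp
  have w0: "?w d \<ge> 0" for d by (intro prod_nonneg) simp
  have Lpos: "?L > 0"
    using labelings_nonempty[of "{..<n}" n] by (simp add: card_gt_0_iff finite_labelings)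
  have c0: "?c \<ge> 0" using \<delta> \<eta> by simp
  have finT: "finite (?T d)" for d by (intro finite_slot_trees finite_child_slots) simp
  have tall: "real (card (tall_slot_trees n h d)) \<le> (?c + (if ?bad d then 1 else 0)) * fact (n - 1)" if d: "d \<in> ?D" for d
  proof (cases "?bad d")
    case True
    have "card (tall_slot_trees n h d) \<le> card (?T d)"
      unfolding tall_slot_trees_def using finT by (intro card_mono) auto
    then have "real (card (tall_slot_trees n h d)) \<le> 1 * fact (n - 1)"
      using card_slot_trees_degree_seqs[OF n d] by (metis mult_1 of_nat_fact of_nat_le_iff)
    also have "\<dots> \<le> (?c + 1) * fact (n - 1)" using c0 by (intro mult_right_mono) auto
    finally show ?thesis using True by simp
  next
    case False
    have cS: "card {..<n} = card (child_slots n d)"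
      using d n by (simp add: card_child_slots degree_seqs_def)
    have Z: "{u \<in> {..<n}. slot_deg (child_slots n d) fst u = 0} = {i. i < n \<and> d i = 0}"
      using slot_deg_child_slots[of _ n d] by auto
    have "real (card {p \<in> ?T d. \<exists>v\<in>{..<n}. orbit_in {..<n} (fst \<circ> p) h v}) \<le> (5 + 1 / \<eta>) * exp (- real K) * real (card (?T d))"
    proof (rule card_tall_slot_trees[OF _ finite_child_slots cS _ \<delta> _ \<eta> K(1)])
      show "card (root_slots {..<n} (child_slots n d) fst) = 1" by (simp add: root_slots_child_slots)
      show "\<delta> * real (card {..<n}) \<le> real (card {u \<in> {..<n}. slot_deg (child_slots n d) fst u = 0})"
        using False unfolding Z by simp
      show "(8 / sqrt \<delta> + 32 / sqrt \<eta> + 2) * sqrt (real K * real (card {..<n})) \<le> real h"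
        using h by simp
    qed (use K in simp_all)
    then show ?thesis
      using False card_slot_trees_degree_seqs[OF n d] by (simp add: tall_slot_trees_def)
  qed
  have tall0: "real (card (tall_slot_trees n 0 d)) = fact (n - 1)" if d: "d \<in> ?D" for d
  proof -
    have "\<exists>v. v < n" using n by (intro exI[of _ 0]) simp
    then have "tall_slot_trees n 0 d = ?T d" by (auto simp: tall_slot_trees_def)
    then show ?thesis using card_slot_trees_degree_seqs[OF n d] by simp
  qed
  have "?L * (\<Sum>t | t \<in> plane_trees n \<and> h \<le> ht t. \<Prod>u\<in>t. pmf \<mu> (num_children t u)) =
     (\<Sum>d\<in>?D. ?w d * card (tall_slot_trees n h d))"
    by (rule sum_plane_trees[OF n])
  also have "\<dots> \<le> (\<Sum>d\<in>?D. ?w d * ((?c + (if ?bad d then 1 else 0)) * fact (n - 1)))"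
    by (intro sum_mono mult_left_mono tall w0)
  also have "\<dots> = (\<Sum>d\<in>?D. ?c * fact (n - 1) * ?w d + fact (n - 1) * (if ?bad d then ?w d else 0))"
    by (intro sum.cong) (auto simp: algebra_simps)
  also have "\<dots> = ?c * fact (n - 1) * (\<Sum>d\<in>?D. ?w d) + fact (n - 1) * (\<Sum>d | d \<in> ?D \<and> ?bad d. ?w d)"
    using finD by (simp add: sum.distrib sum_distrib_left[symmetric] sum.If_cases Int_def)
  also have "\<dots> \<le> ?c * fact (n - 1) * (\<Sum>d\<in>?D. ?w d) + fact (n - 1) * (B * (\<Sum>d\<in>?D. ?w d))"
    by (intro add_left_mono mult_left_mono B) simp
  also have "\<dots> = (?c + B) * (\<Sum>d\<in>?D. ?w d * fact (n - 1))"
    by (simp only: sum_distrib_right[symmetric]) (simp add: algebra_simps)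
  also have "(\<Sum>d\<in>?D. ?w d * fact (n - 1)) = (\<Sum>d\<in>?D. ?w d * card (tall_slot_trees n 0 d))"
    by (intro sum.cong) (simp_all add: tall0)
  also have "\<dots> = ?L * (\<Sum>t | t \<in> plane_trees n \<and> 0 \<le> ht t. \<Prod>u\<in>t. pmf \<mu> (num_children t u))"
    by (rule sum_plane_trees[OF n, symmetric])
  finally have "?L * (\<Sum>t | t \<in> plane_trees n \<and> h \<le> ht t. \<Prod>u\<in>t. pmf \<mu> (num_children t u)) \<le>
    ?L * ((?c + B) * (\<Sum>t | t \<in> plane_trees n \<and> 0 \<le> ht t. \<Prod>u\<in>t. pmf \<mu> (num_children t u)))"
    by (simp add: mult_ac)
  then show ?thesis using Lpos by (simp only: mult_le_cancel_left_pos)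
qed

theorem theorem3:
  fixes \<epsilon> :: real
  assumes "0 < \<epsilon>" and "\<epsilon> < 1"
  shows "\<exists>c C :: real. c > 0 \<and> C > 0 \<and>
    (\<forall>\<mu> :: nat pmf.
       pmf \<mu> 0 + pmf \<mu> 1 < 1 - \<epsilon> \<longrightarrow>
       pmf \<mu> 0 / (pmf \<mu> 0 + pmf \<mu> 1) > \<epsilon> \<longrightarrow>
       (\<exists>N :: nat. \<forall>n\<ge>N.
          \<P>(\<xi> in branching \<mu>. finite (family_tree \<xi>) \<and> card (family_tree \<xi>) = n) > 0 \<longrightarrow>
          (\<forall>x :: real. x > 0 \<longrightarrow>
             \<P>(\<xi> in branching \<mu>. real (ht (family_tree \<xi>)) \<ge> x * sqrt (real n) \<bar>
                finite (family_tree \<xi>) \<and> card (family_tree \<xi>) = n)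
             < C * exp (- c * x\<^sup>2))))"
proof -
  obtain \<delta> c1 :: real where \<delta>: "0 < \<delta>" "\<delta> \<le> 1" and c1: "0 < c1" and
    rare: "\<And>\<mu> :: nat pmf. pmf \<mu> 0 + pmf \<mu> 1 < 1 - \<epsilon> \<Longrightarrow> pmf \<mu> 0 / (pmf \<mu> 0 + pmf \<mu> 1) > \<epsilon> \<Longrightarrow>
       \<exists>N. \<forall>n\<ge>N. (\<Sum>d | d \<in> degree_seqs {..<n} (n - 1) \<and> real (card {i. i < n \<and> d i = 0}) < \<delta> * n. \<Prod>i<n. pmf \<mu> (d i))
         \<le> exp (- c1 * n) * (\<Sum>d\<in>degree_seqs {..<n} (n - 1). \<Prod>i<n. pmf \<mu> (d i))"
    using few_leaves_rare[OF assms] by blast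
  define \<eta> where "\<eta> = \<delta> / 864"
  define a where "a = 8 / sqrt \<delta> + 32 / sqrt \<eta> + 2"
  \<comment> \<open>\<open>\<kappa> \<le> \<eta>\<close> keeps \<open>K\<close> within
    \<open>\<eta> * n\<close> when \<open>x\<^sup>2 < n\<close>, and
    \<open>\<kappa> \<le> 1 / a\<^sup>2\<close> makes \<open>a * sqrt (K * n)\<close> at most
    \<open>x * sqrt n\<close>.\<close>
  define \<kappa> where "\<kappa> = min \<eta> (1 / a\<^sup>2)"
  define c where "c = min \<kappa> c1"
  \<comment> \<open>The factor 3 bounds \<open>exp 1\<close>, lost when
    \<open>\<kappa> * x\<^sup>2\<close> is rounded down to \<open>K\<close>. The summand 83 exceeds
    \<open>3 ^ 4 \<ge> exp 4\<close>, which settles the case \<open>K < 4\<close>, and it also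
    covers the term for few leaves.\<close>
  define C where "C = 3 * (5 + 1 / \<eta>) + 83"
  have \<eta>: "\<eta> > 0" using \<delta> by (simp add: \<eta>_def)
  have a: "a > 0" using \<delta> \<eta> by (auto simp: a_def intro!: add_pos_pos)
  have \<kappa>: "\<kappa> > 0" "\<kappa> \<le> \<eta>" "\<kappa> \<le> 1 / a\<^sup>2" using a \<eta> by (auto simp: \<kappa>_def)
  have c: "c > 0" "c \<le> \<kappa>" "c \<le> c1" using \<kappa> c1 by (auto simp: c_def)
  have C: "C > 0" using \<eta> by (simp add: C_def add_pos_pos)
  show ?thesis
  proof (rule exI[of _ c], rule exI[of _ C], intro conjI c(1) C allI impI)
    fix \<mu> :: "nat pmf"
    assume h: "pmf \<mu> 0 + pmf \<mu> 1 < 1 - \<epsilon>" "pmf \<mu> 0 / (pmf \<mu> 0 + pmf \<mu> 1) > \<epsilon>"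
    obtain N where N: "\<And>n. n \<ge> N \<Longrightarrow>
        (\<Sum>d | d \<in> degree_seqs {..<n} (n - 1) \<and> real (card {i. i < n \<and> d i = 0}) < \<delta> * n. \<Prod>i<n. pmf \<mu> (d i))
         \<le> exp (- c1 * n) * (\<Sum>d\<in>degree_seqs {..<n} (n - 1). \<Prod>i<n. pmf \<mu> (d i))"
      using rare[OF h] by blast
    interpret prob_space "branching \<mu>" by (rule prob_space_branching)
    show "\<exists>N :: nat. \<forall>n\<ge>N.
          \<P>(\<xi> in branching \<mu>. finite (family_tree \<xi>) \<and> card (family_tree \<xi>) = n) > 0 \<longrightarrow>
          (\<forall>x :: real. x > 0 \<longrightarrow>
             \<P>(\<xi> in branching \<mu>. real (ht (family_tree \<xi>)) \<ge> x * sqrt (real n) \<bar>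
                finite (family_tree \<xi>) \<and> card (family_tree \<xi>) = n)
             < C * exp (- c * x\<^sup>2))"
    proof (intro exI[of _ "N + 1"] allI impI)
      fix n :: nat and x :: real
      assume n: "N + 1 \<le> n" and pos: "0 < \<P>(\<xi> in branching \<mu>. finite (family_tree \<xi>) \<and> card (family_tree \<xi>) = n)"
        and x: "0 < x"
      have n1: "n \<ge> 1" using n by simp
      define S where "S j = (\<Sum>t | t \<in> plane_trees n \<and> j \<le> ht t. \<Prod>u\<in>t. pmf \<mu> (num_children t u))" for j
      define h where "h = nat \<lceil>x * sqrt n\<rceil>"
      have hge: "real m \<ge> x * sqrt n \<longleftrightarrow> h \<le> m" for m
        using x by (auto simp: h_def nat_le_iff ceiling_le_iff)
      have P0: "\<P>(\<xi> in branching \<mu>. finite (family_tree \<xi>) \<and> card (family_tree \<xi>) = n) = S 0"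
        using prob_tall_family_tree[OF n1, of \<mu> 0] by (simp add: S_def)
      have Ph: "\<P>(\<xi> in branching \<mu>. real (ht (family_tree \<xi>)) \<ge> x * sqrt n \<and> finite (family_tree \<xi>) \<and> card (family_tree \<xi>) = n) = S h"
        using prob_tall_family_tree[OF n1, of \<mu> h] by (simp add: S_def hge)
      have S0: "S 0 > 0" using pos P0 by simp
      have cond: "\<P>(\<xi> in branching \<mu>. real (ht (family_tree \<xi>)) \<ge> x * sqrt (real n) \<bar>
                finite (family_tree \<xi>) \<and> card (family_tree \<xi>) = n) = S h / S 0"
        unfolding cond_prob_def Ph P0 ..
      have Sle: "S h \<le> S 0"
        unfolding S_def using finite_plane_trees[OF n1] by (intro sum_mono2) (auto intro: prod_nonneg)
      define K where "K = nat \<lfloor>\<kappa> * x\<^sup>2\<rfloor>"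
      have K: "real K \<le> \<kappa> * x\<^sup>2" "\<kappa> * x\<^sup>2 < real K + 1"
        using \<kappa> by (auto simp: K_def)
      show "\<P>(\<xi> in branching \<mu>. real (ht (family_tree \<xi>)) \<ge> x * sqrt (real n) \<bar>
                finite (family_tree \<xi>) \<and> card (family_tree \<xi>) = n) < C * exp (- c * x\<^sup>2)"
      proof (cases "x\<^sup>2 < n")
        case False
        have "S h = 0"
        proof -
          have "x * sqrt n \<ge> sqrt n * sqrt n"
            using False x by (intro mult_right_mono real_le_lsqrt) auto
          then have "x * sqrt n \<ge> n" by simp
          then have "n \<le> h" unfolding h_def by linarith
          then have "{t. t \<in> plane_trees n \<and> h \<le> ht t} = {}"
            using ht_less_card by (fastforce simp: plane_trees_def)
          then show ?thesis by (simp only: S_def sum.empty)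
        qed
        then show ?thesis unfolding cond using C by simp
      next
        case True
        show ?thesis
        proof (cases "K < 4")
          case True
          have "S h / S 0 \<le> 1" using Sle S0 by simp
          also have "1 < C * exp (- c * x\<^sup>2)"
          proof -
            have "c * x\<^sup>2 \<le> \<kappa> * x\<^sup>2" using c by (intro mult_right_mono) auto
            then have "c * x\<^sup>2 \<le> 4" using K True by linarith
            then have "exp (c * x\<^sup>2) \<le> exp 4" by simp
            also have "exp 4 = exp (1::real) ^ 4" by (simp flip: exp_of_nat_mult)
            also have "\<dots> \<le> 3 ^ 4" using exp_le by (intro power_mono) auto
            also have "\<dots> < C" using \<eta> by (simp add: C_def add_pos_pos)
            finally show ?thesis by (simp add: exp_minus field_simps)
          qed
          finally show ?thesis unfolding cond .
        next
          case False
          have "S h \<le> ((5 + 1 / \<eta>) * exp (- real K) + exp (- c1 * n)) * S 0"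
            unfolding S_def
          proof (rule prob_tall_le[OF n1 \<delta> \<eta>_def _ _ _ N])
            show "4 \<le> K" using False by simp
            have "real K \<le> \<eta> * x\<^sup>2" using K \<kappa> by (meson mult_right_mono order_trans zero_le_power2)
            also have "\<dots> \<le> \<eta> * n" using True \<eta> by simp
            finally show "real K \<le> \<eta> * n" .
            have "real K \<le> 1 / a\<^sup>2 * x\<^sup>2" using K \<kappa> by (meson mult_right_mono order_trans zero_le_power2)
            then have "real K * n \<le> (x / a)\<^sup>2 * n" by (intro mult_right_mono) (auto simp: power_divide)
            then have "sqrt (real K * n) \<le> sqrt ((x / a)\<^sup>2 * n)" by simp
            also have "\<dots> = x / a * sqrt n" using x a by (simp add: real_sqrt_mult)
            finally have "a * sqrt (real K * n) \<le> a * (x / a * sqrt n)" using a by (intro mult_left_mono) auto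
            also have "\<dots> = x * sqrt n" using a by simp
            also have "\<dots> \<le> h" using x by (simp add: h_def)
            finally show "(8 / sqrt \<delta> + 32 / sqrt \<eta> + 2) * sqrt (real K * n) \<le> h" by (simp add: a_def)
            show "N \<le> n" using n by simp
          qed
          then have "S h / S 0 \<le> (5 + 1 / \<eta>) * exp (- real K) + exp (- c1 * n)"
            using S0 by (simp add: pos_divide_le_eq)
          also have "\<dots> \<le> (5 + 1 / \<eta>) * (3 * exp (- c * x\<^sup>2)) + exp (- c * x\<^sup>2)"
          proof (intro add_mono mult_left_mono)
            have "c * x\<^sup>2 \<le> \<kappa> * x\<^sup>2" using c by (intro mult_right_mono) auto
            then have "exp (- real K) \<le> exp (1 + - c * x\<^sup>2)" using K by simp
            also have "\<dots> = exp 1 * exp (- c * x\<^sup>2)" by (rule exp_add)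
            also have "\<dots> \<le> 3 * exp (- c * x\<^sup>2)" using exp_le by (intro mult_right_mono) auto
            finally show "exp (- real K) \<le> 3 * exp (- c * x\<^sup>2)" .
            have "c * x\<^sup>2 \<le> c1 * n" using c True by (intro mult_mono) auto
            then show "exp (- c1 * n) \<le> exp (- c * x\<^sup>2)" by simp
          qed (use \<eta> in simp)
          also have "\<dots> < C * exp (- c * x\<^sup>2)" by (simp add: C_def algebra_simps)
          finally show ?thesis unfolding cond .
        qed
      qed
    qed
  qed
qed

end
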